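(* Let $\widehat S\in\mathrm{Mp}(n,\mathbb{R})$ have projection $S=\begin{pmatrix}A&B\\C&D\end{pmatrix}\in\mathrm{Sp}(n,\mathbb{R})$ and assume $r=\mathrm{rank}(B)>0$. Then for every $f\in\mathcal S(\mathbb{R}^n)$, $$\int_{\mathbb{R}^n}\log\big|B^{+}\mathcal P_{R(B)}^{A(\ker(B))}\xi\big|\,|\widehat Sf(\xi)|^2\,\mathrm d\xi+\int_{\mathbb{R}^n}\log\big|\mathcal P_{\ker(B)^\perp}^{D^\top A(\ker(B))}x\big|\,|f(x)|^2\,\mathrm dx\ \ge\ \tilde K_r\|f\|_2^2,$$ where $\tilde K_r=\psi(r/4)-\ln\pi$ and $\psi(t)=\frac{\mathrm d}{\mathrm dt}\ln\Gamma(t)$.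
   Context: $\log=\ln$ is the natural logarithm. Metaplectic operators: let $J=\begin{pmatrix}O&I\\-I&O\end{pmatrix}$ and let $\mathrm{Sp}(n,\mathbb{R})$ be the group of real $2n\times2n$ matrices with $S^\top JS=J$; the blocks $A,B,C,D$ of $S$ are $n\times n$. For $x,\xi\in\mathbb{R}^n,\tau\in\mathbb{R}$ let $\rho(x,\xi;\tau)f(t)=e^{2\pi i\tau}e^{-i\pi x\cdot\xi}e^{2\pi i\xi\cdot t}f(t-x)$ on $L^2(\mathbb{R}^n)$. For each $S\in\mathrm{Sp}(n,\mathbb{R})$ there is a unitary operator $\widehat S$ on $L^2(\mathbb{R}^n)$, unique up to a unimodular constant, with $\widehat S\rho(x,\xi;\tau)\widehat S^{-1}=\rho(S(x,\xi);\tau)$ for all $x,\xi,\tau$. The metaplectic group $\mathrm{Mp}(n,\mathbb{R})$ is the subgroup of the group of all such operators containing precisely two operators (differing by a sign) for each $S$; the map $\widehat S\mapsto S$ is a homomorphism (the projection). Each $\widehat S\in\mathrm{Mp}(n,\mathbb{R})$ restricts to a homeomorphism of $\mathcal S(\mathbb{R}^n)$. $B^+$ is the Moore–Penrose inverse of $B$ and $R(B)$ its range. For every symplectic $S$ one has $\mathbb{R}^n=\ker(B)^\perp\oplus D^\top A(\ker(B))=R(B)\oplus A(\ker(B))$. For $\mathbb{R}^n=\mathcal L_1\oplus\mathcal L_2$, $\mathcal P_{\mathcal L_1}^{\mathcal L_2}$ denotes the projection onto $\mathcal L_1$ along $\mathcal L_2$ (the identity if $\mathcal L_2=\{0\}$).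 *)

theory Defs
  imports "HOL-Analysis.Analysis" "HOL-Algebra.Bij"
begin

section \<open>The Hilbert space of square-integrable functions\<close>

definition sq_integrable :: "(real^'n::finite \<Rightarrow> complex) \<Rightarrow> bool" where
  "sq_integrable f \<longleftrightarrow>
     f \<in> borel_measurable lborel \<and> integrable lborel (\<lambda>x. (cmod (f x))\<^sup>2)"

definition l2_rel :: "(real^'n::finite \<Rightarrow> complex) \<Rightarrow> (real^'n \<Rightarrow> complex) \<Rightarrow> bool" where
  "l2_rel f g \<longleftrightarrow> sq_integrable f \<and> sq_integrable g \<and> (AE x in lborel. f x = g x)"

lemma sq_integrable_add:
  assumes "sq_integrable f" "sq_integrable g"
  shows "sq_integrable (\<lambda>x. f x + g x)"
proof -
  have [measurable]: "f \<in> borel_measurable borel" "g \<in> borel_measurable borel"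
    using assms by (auto simp: sq_integrable_def)
  have bound: "(cmod (f x + g x))\<^sup>2 \<le> 2 * (cmod (f x))\<^sup>2 + 2 * (cmod (g x))\<^sup>2" for x
  proof -
    have "(cmod (f x + g x))\<^sup>2 \<le> (cmod (f x) + cmod (g x))\<^sup>2"
      by (intro power_mono norm_triangle_ineq) auto
    also have "\<dots> \<le> 2 * (cmod (f x))\<^sup>2 + 2 * (cmod (g x))\<^sup>2"
      using sum_squares_bound[of "cmod (f x)" "cmod (g x)"] by (simp add: power2_sum)
    finally show ?thesis .
  qed
  have "integrable lborel (\<lambda>x. (cmod (f x + g x))\<^sup>2)"
    by (rule Bochner_Integration.integrable_bound
          [of _ "\<lambda>x. 2 * (cmod (f x))\<^sup>2 + 2 * (cmod (g x))\<^sup>2"])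
       (use assms bound in \<open>auto simp: sq_integrable_def\<close>)
  then show ?thesis by (simp add: sq_integrable_def)
qed

lemma sq_integrable_scale: "sq_integrable f \<Longrightarrow> sq_integrable (\<lambda>x. c * f x)"
  by (auto simp: sq_integrable_def norm_mult power_mult_distrib)

lemma AE_lborel_translate:
  fixes a :: "'a::euclidean_space"
  assumes "AE x in lborel. P x"
  shows "AE x in lborel. P (x - a)"
proof -
  have "AE x in distr lborel borel ((+) (-a)). P x"
    using assms unfolding lborel_distr_plus .
  then have "AE x in lborel. P (- a + x)"
    by (rule AE_distrD[rotated]) simp
  then show ?thesis by (simp add: add.commute)
qed

lemma sq_integrable_translate:
  assumes "sq_integrable f"
  shows "sq_integrable (\<lambda>x. f (x - a))"
proof -
  have [measurable]: "f \<in> borel_measurable borel"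
    using assms by (auto simp: sq_integrable_def)
  have "integrable (distr lborel borel ((+) (-a))) (\<lambda>x. (cmod (f x))\<^sup>2)"
    using assms unfolding lborel_distr_plus sq_integrable_def by blast
  then have "integrable lborel (\<lambda>x. (cmod (f (- a + x)))\<^sup>2)"
    by (subst (asm) integrable_distr_eq) auto
  then show ?thesis by (simp add: sq_integrable_def add.commute)
qed

quotient_type (overloaded) 'n L2 = "real^'n::finite \<Rightarrow> complex" / partial: l2_rel
proof (rule part_equivpI)
  show "\<exists>f::real^'n \<Rightarrow> complex. l2_rel f f"
    by (rule exI[of _ "\<lambda>_. 0"]) (auto simp: l2_rel_def sq_integrable_def)
  show "symp (l2_rel :: (real^'n \<Rightarrow> complex) \<Rightarrow> _)"
    by (auto simp: symp_def l2_rel_def elim: AE_mp)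
  show "transp (l2_rel :: (real^'n \<Rightarrow> complex) \<Rightarrow> _)"
    by (auto simp: transp_def l2_rel_def elim: AE_mp)
qed

lift_definition l2_add :: "'n::finite L2 \<Rightarrow> 'n L2 \<Rightarrow> 'n L2" is "\<lambda>f g x. f x + g x"
  by (auto simp: l2_rel_def sq_integrable_add elim: AE_mp)

lift_definition l2_scale :: "complex \<Rightarrow> 'n::finite L2 \<Rightarrow> 'n L2" is "\<lambda>c f x. c * f x"
  by (auto simp: l2_rel_def sq_integrable_scale elim: AE_mp)

lemma borel_measurable_mult_cnj:
  assumes "f \<in> borel_measurable borel" "g \<in> borel_measurable borel"
  shows "(\<lambda>x. f x * cnj (g x)) \<in> borel_measurable borel"
  using borel_measurable_continuous_onI[OF continuous_on_cnj[OF continuous_on_id]] assms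
  by (intro borel_measurable_times) (auto intro: measurable_compose)

lift_definition l2_inner :: "'n::finite L2 \<Rightarrow> 'n L2 \<Rightarrow> complex"
  is "\<lambda>f g. \<integral>x. f x * cnj (g x) \<partial>lborel"
  by (rule integral_cong_AE)
     (auto simp: l2_rel_def sq_integrable_def borel_measurable_mult_cnj elim: AE_mp)

definition unitary_op :: "('n::finite L2 \<Rightarrow> 'n L2) \<Rightarrow> bool" where
  "unitary_op T \<longleftrightarrow>
     (\<forall>f g. T (l2_add f g) = l2_add (T f) (T g)) \<and>
     (\<forall>c f. T (l2_scale c f) = l2_scale c (T f)) \<and>
     (\<forall>f g. l2_inner (T f) (T g) = l2_inner f g) \<and>
     surj T"

section \<open>Symplectic matrices and metaplectic operators\<close>

definition block_mat ::
  "real^'n^'n \<Rightarrow> real^'n^'n \<Rightarrow> real^'n^'n \<Rightarrow> real^'n^'n \<Rightarrow> real^('n::finite + 'n)^('n + 'n)" where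
  "block_mat A B C D = (\<chi> i j.
     case i of
       Inl p \<Rightarrow> (case j of Inl q \<Rightarrow> A $ p $ q | Inr q \<Rightarrow> B $ p $ q)
     | Inr p \<Rightarrow> (case j of Inl q \<Rightarrow> C $ p $ q | Inr q \<Rightarrow> D $ p $ q))"

definition symplectic :: "real^('n::finite + 'n)^('n + 'n) \<Rightarrow> bool" where
  "symplectic S \<longleftrightarrow>
     (let J = block_mat 0 (mat 1) (- mat 1) 0 in transpose S ** J ** S = J)"

text \<open>A phase space point \<open>z = (x, \<xi>)\<close> has position \<open>x\<close> and momentum \<open>\<xi>\<close>.\<close>

definition position :: "real^('n::finite + 'n) \<Rightarrow> real^'n" where
  "position z = (\<chi> i. z $ Inl i)"

definition momentum :: "real^('n::finite + 'n) \<Rightarrow> real^'n" where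
  "momentum z = (\<chi> i. z $ Inr i)"

lift_definition rho :: "real^'n \<Rightarrow> real^'n \<Rightarrow> real \<Rightarrow> 'n::finite L2 \<Rightarrow> 'n L2"
  is "\<lambda>x \<xi> \<tau> f t. cis (2 * pi * \<tau>) * cis (- pi * (x \<bullet> \<xi>)) * cis (2 * pi * (\<xi> \<bullet> t)) * f (t - x)"
proof -
  fix x \<xi> :: "real^'n" and \<tau> :: real and f g :: "real^'n \<Rightarrow> complex"
  let ?m = "\<lambda>f t. cis (2 * pi * \<tau>) * cis (- pi * (x \<bullet> \<xi>)) * cis (2 * pi * (\<xi> \<bullet> t)) * f (t - x)"
  assume fg: "l2_rel f g"
  have sq: "sq_integrable (?m h)" if "sq_integrable h" for h :: "real^'n \<Rightarrow> complex"
  proof -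
    have cis_meas: "(\<lambda>t. cis (2 * pi * (\<xi> \<bullet> t))) \<in> borel_measurable borel"
      by (intro borel_measurable_continuous_onI continuous_intros)
    show ?thesis
      using sq_integrable_translate[OF that, of x] cis_meas
      by (auto simp: sq_integrable_def norm_mult)
  qed
  show "l2_rel (?m f) (?m g)"
    using fg sq AE_lborel_translate[of "\<lambda>t. f t = g t" x]
    by (auto simp: l2_rel_def elim: AE_mp)
qed

definition metaplectic_over :: "('n::finite L2 \<Rightarrow> 'n L2) \<Rightarrow> real^('n + 'n)^('n + 'n) \<Rightarrow> bool" where
  "metaplectic_over T S \<longleftrightarrow> unitary_op T \<and>
     (\<forall>z \<tau>. T \<circ> rho (position z) (momentum z) \<tau> \<circ> inv_into UNIV T
            = rho (position (S *v z)) (momentum (S *v z)) \<tau>)"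

text \<open>
  Exactly one subgroup satisfies this predicate: the kernel of the projection is
  \<open>{I, -I}\<close>, and as the symplectic group is perfect, two such subgroups cannot differ by a
  nontrivial character.  So quantifying over all \<open>G\<close> with \<open>metaplectic_group G\<close> is quantifying
  over the one group.
\<close>

definition metaplectic_group :: "('n::finite L2 \<Rightarrow> 'n L2) set \<Rightarrow> bool" where
  "metaplectic_group G \<longleftrightarrow>
     subgroup G (BijGroup UNIV) \<and>
     G \<subseteq> {T. \<exists>S. symplectic S \<and> metaplectic_over T S} \<and>
     (\<forall>S. symplectic S \<longrightarrow>
        (\<exists>T. {U \<in> G. metaplectic_over U S} = {T, l2_scale (-1) \<circ> T}))"

section \<open>Schwartz functions\<close>

definition partial_deriv :: "'n \<Rightarrow> (real^'n::finite \<Rightarrow> complex) \<Rightarrow> real^'n \<Rightarrow> complex" where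
  "partial_deriv i f = (\<lambda>x. frechet_derivative f (at x) (axis i 1))"

text \<open>
  The list \<open>is\<close> enumerates the variables of an iterated partial derivative, outermost first;
  every multi-index is represented by some list.
\<close>

fun iterated_partial :: "'n list \<Rightarrow> (real^'n::finite \<Rightarrow> complex) \<Rightarrow> real^'n \<Rightarrow> complex" where
  "iterated_partial [] f = f"
| "iterated_partial (i # is) f = partial_deriv i (iterated_partial is f)"

definition schwartz :: "(real^'n::finite \<Rightarrow> complex) \<Rightarrow> bool" where
  "schwartz f \<longleftrightarrow>
     (\<forall>is. \<forall>x. iterated_partial is f differentiable (at x)) \<and>
     (\<forall>(\<alpha> :: 'n \<Rightarrow> nat) is. \<exists>M. \<forall>x.
        cmod (of_real (\<Prod>i\<in>UNIV. (x $ i) ^ \<alpha> i) * iterated_partial is f x) \<le> M)"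

section \<open>Linear algebra\<close>

definition moore_penrose :: "real^'n^'m \<Rightarrow> real^'m::finite^'n::finite" where
  "moore_penrose B = (THE X.
     B ** X ** B = B \<and> X ** B ** X = X \<and>
     transpose (B ** X) = B ** X \<and> transpose (X ** B) = X ** B)"

definition ker :: "real^'n^'m \<Rightarrow> (real^'n::finite) set" where
  "ker B = {x. B *v x = 0}"

text \<open>The projection onto \<open>L1\<close> along \<open>L2\<close>; meaningful when the space is \<open>L1 \<oplus> L2\<close>.\<close>

definition proj_along :: "(real^'n) set \<Rightarrow> (real^'n) set \<Rightarrow> real^'n \<Rightarrow> real^'n::finite" where
  "proj_along L1 L2 x = (THE u. u \<in> L1 \<and> x - u \<in> L2)"

section \<open>The digamma function\<close>

lemma Digamma_eq_deriv_ln_Gamma: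
  fixes t :: real
  assumes "t > 0"
  shows "Digamma t = deriv (\<lambda>s. ln (Gamma s)) t"
proof -
  have "eventually (\<lambda>s::real. s > 0) (nhds t)"
    using assms by (intro eventually_nhds_in_open[of "{0<..}", simplified]) auto
  then have ev: "eventually (\<lambda>s. ln_Gamma s = ln (Gamma s)) (nhds t)"
    by eventually_elim (simp add: Gamma_real_pos_exp)
  have "((\<lambda>s. ln (Gamma s)) has_field_derivative Digamma t) (at t)"
    using has_field_derivative_ln_Gamma_real[OF assms] DERIV_cong_ev[OF refl ev refl] by blast
  then show ?thesis by (simp add: DERIV_imp_deriv)
qed

end

theory Submission
  imports Defs "HOL-Probability.Probability"
begin

text \<open>
  Write \<open>y = P x\<close> and \<open>\<eta> = B\<^sup>+ P \<xi>\<close> for the two projected variables; both range over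
  \<open>V = (ker B)\<^sup>\<bottom>\<close>, which has dimension \<open>r\<close>.  No Fourier transform is needed: by the intertwining
  relation, the characteristic function of \<open>\<eta>\<close> under \<open>|T f|\<^sup>2\<close> at \<open>c \<in> V\<close> is
  \<open>\<langle>\<rho>(z) f, f\<rangle>\<close> with \<open>S z = (0, w)\<close>, and \<open>\<rho>(z)\<close> is, up to phases, the
  translation by \<open>-c\<close>.  Dropping the phases and averaging over Gaussians in \<open>c\<close> bounds
  \<open>\<integral> exp(-\<pi>t|\<eta>|\<^sup>2) |T f|\<^sup>2\<close> by a Gaussian average of
  \<open>\<integral> |f(s + c)| |f(s)| ds\<close>.  The arithmetic-geometric mean inequality with the weight
  \<open>|y|\<^bsup>-r/2\<^esup>\<close> and integration against \<open>t\<^bsup>\<epsilon>-1\<^esup> dt\<close> then give, with \<open>k = r/4\<close>,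
  \<open>\<integral> |\<eta>|\<^bsup>-2\<epsilon>\<^esup> |T f|\<^sup>2 \<le> \<pi>\<^bsup>2\<epsilon>\<^esup> \<Gamma>(k-\<epsilon>)/\<Gamma>(k+\<epsilon>) \<integral> |y|\<^bsup>2\<epsilon>\<^esup> |f|\<^sup>2.\<close>
  This is an equality to zeroth order in \<open>\<epsilon>\<close>, and comparing first-order terms at \<open>\<epsilon> = 0\<close> yields
  the logarithmic inequality.  The same argument with \<open>f\<close> and \<open>T f\<close> exchanged supplies the
  integrability of \<open>|y|\<^bsup>-2\<epsilon>\<^esup> |f|\<^sup>2\<close>.
\<close>

section \<open>Gamma integrals and Gaussians on the line\<close>

text \<open>The exponent of the weight is what produces \<open>Digamma (r / 4)\<close>. With |y| to
  the power -2j in its place, 0 < j < r/2, the same computation would give the constant Gamma(j - e)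
  Gamma(r/2 - j) / (Gamma(j) Gamma(r/2 - j + e)) up to the power of \<open>pi\<close>, and in the
  limit the mean of psi(j) and psi(r/2 - j) instead of psi(r/4). As psi is concave, j = r/4 is the
  best choice. The logarithmic integrals must be shown to converge. Negative powers control the
  logarithm near zero; at infinity it is controlled by second moments. For y under |f|^2 the second
  moment comes from Schwartz decay. For \<eta> under |T f|^2 it comes from the intertwining relation
  again: the squared distance from \<rho>(t z) f to f is O(t^2) for Schwartz f, and when S z = (0,
  w) it equals the integral of 2 - 2 cos(2 pi t w . \<xi>) against |T f|^2; Fatou's lemma then lets
  t tend to 0. Smoothness or decay of T f is never invoked.\<close>

text \<open>
  Powers are written as superpositions of exponentials after the substitution \<open>t = exp s\<close>, so that
  every integral runs over the whole line and scaling becomes translation.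
\<close>

lemma nn_integral_exp_Gamma:
  fixes x q :: real
  assumes "x > 0" "q > 0"
  shows "(\<integral>\<^sup>+s. ennreal (exp (x * s - q * exp s)) \<partial>lborel) = ennreal (Gamma x * q powr - x)"
proof -
  have rng: "range exp = {0::real<..}"
    by (auto simp: image_iff) (metis exp_ln)
  have ai: "(\<lambda>t. t powr (x - 1) / exp t) absolutely_integrable_on {0<..} \<and>
      integral {0<..} (\<lambda>t. t powr (x - 1) / exp t) = Gamma x"
  proof -
    have "((\<lambda>t. if t \<in> {0<..} then t powr (x - 1) / exp t else 0) has_integral Gamma x) {0..}"
      by (rule has_integral_spike[of "{0}", rotated 2, OF Gamma_integral_real[OF assms(1)]]) auto
    then have "((\<lambda>t. t powr (x - 1) / exp t) has_integral Gamma x) {0<..}"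
      by (subst (asm) has_integral_restrict) auto
    then show ?thesis
      by (auto intro!: nonnegative_absolutely_integrable_1 simp: has_integral_iff)
  qed
  have "(\<lambda>s. \<bar>exp s\<bar> * (exp s powr (x - 1) / exp (exp s))) absolutely_integrable_on UNIV \<and>
      integral UNIV (\<lambda>s. \<bar>exp s\<bar> * (exp s powr (x - 1) / exp (exp s))) = Gamma x"
    using has_absolute_integral_change_of_variables_1'[of UNIV exp exp "\<lambda>t. t powr (x - 1) / exp t" "Gamma x"] ai
    by (auto simp: rng inj_on_def intro!: derivative_eq_intros)
  moreover have "\<bar>exp s\<bar> * (exp s powr (x - 1) / exp (exp s)) = exp (x * s - exp s)" for s :: real
    by (simp add: powr_def exp_diff[symmetric] exp_add[symmetric] algebra_simps)
  ultimately have "((\<lambda>s. exp (x * s - exp s)) has_integral Gamma x) UNIV"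
    by (auto simp: has_integral_iff absolutely_integrable_on_def)
  then have 1: "(\<integral>\<^sup>+s. ennreal (exp (x * s - exp s)) \<partial>lborel) = ennreal (Gamma x)"
    by (intro nn_integral_has_integral_lborel) auto
  \<comment> \<open>Shifting \<open>s\<close> by \<open>ln q\<close> is scaling by \<open>q\<close>
    in the variable \<open>exp s\<close>.\<close>
  have e: "exp (x * (ln q + 1 * s) - exp (ln q + 1 * s)) = q powr x * exp (x * s - q * exp s)" for s
    using assms by (simp add: powr_def exp_diff exp_add algebra_simps)
  have "ennreal (Gamma x) = (\<integral>\<^sup>+s. ennreal (q powr x * exp (x * s - q * exp s)) \<partial>lborel)"
    unfolding 1[symmetric]
    by (subst nn_integral_real_affine[of _ 1 "ln q"]) (simp_all only: e, auto)
  also have "\<dots> = ennreal (q powr x) * (\<integral>\<^sup>+s. ennreal (exp (x * s - q * exp s)) \<partial>lborel)"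
    by (simp add: ennreal_mult' nn_integral_cmult)
  finally have g: "ennreal (Gamma x) = \<dots>" .
  have "ennreal (Gamma x * q powr - x) = ennreal (q powr - x) * ennreal (Gamma x)"
    using assms by (simp add: ennreal_mult'' mult.commute)
  also have "\<dots> = ennreal (q powr - x * q powr x) * (\<integral>\<^sup>+s. ennreal (exp (x * s - q * exp s)) \<partial>lborel)"
    unfolding g by (simp add: ennreal_mult' mult.assoc)
  also have "q powr - x * q powr x = 1"
    using assms by (simp add: powr_minus field_simps)
  finally show ?thesis by simp
qed

text \<open>The Beta integral in the variable \<open>exp s\<close>. Multiplication by
  \<open>Gamma (a + b)\<close> turns the power of \<open>1 + exp s\<close> into a Gamma integral
  over \<open>w\<close>; in the other order of integration both integrals are of Gamma type.\<close>

lemma nn_integral_exp_Beta: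
  fixes a b :: real
  assumes "a > 0" "b > 0"
  shows "(\<integral>\<^sup>+s. ennreal (exp (a * s) * (1 + exp s) powr - (a + b)) \<partial>lborel)
    = ennreal (Gamma a * Gamma b / Gamma (a + b))"
proof -
  let ?I = "\<integral>\<^sup>+s. ennreal (exp (a * s) * (1 + exp s) powr - (a + b)) \<partial>lborel"
  have "ennreal (Gamma (a + b)) * ?I
      = (\<integral>\<^sup>+s. ennreal (exp (a * s)) * ennreal (Gamma (a + b) * (1 + exp s) powr - (a + b)) \<partial>lborel)"
    using assms
    by (subst nn_integral_cmult[symmetric])
       (auto simp: ennreal_mult'[symmetric] mult_ac)
  also have "\<dots> = (\<integral>\<^sup>+s. (\<integral>\<^sup>+w. ennreal (exp (a * s)) * ennreal (exp ((a + b) * w - (1 + exp s) * exp w)) \<partial>lborel) \<partial>lborel)"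
    using assms
    by (simp add: nn_integral_cmult nn_integral_exp_Gamma add_pos_pos)
  also have "\<dots> = (\<integral>\<^sup>+w. (\<integral>\<^sup>+s. ennreal (exp (a * s)) * ennreal (exp ((a + b) * w - (1 + exp s) * exp w)) \<partial>lborel) \<partial>lborel)"
    by (rule lborel_pair.Fubini') auto
  also have "\<dots> = (\<integral>\<^sup>+w. (\<integral>\<^sup>+s. ennreal (exp ((a + b) * w - exp w)) * ennreal (exp (a * s - exp w * exp s)) \<partial>lborel) \<partial>lborel)"
    by (intro nn_integral_cong)
       (simp add: ennreal_mult'[symmetric] exp_add[symmetric] algebra_simps)
  also have "\<dots> = (\<integral>\<^sup>+w. ennreal (Gamma a) * ennreal (exp (b * w - 1 * exp w)) \<partial>lborel)"
  proof (intro nn_integral_cong)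
    fix w :: real
    have "(\<integral>\<^sup>+s. ennreal (exp ((a + b) * w - exp w)) * ennreal (exp (a * s - exp w * exp s)) \<partial>lborel)
      = ennreal (exp ((a + b) * w - exp w)) * ennreal (Gamma a * exp w powr - a)"
      using assms by (subst nn_integral_cmult) (auto simp: nn_integral_exp_Gamma)
    also have "\<dots> = ennreal (Gamma a * (exp ((a + b) * w - exp w) * exp w powr - a))"
      using assms by (simp add: ennreal_mult'[symmetric] mult_ac Gamma_real_pos less_imp_le)
    also have "exp ((a + b) * w - exp w) * exp w powr - a = exp (b * w - 1 * exp w)"
      by (simp add: powr_def exp_add[symmetric] algebra_simps)
    finally show "(\<integral>\<^sup>+s. ennreal (exp ((a + b) * w - exp w)) * ennreal (exp (a * s - exp w * exp s)) \<partial>lborel)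
       = ennreal (Gamma a) * ennreal (exp (b * w - 1 * exp w))"
      using assms by (simp add: ennreal_mult'')
  qed
  also have "\<dots> = ennreal (Gamma a * Gamma b)"
    using assms nn_integral_exp_Gamma[of b 1] by (simp add: nn_integral_cmult ennreal_mult'')
  finally have *: "ennreal (Gamma (a + b)) * ?I = ennreal (Gamma a * Gamma b)" .
  have g: "Gamma (a + b) > 0" using assms by (simp add: Gamma_real_pos)
  have "?I = ennreal (1 / Gamma (a + b)) * (ennreal (Gamma (a + b)) * ?I)"
    using g by (simp add: mult.assoc[symmetric] ennreal_mult'[symmetric])
  also have "\<dots> = ennreal (Gamma a * Gamma b / Gamma (a + b))"
    unfolding * using g by (simp add: ennreal_mult'[symmetric])
  finally show ?thesis .
qed

text \<open>Shifting \<open>s\<close> by \<open>- v\<close> uncouples the variables. Then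
  \<open>v\<close> carries a Gamma integral of order \<open>k - e\<close> with rate
  \<open>Y / (1 + exp s)\<close>, convergent because \<open>e < k\<close>, and the powers of
  \<open>1 + exp s\<close> combine to the exponent \<open>- (e + k)\<close>, which leaves a Beta
  integral in \<open>s\<close>.\<close>

lemma nn_integral_Gamma_Beta:
  fixes k e Y :: real
  assumes "0 < e" "e < k" "Y > 0"
  shows "(\<integral>\<^sup>+s. \<integral>\<^sup>+v. ennreal (exp (e * s + k * v - Y * exp v / (1 + exp (s + v)))
        * (1 + exp (s + v)) powr - (2 * k)) \<partial>lborel \<partial>lborel)
    = ennreal (Gamma (k - e) * Gamma e * Gamma k / Gamma (k + e) * Y powr (e - k))"
    (is "?L = _")
proof -
  have "?L = (\<integral>\<^sup>+v. \<integral>\<^sup>+s. ennreal (exp (e * s + k * v - Y * exp v / (1 + exp (s + v)))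
        * (1 + exp (s + v)) powr - (2 * k)) \<partial>lborel \<partial>lborel)"
    by (rule lborel_pair.Fubini') auto
  also have "\<dots> = (\<integral>\<^sup>+v. \<integral>\<^sup>+s. ennreal (exp (e * s + (k - e) * v - (Y / (1 + exp s)) * exp v)
        * (1 + exp s) powr - (2 * k)) \<partial>lborel \<partial>lborel)"
  proof (rule nn_integral_cong)
    fix v :: real
    show "(\<integral>\<^sup>+s. ennreal (exp (e * s + k * v - Y * exp v / (1 + exp (s + v))) * (1 + exp (s + v)) powr - (2 * k)) \<partial>lborel)
      = (\<integral>\<^sup>+s. ennreal (exp (e * s + (k - e) * v - (Y / (1 + exp s)) * exp v) * (1 + exp s) powr - (2 * k)) \<partial>lborel)"
      by (subst nn_integral_real_affine[of _ 1 "- v"]) (auto simp: algebra_simps)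
  qed
  also have "\<dots> = (\<integral>\<^sup>+s. \<integral>\<^sup>+v. ennreal (exp (e * s + (k - e) * v - (Y / (1 + exp s)) * exp v)
        * (1 + exp s) powr - (2 * k)) \<partial>lborel \<partial>lborel)"
    by (rule lborel_pair.Fubini') auto
  also have "\<dots> = (\<integral>\<^sup>+s. ennreal (Gamma (k - e) * Y powr (e - k)) * ennreal (exp (e * s) * (1 + exp s) powr - (e + k)) \<partial>lborel)"
  proof (intro nn_integral_cong)
    fix s :: real
    have pos: "1 + exp s > 0" by (simp add: add_pos_pos)
    have "(\<integral>\<^sup>+v. ennreal (exp (e * s + (k - e) * v - (Y / (1 + exp s)) * exp v) * (1 + exp s) powr - (2 * k)) \<partial>lborel)
      = (\<integral>\<^sup>+v. ennreal (exp (e * s) * (1 + exp s) powr - (2 * k)) * ennreal (exp ((k - e) * v - (Y / (1 + exp s)) * exp v)) \<partial>lborel)"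
      by (intro nn_integral_cong) (simp add: ennreal_mult'[symmetric] exp_add exp_diff algebra_simps)
    also have "\<dots> = ennreal (exp (e * s) * (1 + exp s) powr - (2 * k)) * ennreal (Gamma (k - e) * (Y / (1 + exp s)) powr - (k - e))"
      using assms pos by (subst nn_integral_cmult, simp, subst nn_integral_exp_Gamma) auto
    also have "\<dots> = ennreal (exp (e * s) * Gamma (k - e) * ((1 + exp s) powr - (2 * k) * (Y / (1 + exp s)) powr - (k - e)))"
      using assms by (simp add: ennreal_mult'[symmetric] mult_ac Gamma_real_pos less_imp_le)
    also have "(1 + exp s) powr - (2 * k) * (Y / (1 + exp s)) powr - (k - e) = Y powr (e - k) * (1 + exp s) powr - (e + k)"
      using assms pos by (simp add: powr_divide powr_minus powr_diff powr_add field_simps power2_eq_square flip: powr_add)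
    finally show "(\<integral>\<^sup>+v. ennreal (exp (e * s + (k - e) * v - (Y / (1 + exp s)) * exp v) * (1 + exp s) powr - (2 * k)) \<partial>lborel)
      = ennreal (Gamma (k - e) * Y powr (e - k)) * ennreal (exp (e * s) * (1 + exp s) powr - (e + k))"
      by (simp add: ennreal_mult''[symmetric] mult_ac)
  qed
  also have "\<dots> = ennreal (Gamma (k - e) * Y powr (e - k)) * ennreal (Gamma e * Gamma k / Gamma (e + k))"
    using assms by (subst nn_integral_cmult, simp, subst nn_integral_exp_Beta) auto
  also have "\<dots> = ennreal (Gamma (k - e) * Gamma e * Gamma k / Gamma (k + e) * Y powr (e - k))"
    using assms by (subst ennreal_mult'[symmetric]) (auto simp: field_simps Gamma_real_nonneg)
  finally show ?thesis .
qed

text \<open>The heat kernel of mass one, that is the centred normal density of variance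
  \<open>t / (2 * pi)\<close>, scaled so that its Fourier transform is
  \<open>exp (- pi * t * v\<^sup>2)\<close>.\<close>

definition gauss :: "real \<Rightarrow> real \<Rightarrow> real" where
  "gauss t c = exp (- pi * c\<^sup>2 / t) / sqrt t"

lemma gauss_nonneg: "t > 0 \<Longrightarrow> 0 \<le> gauss t c"
  by (simp add: gauss_def)

lemma borel_measurable_gauss [measurable]: "gauss t \<in> borel_measurable borel"
  unfolding gauss_def by measurable

lemma gauss_conv_normal_density:
  "t > 0 \<Longrightarrow> gauss t c = normal_density 0 (sqrt (t / (2 * pi))) c"
  by (simp add: gauss_def normal_density_def)

lemma integrable_gauss: "t > 0 \<Longrightarrow> integrable lborel (gauss t)"
  by (simp add: gauss_conv_normal_density cong: Bochner_Integration.integrable_cong)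

lemma nn_integral_gauss_conv:
  fixes t u y :: real
  assumes "t > 0" "u \<ge> 0"
  shows "(\<integral>\<^sup>+c. ennreal (gauss t c * exp (- pi * u * (y + c)\<^sup>2)) \<partial>lborel)
    = ennreal ((1 + u * t) powr (- 1 / 2) * exp (- pi * u * y\<^sup>2 / (1 + u * t)))"
proof -
  define w where "w = 1 + u * t"
  have w: "w > 0" using assms by (simp add: w_def add_pos_nonneg)
  \<comment> \<open>Mean and standard deviation found by completing the square in
    \<open>c\<close>.\<close>
  define m where "m = - u * t * y / w"
  define sg where "sg = sqrt (t / (2 * pi * w))"
  have sg: "sg > 0" using assms w by (simp add: sg_def)
  have eq: "gauss t c * exp (- pi * u * (y + c)\<^sup>2)
      = w powr (- 1 / 2) * exp (- pi * u * y\<^sup>2 / w) * normal_density m sg c" for c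
  proof -
    have "c\<^sup>2 / t + u * (y + c)\<^sup>2 = u * y\<^sup>2 / w + (c - m)\<^sup>2 * w / t"
    proof -
      have wm: "w * m = - u * t * y" using w by (simp add: m_def)
      have "(c\<^sup>2 / t + u * (y + c)\<^sup>2) * (w * t) = (c\<^sup>2 + u * t * (y + c)\<^sup>2) * w"
        using assms by (simp add: field_simps)
      also have "\<dots> = u * y\<^sup>2 * t + (w * c - w * m)\<^sup>2"
        unfolding wm by (simp add: w_def power2_eq_square algebra_simps)
      also have "\<dots> = (u * y\<^sup>2 / w + (c - m)\<^sup>2 * w / t) * (w * t)"
        using assms w by (simp add: field_simps power2_eq_square)
      finally show ?thesis using assms w by simp
    qed
    then have "- pi * c\<^sup>2 / t + (- pi * u * (y + c)\<^sup>2) = - pi * u * y\<^sup>2 / w + (- pi * ((c - m)\<^sup>2 * w / t))"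
      by (smt (verit) distrib_left mult.assoc mult_minus_left times_divide_eq_right)
    then have "exp (- pi * c\<^sup>2 / t) * exp (- pi * u * (y + c)\<^sup>2) = exp (- pi * u * y\<^sup>2 / w) * exp (- pi * ((c - m)\<^sup>2 * w / t))"
      by (metis exp_add)
    moreover have nd: "normal_density m sg c = sqrt (w / t) * exp (- pi * ((c - m)\<^sup>2 * w / t))"
    proof -
      have sgsq: "sg\<^sup>2 = t / (2 * pi * w)" unfolding sg_def using assms w by simp
      have "2 * pi * sg\<^sup>2 = t / w" unfolding sgsq by simp
      moreover have "(c - m)\<^sup>2 / (2 * sg\<^sup>2) = pi * ((c - m)\<^sup>2 * w / t)"
        unfolding sgsq using assms w by (simp add: field_simps)
      ultimately show ?thesis
        unfolding normal_density_def using assms w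
        by (simp add: real_sqrt_divide)
    qed
    moreover have "w powr (- 1 / 2) * sqrt (w / t) = 1 / sqrt t"
      using w assms by (simp add: powr_minus powr_half_sqrt real_sqrt_divide field_simps)
    moreover have "gauss t c * exp (- pi * u * (y + c)\<^sup>2)
      = (exp (- pi * c\<^sup>2 / t) * exp (- pi * u * (y + c)\<^sup>2)) * (1 / sqrt t)"
      by (simp add: gauss_def)
    ultimately show ?thesis by algebra
  qed
  have "(\<integral>\<^sup>+c. ennreal (normal_density m sg c) \<partial>lborel) = 1"
    using sg by (subst nn_integral_eq_integral) auto
  then show ?thesis
    unfolding eq w_def[symmetric]
    by (simp add: ennreal_mult' nn_integral_cmult)
qed

lemma integral_gauss_cis:
  fixes t v :: real
  assumes "t > 0"
  shows "(\<integral>c. of_real (gauss t c) * cis (2 * pi * (c * v)) \<partial>lborel) = of_real (exp (- pi * t * v\<^sup>2))"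
proof -
  define sg where "sg = sqrt (t / (2 * pi))"
  have sg: "sg > 0" using assms by (simp add: sg_def)
  \<comment> \<open>Rescaling \<open>c\<close> by the standard deviation \<open>sg\<close> reduces
    the Fourier integral to the characteristic function of the standard normal law.\<close>
  have dens: "sg * gauss t (sg * x) = std_normal_density x" for x
  proof -
    have sgsq: "sg\<^sup>2 = t / (2 * pi)" unfolding sg_def using assms by simp
    have e1: "- pi * (sg * x)\<^sup>2 / t = - x\<^sup>2 / 2"
      unfolding power_mult_distrib sgsq using assms by (simp add: field_simps)
    have e2: "sg / sqrt t = 1 / sqrt (2 * pi)"
      unfolding sg_def using assms by (simp add: real_sqrt_divide)
    have "sg * gauss t (sg * x) = (sg / sqrt t) * exp (- x\<^sup>2 / 2)"
      unfolding gauss_def e1 by simp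
    then show ?thesis
      unfolding e2 std_normal_density_def .
  qed
  have "(\<integral>c. of_real (gauss t c) * cis (2 * pi * (c * v)) \<partial>lborel)
      = sg *\<^sub>R (\<integral>x. of_real (gauss t (0 + sg * x)) * cis (2 * pi * ((0 + sg * x) * v)) \<partial>lborel)"
    using sg by (subst lborel_integral_real_affine[of sg _ 0]) auto
  also have "\<dots> = (\<integral>x. std_normal_density x *\<^sub>R iexp ((2 * pi * sg * v) * x) \<partial>lborel)"
    unfolding integral_scaleR_right[symmetric] dens[symmetric]
    by (intro Bochner_Integration.integral_cong)
       (auto simp: scaleR_conv_of_real cis_conv_exp mult_ac)
  also have "\<dots> = char std_normal_distribution (2 * pi * sg * v)"
    unfolding char_def by (subst integral_density) (auto simp: mult_ac)
  also have "\<dots> = of_real (exp (- ((2 * pi * sg * v)\<^sup>2 / 2)))"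
    by (simp add: char_std_normal_distribution)
  also have "(2 * pi * sg * v)\<^sup>2 / 2 = pi * t * v\<^sup>2"
    unfolding power_mult_distrib sg_def using assms by (simp add: field_simps power2_eq_square)
  finally show ?thesis by simp
qed

section \<open>Gaussian averages on finite products\<close>

text \<open>Coordinates are indexed by a finite set instead of a type, because \<open>I\<close> will
  be an orthonormal basis of a subspace whose dimension is the rank of a matrix.\<close>

abbreviation lborelI :: "'i set \<Rightarrow> ('i \<Rightarrow> real) measure" where
  "lborelI I \<equiv> Pi\<^sub>M I (\<lambda>_. lborel)"

lemma sigma_finite_lborelI: "finite I \<Longrightarrow> sigma_finite_measure (lborelI I)"
  by (intro product_sigma_finite.sigma_finite)
     (auto simp: product_sigma_finite_def sigma_finite_lborel)

definition gaussI :: "'i set \<Rightarrow> real \<Rightarrow> ('i \<Rightarrow> real) \<Rightarrow> real" where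
  "gaussI I t c = (\<Prod>i\<in>I. gauss t (c i))"

lemma gaussI_nonneg: "t > 0 \<Longrightarrow> 0 \<le> gaussI I t c"
  by (simp add: gaussI_def gauss_nonneg prod_nonneg)

lemma borel_measurable_gauss_compose [measurable]: 
  "f \<in> borel_measurable M \<Longrightarrow> g \<in> borel_measurable M \<Longrightarrow> (\<lambda>x. gauss (f x) (g x)) \<in> borel_measurable M"
proof -
  assume [measurable]: "f \<in> borel_measurable M" "g \<in> borel_measurable M"
  have "(\<lambda>x. sqrt (f x)) \<in> borel_measurable M"
    by (rule borel_measurable_continuous_on[OF _ \<open>f \<in> _\<close>]) (intro continuous_intros)
  then show "(\<lambda>x. gauss (f x) (g x)) \<in> borel_measurable M"
    unfolding gauss_def by measurable
qed

lemma borel_measurable_gaussI: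
  "(\<lambda>(s, c). gaussI I (exp s) c) \<in> borel_measurable (lborel \<Otimes>\<^sub>M lborelI I)"
  unfolding gaussI_def by measurable

lemma borel_measurable_gaussI' [measurable]:
  "gaussI I t \<in> borel_measurable (lborelI I)"
  unfolding gaussI_def[abs_def] by measurable

lemma nn_integral_gaussI_conv:
  assumes "finite I" "t > 0" "u \<ge> 0"
  shows "(\<integral>\<^sup>+c. ennreal (gaussI I t c * exp (- pi * u * (\<Sum>i\<in>I. (y i + c i)\<^sup>2))) \<partial>lborelI I)
    = ennreal ((1 + u * t) powr (- real (card I) / 2) * exp (- pi * u * (\<Sum>i\<in>I. (y i)\<^sup>2) / (1 + u * t)))"
proof -
  interpret product_sigma_finite "\<lambda>_. lborel :: real measure"
    by (simp add: product_sigma_finite_def sigma_finite_lborel)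
  have "(\<integral>\<^sup>+c. ennreal (gaussI I t c * exp (- pi * u * (\<Sum>i\<in>I. (y i + c i)\<^sup>2))) \<partial>lborelI I)
      = (\<integral>\<^sup>+c. (\<Prod>i\<in>I. ennreal (gauss t (c i) * exp (- pi * u * (y i + c i)\<^sup>2))) \<partial>lborelI I)"
    using assms
    by (intro nn_integral_cong)
       (simp add: prod_ennreal gauss_nonneg gaussI_def prod.distrib sum_distrib_left exp_sum
         flip: sum_negf)
  also have "\<dots> = (\<Prod>i\<in>I. \<integral>\<^sup>+c. ennreal (gauss t c * exp (- pi * u * (y i + c)\<^sup>2)) \<partial>lborel)"
    using assms by (intro product_nn_integral_prod) auto
  also have "\<dots> = (\<Prod>i\<in>I. ennreal ((1 + u * t) powr (- 1 / 2) * exp (- pi * u * (y i)\<^sup>2 / (1 + u * t))))"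
    using assms by (intro prod.cong refl nn_integral_gauss_conv) auto
  also have "\<dots> = ennreal ((1 + u * t) powr (- real (card I) / 2) * exp (- pi * u * (\<Sum>i\<in>I. (y i)\<^sup>2) / (1 + u * t)))"
  proof -
    have "((1 + u * t) powr (- 1 / 2)) ^ card I = (1 + u * t) powr (- real (card I) / 2)"
      using add_pos_nonneg[of 1 "u * t"] assms by (subst powr_power) auto
    moreover have "(\<Prod>i\<in>I. exp (- pi * u * (y i)\<^sup>2 / (1 + u * t))) = exp (- pi * u * (\<Sum>i\<in>I. (y i)\<^sup>2) / (1 + u * t))"
      using assms by (simp add: exp_sum[symmetric] sum_distrib_left sum_divide_distrib sum_negf)
    ultimately show ?thesis
      by (simp add: prod_ennreal prod.distrib)
  qed
  finally show ?thesis .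
qed

lemma integrable_gaussI:
  assumes "finite I" "t > 0"
  shows "integrable (lborelI I) (gaussI I t)"
proof -
  interpret product_sigma_finite "\<lambda>_. lborel :: real measure"
    by (simp add: product_sigma_finite_def sigma_finite_lborel)
  show ?thesis
    unfolding gaussI_def[abs_def] using assms by (intro product_integrable_prod integrable_gauss) auto
qed

lemma integral_gaussI_cis:
  assumes "finite I" "t > 0"
  shows "(\<integral>c. of_real (gaussI I t c) * cis (2 * pi * (\<Sum>i\<in>I. c i * v i)) \<partial>lborelI I)
    = of_real (exp (- pi * t * (\<Sum>i\<in>I. (v i)\<^sup>2)))"
proof -
  interpret product_sigma_finite "\<lambda>_. lborel :: real measure"
    by (simp add: product_sigma_finite_def sigma_finite_lborel)
  have cis_sum: "cis (\<Sum>i\<in>I. h i) = (\<Prod>i\<in>I. cis (h i))" for h :: "_ \<Rightarrow> real"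
    using assms(1) by (induction I) (auto simp: cis_mult[symmetric])
  have cis_m: "(\<lambda>c. cis (2 * pi * (c * w))) \<in> borel_measurable borel" for w
    by (intro borel_measurable_continuous_onI continuous_intros)
  have "(\<integral>c. of_real (gaussI I t c) * cis (2 * pi * (\<Sum>i\<in>I. c i * v i)) \<partial>lborelI I)
     = (\<integral>c. (\<Prod>i\<in>I. of_real (gauss t (c i)) * cis (2 * pi * (c i * v i))) \<partial>lborelI I)"
    by (simp add: gaussI_def prod.distrib cis_sum sum_distrib_left)
  also have "\<dots> = (\<Prod>i\<in>I. \<integral>c. of_real (gauss t c) * cis (2 * pi * (c * v i)) \<partial>lborel)"
  proof (rule product_integral_prod[OF assms(1)])
    fix i
    show "integrable lborel (\<lambda>c. of_real (gauss t c) * cis (2 * pi * (c * v i)))"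
      using assms cis_m
      by (intro Bochner_Integration.integrable_bound[OF integrable_gauss[OF assms(2)]])
         (auto simp: norm_mult)
  qed
  also have "\<dots> = (\<Prod>i\<in>I. of_real (exp (- pi * t * (v i)\<^sup>2)))"
    using assms by (simp add: integral_gauss_cis)
  also have "\<dots> = of_real (exp (- pi * t * (\<Sum>i\<in>I. (v i)\<^sup>2)))"
    using assms by (simp add: exp_sum[symmetric] sum_distrib_left sum_negf flip: of_real_prod)
  finally show ?thesis .
qed

text \<open>Only an inequality: at \<open>q = 0\<close> the left side is the junk value \<open>0\<close>, the right side \<open>\<infinity>\<close>.\<close>

lemma powr_le_Gamma_integral:
  fixes q k :: real
  assumes "k > 0" "q \<ge> 0"
  shows "ennreal (q powr - k) \<le> ennreal (pi powr k / Gamma k) * (\<integral>\<^sup>+v. ennreal (exp (k * v - pi * q * exp v)) \<partial>lborel)"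
proof (cases "q = 0")
  case False
  then have "(\<integral>\<^sup>+v. ennreal (exp (k * v - pi * q * exp v)) \<partial>lborel) = ennreal (Gamma k * (pi * q) powr - k)"
    using assms by (intro nn_integral_exp_Gamma) auto
  moreover have "q powr - k = pi powr k / Gamma k * (Gamma k * (pi * q) powr - k)"
  proof -
    have "Gamma k \<noteq> 0" using Gamma_real_pos[OF assms(1)] by simp
    then show ?thesis using assms False by (simp add: powr_mult powr_minus)
  qed
  moreover have "0 \<le> pi powr k / Gamma k"
    using Gamma_real_pos[OF assms(1)] by simp
  ultimately show ?thesis by (simp add: ennreal_mult'[symmetric])
qed simp

text \<open>The Gamma integral presents the negative power as a superposition of Gaussians in
  \<open>y + c\<close>, and averaging each of these over \<open>c\<close> is an explicit Gaussian
  convolution.\<close>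

lemma nn_integral_gaussI_powr_le:
  assumes "finite I" "t > 0" "k > 0"
  shows "(\<integral>\<^sup>+c. ennreal (gaussI I t c * (\<Sum>i\<in>I. (y i + c i)\<^sup>2) powr - k) \<partial>lborelI I)
    \<le> ennreal (pi powr k / Gamma k) *
      (\<integral>\<^sup>+v. ennreal (exp (k * v) * ((1 + exp v * t) powr (- real (card I) / 2)
         * exp (- pi * exp v * (\<Sum>i\<in>I. (y i)\<^sup>2) / (1 + exp v * t)))) \<partial>lborel)" (is "?L \<le> ?c * ?R")
proof -
  interpret pair_sigma_finite "lborelI I" "lborel :: real measure"
    using assms by (intro pair_sigma_finite.intro sigma_finite_lborelI sigma_finite_lborel)
  have "?L \<le> (\<integral>\<^sup>+c. \<integral>\<^sup>+v. ?c * (ennreal (exp (k * v)) * ennreal (gaussI I t c * exp (- pi * exp v * (\<Sum>i\<in>I. (y i + c i)\<^sup>2)))) \<partial>lborel \<partial>lborelI I)"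
  proof (intro nn_integral_mono)
    fix c
    let ?q = "\<Sum>i\<in>I. (y i + c i)\<^sup>2"
    have "ennreal (gaussI I t c * ?q powr - k) \<le> ennreal (gaussI I t c) * (?c * (\<integral>\<^sup>+v. ennreal (exp (k * v - pi * ?q * exp v)) \<partial>lborel))"
      using assms gaussI_nonneg[of t I c]
      by (subst ennreal_mult') (auto intro!: mult_left_mono powr_le_Gamma_integral sum_nonneg)
    also have "\<dots> = (\<integral>\<^sup>+v. ?c * (ennreal (gaussI I t c) * ennreal (exp (k * v - pi * ?q * exp v))) \<partial>lborel)"
      by (simp add: nn_integral_cmult mult_ac)
    also have "\<dots> = (\<integral>\<^sup>+v. ?c * (ennreal (exp (k * v)) * ennreal (gaussI I t c * exp (- pi * exp v * ?q))) \<partial>lborel)"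
    proof (rule nn_integral_cong)
      fix v
      have "gaussI I t c * exp (k * v - pi * ?q * exp v) = exp (k * v) * (gaussI I t c * exp (- pi * exp v * ?q))"
        by (simp add: exp_diff exp_minus field_simps)
      then show "?c * (ennreal (gaussI I t c) * ennreal (exp (k * v - pi * ?q * exp v)))
        = ?c * (ennreal (exp (k * v)) * ennreal (gaussI I t c * exp (- pi * exp v * ?q)))"
        using gaussI_nonneg[OF assms(2), of I c] by (simp only: ennreal_mult'[symmetric] exp_ge_zero)
    qed
    finally show "ennreal (gaussI I t c * ?q powr - k) \<le> \<dots>" .
  qed
  also have "\<dots> = (\<integral>\<^sup>+v. \<integral>\<^sup>+c. ?c * (ennreal (exp (k * v)) * ennreal (gaussI I t c * exp (- pi * exp v * (\<Sum>i\<in>I. (y i + c i)\<^sup>2)))) \<partial>lborelI I \<partial>lborel)"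
    by (rule Fubini'[symmetric]) measurable
  also have "\<dots> = ?c * (\<integral>\<^sup>+v. ennreal (exp (k * v)) * (\<integral>\<^sup>+c. ennreal (gaussI I t c * exp (- pi * exp v * (\<Sum>i\<in>I. (y i + c i)\<^sup>2))) \<partial>lborelI I) \<partial>lborel)"
  proof -
    have m: "(\<lambda>v. \<integral>\<^sup>+c. ennreal (gaussI I t c * exp (- pi * exp v * (\<Sum>i\<in>I. (y i + c i)\<^sup>2))) \<partial>lborelI I) \<in> borel_measurable lborel"
      using assms by (simp add: nn_integral_gaussI_conv)
    show ?thesis
      using m by (subst nn_integral_cmult[symmetric]) (auto simp: nn_integral_cmult intro!: nn_integral_cong)
  qed
  also have "\<dots> = ?c * ?R"
    using assms
    by (intro arg_cong2[where f = "(*)"] refl nn_integral_cong, subst nn_integral_gaussI_conv)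
       (auto simp: ennreal_mult'[symmetric])
  finally show ?thesis .
qed

text \<open>With \<open>k = card I / 4\<close> the convolution factor has exponent
  \<open>- (2 * k)\<close>, the one that \<open>nn_integral_Gamma_Beta\<close> expects. Its factor
  \<open>Gamma k\<close> cancels against the one in the superposition, and \<open>pi powr k\<close>
  combines with \<open>pi powr (e - k)\<close> to \<open>pi powr e\<close>.\<close>

lemma nn_integral_gaussI_powr_scale_le:
  assumes "finite I" and k: "k = real (card I) / 4" and e: "0 < e" "e < k"
    and Y: "(\<Sum>i\<in>I. (y i)\<^sup>2) > 0"
  shows "(\<integral>\<^sup>+s. ennreal (exp (e * s)) * (\<integral>\<^sup>+c. ennreal (gaussI I (exp s) c * (\<Sum>i\<in>I. (y i + c i)\<^sup>2) powr - k) \<partial>lborelI I) \<partial>lborel)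
    \<le> ennreal (pi powr e * Gamma (k - e) * Gamma e / Gamma (k + e) * (\<Sum>i\<in>I. (y i)\<^sup>2) powr (e - k))"
    (is "?L \<le> _")
proof -
  let ?Y = "\<Sum>i\<in>I. (y i)\<^sup>2"
  let ?c = "ennreal (pi powr k / Gamma k)"
  let ?h = "\<lambda>s v. ennreal (exp (k * v) * ((1 + exp v * exp s) powr (- real (card I) / 2)
         * exp (- pi * exp v * ?Y / (1 + exp v * exp s))))"
  have "?L \<le> (\<integral>\<^sup>+s. ennreal (exp (e * s)) * (?c * (\<integral>\<^sup>+v. ?h s v \<partial>lborel)) \<partial>lborel)"
    using assms by (intro nn_integral_mono mult_left_mono nn_integral_gaussI_powr_le) auto
  also have "\<dots> = (\<integral>\<^sup>+s. ?c * (\<integral>\<^sup>+v. ennreal (exp (e * s)) * ?h s v \<partial>lborel) \<partial>lborel)"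
    by (intro nn_integral_cong) (simp add: nn_integral_cmult mult_ac)
  also have "\<dots> = ?c * (\<integral>\<^sup>+s. (\<integral>\<^sup>+v. ennreal (exp (e * s)) * ?h s v \<partial>lborel) \<partial>lborel)"
    by (rule nn_integral_cmult) measurable
  also have "(\<integral>\<^sup>+s. (\<integral>\<^sup>+v. ennreal (exp (e * s)) * ?h s v \<partial>lborel) \<partial>lborel) =
     (\<integral>\<^sup>+s. \<integral>\<^sup>+v. ennreal (exp (e * s + k * v - (pi * ?Y) * exp v / (1 + exp (s + v)))
        * (1 + exp (s + v)) powr - (2 * k)) \<partial>lborel \<partial>lborel)"
  proof (rule nn_integral_cong, rule nn_integral_cong)
    fix s v :: real
    have ex: "exp (e * s) * (exp (k * v) * exp (- pi * exp v * ?Y / (1 + exp (s + v))))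
      = exp (e * s + k * v - (pi * ?Y) * exp v / (1 + exp (s + v)))"
      unfolding exp_add[symmetric] by (simp add: mult_ac)
    have c: "- real (card I) / 2 = - (2 * k)" using k by simp
    have es: "exp v * exp s = exp (s + v)" by (simp add: exp_add)
    have "ennreal (exp (e * s)) * ?h s v = ennreal (exp (e * s) * (exp (k * v) * ((1 + exp (s + v)) powr - (2 * k)
         * exp (- pi * exp v * ?Y / (1 + exp (s + v))))))"
      unfolding c es by (simp add: ennreal_mult'[symmetric])
    also have "exp (e * s) * (exp (k * v) * ((1 + exp (s + v)) powr - (2 * k)
         * exp (- pi * exp v * ?Y / (1 + exp (s + v)))))
      = exp (e * s + k * v - (pi * ?Y) * exp v / (1 + exp (s + v))) * (1 + exp (s + v)) powr - (2 * k)"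
      unfolding ex[symmetric] by algebra
    finally show "ennreal (exp (e * s)) * ?h s v = ennreal (exp (e * s + k * v - (pi * ?Y) * exp v / (1 + exp (s + v)))
        * (1 + exp (s + v)) powr - (2 * k))" .
  qed
  also have "\<dots> = ennreal (Gamma (k - e) * Gamma e * Gamma k / Gamma (k + e) * (pi * ?Y) powr (e - k))"
    using assms by (intro nn_integral_Gamma_Beta) auto
  also have "?c * \<dots> = ennreal (pi powr e * Gamma (k - e) * Gamma e / Gamma (k + e) * ?Y powr (e - k))"
  proof -
    have g: "Gamma k > 0" "Gamma (k + e) > 0" using e by (auto intro!: Gamma_real_pos)
    have "(pi * ?Y) powr (e - k) = pi powr e / pi powr k * ?Y powr (e - k)"
      using Y by (simp add: powr_mult powr_diff)
    then show ?thesis using g by (subst ennreal_mult'[symmetric]) (auto simp: mult_ac)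
  qed
  finally show ?thesis .
qed

section \<open>Translated products and heat averages\<close>

lemma AM_GM_weighted:
  fixes a b v w :: real
  assumes "v > 0" "w > 0"
  shows "a * b \<le> (a\<^sup>2 * (v / w) + b\<^sup>2 * (w / v)) / 2"
proof -
  have "0 \<le> (a * v - b * w)\<^sup>2 / (v * w)" using assms by simp
  also have "\<dots> = a\<^sup>2 * (v / w) + b\<^sup>2 * (w / v) - 2 * (a * b)"
    using assms by (simp add: field_simps power2_eq_square)
  finally show ?thesis by simp
qed

lemma nn_integral_lborel_translate:
  fixes a :: "'a::euclidean_space"
  assumes "f \<in> borel_measurable borel"
  shows "(\<integral>\<^sup>+x. f (x + a) \<partial>lborel) = (\<integral>\<^sup>+x. f x \<partial>lborel)"
proof -
  have "(\<integral>\<^sup>+x. f x \<partial>lborel) = (\<integral>\<^sup>+x. f x \<partial>distr lborel borel ((+) a))"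
    by (simp add: lborel_distr_plus)
  also have "\<dots> = (\<integral>\<^sup>+x. f (x + a) \<partial>lborel)"
    using assms by (subst nn_integral_distr) (auto simp: add.commute)
  finally show ?thesis by simp
qed

text \<open>The weighted arithmetic-geometric mean inequality leaves one square at \<open>x\<close>
  and one at \<open>x + a\<close>. Translating the integral of the latter by \<open>- a\<close>
  brings it to \<open>x\<close> and moves its weight to \<open>x - a\<close>, whence the two
  signs.\<close>

lemma nn_integral_translate_product_le:
  fixes F Q :: "'a::euclidean_space \<Rightarrow> real" and a :: 'a
  assumes [measurable]: "F \<in> borel_measurable borel" "Q \<in> borel_measurable borel"
    and pos: "AE x in lborel. Q x > 0"
    and F: "\<And>x. F x \<ge> 0"
  shows "(\<integral>\<^sup>+x. ennreal (F (x + a) * F x) \<partial>lborel)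
    \<le> (\<integral>\<^sup>+x. ennreal ((F x)\<^sup>2 * Q x powr k) * (ennreal (Q (x + a) powr - k) + ennreal (Q (x - a) powr - k)) / 2 \<partial>lborel)"
proof -
  let ?h = "\<lambda>x b. ennreal ((F x)\<^sup>2 * Q x powr k) * ennreal (Q (x + b) powr - k)"
  have "(\<integral>\<^sup>+x. ennreal (F (x + a) * F x) \<partial>lborel) \<le> (\<integral>\<^sup>+x. (?h (x + a) (- a) + ?h x a) / 2 \<partial>lborel)"
  proof (rule nn_integral_mono_AE)
    have "AE x in lborel. Q (x + a) > 0"
      using AE_lborel_translate[OF pos, of "- a"] by simp
    with pos show "AE x in lborel. ennreal (F (x + a) * F x) \<le> (?h (x + a) (- a) + ?h x a) / 2"
    proof eventually_elim
      case (elim x)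
      have "F (x + a) * F x \<le> ((F (x + a))\<^sup>2 * (Q (x + a) powr k / Q x powr k) + (F x)\<^sup>2 * (Q x powr k / Q (x + a) powr k)) / 2"
        using elim by (intro AM_GM_weighted) auto
      then have "ennreal (F (x + a) * F x) \<le> ennreal (((F (x + a))\<^sup>2 * Q (x + a) powr k * Q x powr - k + (F x)\<^sup>2 * Q x powr k * Q (x + a) powr - k) / 2)"
        by (intro ennreal_leI) (simp add: powr_minus field_simps)
      also have "\<dots> = (?h (x + a) (- a) + ?h x a) / 2"
        by (simp add: ennreal_mult' ennreal_plus divide_ennreal[symmetric])
      finally show ?case .
    qed
  qed
  also have "\<dots> = (\<integral>\<^sup>+x. (?h (x + a) (- a)) / 2 \<partial>lborel) + (\<integral>\<^sup>+x. (?h x a) / 2 \<partial>lborel)"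
    by (subst nn_integral_add[symmetric]) (auto simp: add_divide_distrib_ennreal)
  also have "(\<integral>\<^sup>+x. (?h (x + a) (- a)) / 2 \<partial>lborel) = (\<integral>\<^sup>+x. (?h x (- a)) / 2 \<partial>lborel)"
    by (rule nn_integral_lborel_translate) measurable
  also have "(\<integral>\<^sup>+x. (?h x (- a)) / 2 \<partial>lborel) + (\<integral>\<^sup>+x. (?h x a) / 2 \<partial>lborel)
    = (\<integral>\<^sup>+x. ennreal ((F x)\<^sup>2 * Q x powr k) * (ennreal (Q (x + a) powr - k) + ennreal (Q (x - a) powr - k)) / 2 \<partial>lborel)"
    by (subst nn_integral_add[symmetric])
       (auto simp: add_divide_distrib_ennreal[symmetric] distrib_left add.commute)
  finally show ?thesis .
qed

text \<open>The Gaussian in \<open>Z\<close> is a Gaussian average of characters. Interchanging the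
  integrals leaves the same average of the characteristic function of \<open>Z\<close> under
  \<open>R\<close>, of which only the modulus is retained.\<close>

lemma heat_le:
  fixes Z :: "'i \<Rightarrow> 'a::euclidean_space \<Rightarrow> real" and R :: "'a \<Rightarrow> real"
    and K :: "('i \<Rightarrow> real) \<Rightarrow> ennreal"
  assumes "finite I" "t > 0"
    and Z [measurable]: "\<And>i. i \<in> I \<Longrightarrow> Z i \<in> borel_measurable borel"
    and R: "integrable lborel R" "\<And>x. R x \<ge> 0"
    and K: "\<And>c. ennreal (cmod (\<integral>x. cis (2 * pi * (\<Sum>i\<in>I. c i * Z i x)) * of_real (R x) \<partial>lborel)) \<le> K c"
  shows "(\<integral>\<^sup>+x. ennreal (exp (- pi * t * (\<Sum>i\<in>I. (Z i x)\<^sup>2)) * R x) \<partial>lborel)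
    \<le> (\<integral>\<^sup>+c. ennreal (gaussI I t c) * K c \<partial>lborelI I)"
proof -
  interpret pair_sigma_finite "lborelI I" "lborel :: 'a measure"
    using assms by (intro pair_sigma_finite.intro sigma_finite_lborelI sigma_finite_lborel)
  let ?X = "\<lambda>c x. cis (2 * pi * (\<Sum>i\<in>I. c i * Z i x))"
  have [measurable]: "R \<in> borel_measurable borel" using R by auto
  have cism: "cis \<in> borel_measurable borel"
    by (intro borel_measurable_continuous_onI continuous_intros)
  have Xm: "(\<lambda>p. ?X (fst p) (snd p)) \<in> borel_measurable (lborelI I \<Otimes>\<^sub>M lborel)"
    by (rule measurable_compose[OF _ cism]) measurable
  have int: "integrable (lborelI I \<Otimes>\<^sub>M lborel) (\<lambda>(c, x). of_real (gaussI I t c) * (?X c x * of_real (R x)))"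
  proof (rule Bochner_Integration.integrable_bound)
    show "integrable (lborelI I \<Otimes>\<^sub>M lborel) (\<lambda>(c, x). gaussI I t c * R x)"
    proof (rule Fubini_integrable)
      show "integrable (lborelI I) (\<lambda>c. \<integral>x. norm (case (c, x) of (c, x) \<Rightarrow> gaussI I t c * R x) \<partial>lborel)"
        using integrable_gaussI[OF assms(1,2)] gaussI_nonneg[OF assms(2)] by (simp add: abs_mult)
    qed (use R in auto)
  qed (use Xm R gaussI_nonneg[OF assms(2)] in \<open>auto simp: norm_mult case_prod_beta\<close>)
  have nonneg: "0 \<le> exp (- pi * t * (\<Sum>i\<in>I. (Z i x)\<^sup>2)) * R x" for x
    using R by simp
  have le1: "exp (- pi * t * (\<Sum>i\<in>I. (Z i x)\<^sup>2)) \<le> 1" for x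
    using assms by (simp add: sum_nonneg)
  have intR: "integrable lborel (\<lambda>x. exp (- pi * t * (\<Sum>i\<in>I. (Z i x)\<^sup>2)) * R x)"
    using R le1 by (intro Bochner_Integration.integrable_bound[OF R(1)]) (auto intro!: mult_left_le_one_le)
  have "of_real (\<integral>x. exp (- pi * t * (\<Sum>i\<in>I. (Z i x)\<^sup>2)) * R x \<partial>lborel)
      = (\<integral>x. of_real (exp (- pi * t * (\<Sum>i\<in>I. (Z i x)\<^sup>2)) * R x) \<partial>lborel :: complex)"
    by (simp only: integral_complex_of_real)
  also have "\<dots> = (\<integral>x. \<integral>c. of_real (gaussI I t c) * (?X c x * of_real (R x)) \<partial>lborelI I \<partial>lborel)"
  proof (rule Bochner_Integration.integral_cong[OF refl])
    fix x
    have "complex_of_real (exp (- pi * t * (\<Sum>i\<in>I. (Z i x)\<^sup>2)) * R x)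
      = (\<integral>c. of_real (gaussI I t c) * ?X c x \<partial>lborelI I) * of_real (R x)"
      unfolding integral_gaussI_cis[OF assms(1,2)] by simp
    also have "\<dots> = (\<integral>c. of_real (gaussI I t c) * ?X c x * of_real (R x) \<partial>lborelI I)"
      by (rule integral_mult_left_zero[symmetric])
    finally show "complex_of_real (exp (- pi * t * (\<Sum>i\<in>I. (Z i x)\<^sup>2)) * R x)
      = (\<integral>c. of_real (gaussI I t c) * (?X c x * of_real (R x)) \<partial>lborelI I)"
      by (simp add: mult.assoc)
  qed
  also have "\<dots> = (\<integral>c. \<integral>x. of_real (gaussI I t c) * (?X c x * of_real (R x)) \<partial>lborel \<partial>lborelI I)"
    by (rule Fubini_integral[OF int])
  finally have eq: "of_real (\<integral>x. exp (- pi * t * (\<Sum>i\<in>I. (Z i x)\<^sup>2)) * R x \<partial>lborel) = \<dots>" .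
  have "(\<integral>\<^sup>+x. ennreal (exp (- pi * t * (\<Sum>i\<in>I. (Z i x)\<^sup>2)) * R x) \<partial>lborel)
    = ennreal (\<integral>x. exp (- pi * t * (\<Sum>i\<in>I. (Z i x)\<^sup>2)) * R x \<partial>lborel)"
    using intR nonneg by (intro nn_integral_eq_integral) auto
  also have "\<dots> = ennreal (cmod (of_real (\<integral>x. exp (- pi * t * (\<Sum>i\<in>I. (Z i x)\<^sup>2)) * R x \<partial>lborel)))"
    using nonneg by (simp add: integral_nonneg)
  also have "\<dots> = ennreal (cmod (\<integral>c. \<integral>x. of_real (gaussI I t c) * (?X c x * of_real (R x)) \<partial>lborel \<partial>lborelI I))"
    unfolding eq ..
  also have "\<dots> \<le> (\<integral>\<^sup>+c. ennreal (cmod (\<integral>x. of_real (gaussI I t c) * (?X c x * of_real (R x)) \<partial>lborel)) \<partial>lborelI I)"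
    using integrable_fst'[OF int] by (intro integral_norm_bound_ennreal) auto
  also have "\<dots> \<le> (\<integral>\<^sup>+c. ennreal (gaussI I t c) * K c \<partial>lborelI I)"
  proof (rule nn_integral_mono)
    fix c
    have "ennreal (cmod (\<integral>x. of_real (gaussI I t c) * (?X c x * of_real (R x)) \<partial>lborel))
      = ennreal (gaussI I t c) * ennreal (cmod (\<integral>x. ?X c x * of_real (R x) \<partial>lborel))"
      using gaussI_nonneg[OF assms(2), of I c]
      by (simp add: norm_mult ennreal_mult'[symmetric])
    also have "\<dots> \<le> ennreal (gaussI I t c) * K c"
      by (intro mult_left_mono K) auto
    finally show "ennreal (cmod (\<integral>x. of_real (gaussI I t c) * (?X c x * of_real (R x)) \<partial>lborel))
      \<le> ennreal (gaussI I t c) * K c" .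
  qed
  finally show ?thesis .
qed

section \<open>A Pitt inequality\<close>

text \<open>The coordinate functions are abstract because the theorem is applied twice, with two
  different translations. The two sides are linked by \<open>bound\<close>, which dominates the
  characteristic function of \<open>Z\<close> under \<open>R\<close> by an autocorrelation of
  \<open>F\<close>. By \<open>shift\<close>, translating by \<open>\<tau> c\<close> adds exactly
  \<open>c\<close> to the coordinates \<open>Y\<close>, so that the average over \<open>c\<close>
  becomes the one in \<open>nn_integral_gaussI_powr_scale_le\<close>.\<close>

theorem Pitt_inequality:
  fixes Y Z :: "'i \<Rightarrow> 'a::euclidean_space \<Rightarrow> real" and F R :: "'a \<Rightarrow> real"
    and \<tau> :: "('i \<Rightarrow> real) \<Rightarrow> 'a"
  assumes I: "finite I" and k: "k = real (card I) / 4" and e: "0 < e" "e < k"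
    and Y [measurable]: "\<And>i. i \<in> I \<Longrightarrow> Y i \<in> borel_measurable borel"
    and Z [measurable]: "\<And>i. i \<in> I \<Longrightarrow> Z i \<in> borel_measurable borel"
    and \<tau> [measurable]: "\<tau> \<in> borel_measurable (lborelI I)"
    and shift: "\<And>i c x. i \<in> I \<Longrightarrow> Y i (x + \<tau> c) = Y i x + c i"
    and pos: "AE x in lborel. (\<Sum>i\<in>I. (Y i x)\<^sup>2) > 0"
    and F [measurable]: "F \<in> borel_measurable borel" and F0: "\<And>x. F x \<ge> 0"
    and R: "integrable lborel R" "\<And>x. R x \<ge> 0"
    and bound: "\<And>c. ennreal (cmod (\<integral>x. cis (2 * pi * (\<Sum>i\<in>I. c i * Z i x)) * of_real (R x) \<partial>lborel))
        \<le> (\<integral>\<^sup>+x. ennreal (F (x + \<tau> c) * F x) \<partial>lborel)"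
  shows "(\<integral>\<^sup>+x. ennreal ((\<Sum>i\<in>I. (Z i x)\<^sup>2) powr - e * R x) \<partial>lborel)
    \<le> ennreal (pi powr (2 * e) * Gamma (k - e) / Gamma (k + e)) *
      (\<integral>\<^sup>+x. ennreal ((\<Sum>i\<in>I. (Y i x)\<^sup>2) powr e * (F x)\<^sup>2) \<partial>lborel)"
proof -
  define Q where "Q x = (\<Sum>i\<in>I. (Y i x)\<^sup>2)" for x
  define q where "q x = (\<Sum>i\<in>I. (Z i x)\<^sup>2)" for x
  have [measurable]: "Q \<in> borel_measurable borel" "q \<in> borel_measurable borel"
    unfolding Q_def[abs_def] q_def[abs_def] by measurable
  have [measurable]: "R \<in> borel_measurable borel" using R by auto
  have q0: "q x \<ge> 0" for x by (simp add: q_def sum_nonneg)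
  have minus: "Y i (x - \<tau> c) = Y i x - c i" if "i \<in> I" for i x c
    using shift[OF that, of "x - \<tau> c" c] by simp
  have Qp: "Q (x + \<tau> c) = (\<Sum>i\<in>I. (Y i x + c i)\<^sup>2)" for x c
    unfolding Q_def by (intro sum.cong refl) (simp add: shift)
  \<comment> \<open>The sign is flipped inside the square so that the shift by
    \<open>- \<tau> c\<close> is again of the form \<open>y i + c i\<close>, now at the point with
    coordinates \<open>- Y i x\<close>.\<close>
  have Qm: "Q (x - \<tau> c) = (\<Sum>i\<in>I. (- Y i x + c i)\<^sup>2)" for x c
    unfolding Q_def by (intro sum.cong refl) (simp add: minus power2_commute)
  interpret PX: pair_sigma_finite "lborelI I" "lborel :: 'a measure"
    using I by (intro pair_sigma_finite.intro sigma_finite_lborelI sigma_finite_lborel)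
  \<comment> \<open>\<open>?A\<close> comes from writing the power of \<open>q\<close> as a Gamma
    integral in \<open>s\<close>, \<open>?B\<close> from the average over \<open>c\<close> and
    \<open>s\<close>; the factor \<open>Gamma e\<close> cancels in their product.\<close>
  let ?A = "pi powr e / Gamma e"
  let ?B = "pi powr e * Gamma (k - e) * Gamma e / Gamma (k + e)"
  have A0: "0 \<le> ?A" using Gamma_real_pos[OF e(1)] by simp
  have B0: "0 \<le> ?B" using e by (auto intro!: divide_nonneg_nonneg mult_nonneg_nonneg less_imp_le[OF Gamma_real_pos])
  let ?g = "\<lambda>s c x. ennreal (gaussI I (exp s) c * Q (x + \<tau> c) powr - k) + ennreal (gaussI I (exp s) c * Q (x - \<tau> c) powr - k)"
  have gm [measurable]: "(\<lambda>(s, c). gaussI I (exp s) c) \<in> borel_measurable (lborel \<Otimes>\<^sub>M lborelI I)"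
    by (rule borel_measurable_gaussI)
  have g2 [measurable]: "(\<lambda>p. gaussI I (exp (h p)) (h' p)) \<in> borel_measurable M"
    if [measurable]: "h \<in> borel_measurable M" "h' \<in> measurable M (lborelI I)" for h h' and M :: "'z measure"
    using measurable_compose[OF measurable_Pair[OF that(1) that(2)], of "\<lambda>(s, c). gaussI I (exp s) c" borel] gm
    by (simp add: measurable_lborel1)
  have "(\<integral>\<^sup>+x. ennreal (q x powr - e * R x) \<partial>lborel)
      \<le> (\<integral>\<^sup>+x. ennreal ?A * (\<integral>\<^sup>+s. ennreal (exp (e * s - pi * q x * exp s)) \<partial>lborel) * ennreal (R x) \<partial>lborel)"
    using R e q0 by (intro nn_integral_mono) (auto simp: ennreal_mult' intro!: mult_right_mono powr_le_Gamma_integral)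
  also have "\<dots> = (\<integral>\<^sup>+x. (\<integral>\<^sup>+s. ennreal ?A * (ennreal (exp (e * s)) * ennreal (exp (- pi * exp s * q x) * R x)) \<partial>lborel) \<partial>lborel)"
  proof (rule nn_integral_cong)
    fix x
    have "ennreal ?A * (\<integral>\<^sup>+s. ennreal (exp (e * s - pi * q x * exp s)) \<partial>lborel) * ennreal (R x)
      = (\<integral>\<^sup>+s. ennreal ?A * (ennreal (exp (e * s - pi * q x * exp s)) * ennreal (R x)) \<partial>lborel)"
      by (simp add: nn_integral_cmult nn_integral_multc mult.assoc)
    also have "\<dots> = (\<integral>\<^sup>+s. ennreal ?A * (ennreal (exp (e * s)) * ennreal (exp (- pi * exp s * q x) * R x)) \<partial>lborel)"
    proof (rule nn_integral_cong)
      fix s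
      have "exp (e * s - pi * q x * exp s) * R x = exp (e * s) * (exp (- pi * exp s * q x) * R x)"
        by (simp add: exp_diff exp_minus field_simps)
      then show "ennreal ?A * (ennreal (exp (e * s - pi * q x * exp s)) * ennreal (R x))
        = ennreal ?A * (ennreal (exp (e * s)) * ennreal (exp (- pi * exp s * q x) * R x))"
        by (simp only: ennreal_mult'[symmetric] exp_ge_zero)
    qed
    finally show "ennreal ?A * (\<integral>\<^sup>+s. ennreal (exp (e * s - pi * q x * exp s)) \<partial>lborel) * ennreal (R x) = \<dots>" .
  qed
  also have "\<dots> = (\<integral>\<^sup>+s. (\<integral>\<^sup>+x. ennreal ?A * (ennreal (exp (e * s)) * ennreal (exp (- pi * exp s * q x) * R x)) \<partial>lborel) \<partial>lborel)"
    by (rule lborel_pair.Fubini') measurable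
  also have "\<dots> \<le> (\<integral>\<^sup>+s. ennreal ?A * (ennreal (exp (e * s)) *
      (\<integral>\<^sup>+c. \<integral>\<^sup>+x. ennreal ((F x)\<^sup>2 * Q x powr k) * ?g s c x / 2 \<partial>lborel \<partial>lborelI I)) \<partial>lborel)"
  proof (rule nn_integral_mono)
    fix s :: real
    have "(\<integral>\<^sup>+x. ennreal (exp (- pi * exp s * q x) * R x) \<partial>lborel)
       \<le> (\<integral>\<^sup>+c. ennreal (gaussI I (exp s) c) * (\<integral>\<^sup>+x. ennreal (F (x + \<tau> c) * F x) \<partial>lborel) \<partial>lborelI I)"
      unfolding q_def using R bound by (intro heat_le I) auto
    also have "\<dots> \<le> (\<integral>\<^sup>+c. ennreal (gaussI I (exp s) c) *
        (\<integral>\<^sup>+x. ennreal ((F x)\<^sup>2 * Q x powr k) * (ennreal (Q (x + \<tau> c) powr - k) + ennreal (Q (x - \<tau> c) powr - k)) / 2 \<partial>lborel) \<partial>lborelI I)"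
      using pos F0 by (intro nn_integral_mono mult_left_mono nn_integral_translate_product_le) (auto simp: Q_def)
    also have "\<dots> = (\<integral>\<^sup>+c. (\<integral>\<^sup>+x. ennreal ((F x)\<^sup>2 * Q x powr k) * ?g s c x / 2 \<partial>lborel) \<partial>lborelI I)"
      using gaussI_nonneg[of "exp s" I]
      by (subst nn_integral_cmult[symmetric])
         (auto simp: ennreal_mult' distrib_left divide_ennreal_def mult_ac distrib_right)
    finally show "(\<integral>\<^sup>+x. ennreal ?A * (ennreal (exp (e * s)) * ennreal (exp (- pi * exp s * q x) * R x)) \<partial>lborel)
      \<le> ennreal ?A * (ennreal (exp (e * s)) * (\<integral>\<^sup>+c. \<integral>\<^sup>+x. ennreal ((F x)\<^sup>2 * Q x powr k) * ?g s c x / 2 \<partial>lborel \<partial>lborelI I))"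
      by (simp add: nn_integral_cmult mult_left_mono)
  qed
  \<comment> \<open>The integrals are reordered until \<open>x\<close> is outermost: the averages
    over \<open>c\<close> and \<open>s\<close> are computed at a fixed coordinate vector.\<close>
  also have "\<dots> = (\<integral>\<^sup>+s. ennreal ?A * (ennreal (exp (e * s)) *
      (\<integral>\<^sup>+x. \<integral>\<^sup>+c. ennreal ((F x)\<^sup>2 * Q x powr k) * ?g s c x / 2 \<partial>lborelI I \<partial>lborel)) \<partial>lborel)"
    by (intro nn_integral_cong arg_cong2[where f = "(*)"] refl PX.Fubini'[symmetric]) measurable
  also have "\<dots> = (\<integral>\<^sup>+s. \<integral>\<^sup>+x. ennreal ?A * (ennreal (exp (e * s)) *
      (\<integral>\<^sup>+c. ennreal ((F x)\<^sup>2 * Q x powr k) * ?g s c x / 2 \<partial>lborelI I)) \<partial>lborel \<partial>lborel)"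
    by (simp add: nn_integral_cmult)
  also have "\<dots> = (\<integral>\<^sup>+x. \<integral>\<^sup>+s. ennreal ?A * (ennreal (exp (e * s)) *
      (\<integral>\<^sup>+c. ennreal ((F x)\<^sup>2 * Q x powr k) * ?g s c x / 2 \<partial>lborelI I)) \<partial>lborel \<partial>lborel)"
    by (rule lborel_pair.Fubini'[symmetric]) measurable
  also have "\<dots> \<le> (\<integral>\<^sup>+x. ennreal (?A * ?B) * ennreal (Q x powr e * (F x)\<^sup>2) \<partial>lborel)"
  proof (rule nn_integral_mono_AE, use pos in eventually_elim)
    fix x assume "(\<Sum>i\<in>I. (Y i x)\<^sup>2) > 0"
    then have Qx: "Q x > 0" by (simp add: Q_def)
    let ?w = "ennreal ((F x)\<^sup>2 * Q x powr k)"
    let ?Ip = "\<lambda>s. \<integral>\<^sup>+c. ennreal (gaussI I (exp s) c * Q (x + \<tau> c) powr - k) \<partial>lborelI I"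
    let ?Im = "\<lambda>s. \<integral>\<^sup>+c. ennreal (gaussI I (exp s) c * Q (x - \<tau> c) powr - k) \<partial>lborelI I"
    let ?b = "ennreal (?B * Q x powr (e - k))"
    have p: "(\<integral>\<^sup>+s. ennreal (exp (e * s)) * ?Ip s \<partial>lborel) \<le> ?b"
      using nn_integral_gaussI_powr_scale_le[OF I k e, of "\<lambda>i. Y i x"] Qx unfolding Qp unfolding Q_def by simp
    have m: "(\<integral>\<^sup>+s. ennreal (exp (e * s)) * ?Im s \<partial>lborel) \<le> ?b"
      using nn_integral_gaussI_powr_scale_le[OF I k e, of "\<lambda>i. - Y i x"] Qx unfolding Qm unfolding Q_def by simp
    have "(\<integral>\<^sup>+s. ennreal ?A * (ennreal (exp (e * s)) * (\<integral>\<^sup>+c. ?w * ?g s c x / 2 \<partial>lborelI I)) \<partial>lborel)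
      = (\<integral>\<^sup>+s. ennreal ?A * ?w / 2 * (ennreal (exp (e * s)) * ?Ip s + ennreal (exp (e * s)) * ?Im s) \<partial>lborel)"
    proof (rule nn_integral_cong)
      fix s :: real
      have "(\<integral>\<^sup>+c. ?w * ?g s c x / 2 \<partial>lborelI I) = (\<integral>\<^sup>+c. ?w / 2 * ?g s c x \<partial>lborelI I)"
        by (simp add: divide_ennreal_def mult_ac)
      also have "\<dots> = ?w / 2 * (?Ip s + ?Im s)"
        by (subst nn_integral_cmult) (auto simp: nn_integral_add)
      finally show "ennreal ?A * (ennreal (exp (e * s)) * (\<integral>\<^sup>+c. ?w * ?g s c x / 2 \<partial>lborelI I))
        = ennreal ?A * ?w / 2 * (ennreal (exp (e * s)) * ?Ip s + ennreal (exp (e * s)) * ?Im s)"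
        by (simp add: divide_ennreal_def mult_ac distrib_left)
    qed
    also have "\<dots> = ennreal ?A * ?w / 2 * ((\<integral>\<^sup>+s. ennreal (exp (e * s)) * ?Ip s \<partial>lborel) + (\<integral>\<^sup>+s. ennreal (exp (e * s)) * ?Im s \<partial>lborel))"
      by (subst nn_integral_cmult) (auto simp: nn_integral_add)
    also have "\<dots> \<le> ennreal ?A * ?w / 2 * (?b + ?b)"
      by (intro mult_left_mono add_mono p m) auto
    also have "\<dots> = ennreal (?A * ((F x)\<^sup>2 * Q x powr k) / 2 * (?B * Q x powr (e - k) + ?B * Q x powr (e - k)))"
    proof -
      have ennreal_aux: "ennreal a * ennreal w / 2 * (ennreal b + ennreal b) = ennreal (a * w / 2 * (b + b))"
        if "a \<ge> 0" "w \<ge> 0" "b \<ge> 0" for a w b :: real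
      proof -
        have "ennreal a * ennreal w / 2 * (ennreal b + ennreal b) = ennreal (a * w) / ennreal 2 * ennreal (b + b)"
          using that by (simp add: ennreal_mult mult_2[symmetric])
        also have "\<dots> = ennreal (a * w / 2) * ennreal (b + b)"
          using that by (subst divide_ennreal) auto
        also have "\<dots> = ennreal (a * w / 2 * (b + b))"
          using that by (intro ennreal_mult[symmetric]) auto
        finally show ?thesis .
      qed
      show ?thesis
        by (rule ennreal_aux) (intro A0 mult_nonneg_nonneg[OF B0] mult_nonneg_nonneg powr_ge_zero zero_le_power2)+
    qed
    \<comment> \<open>The weight \<open>Q x powr k\<close> attached to \<open>F\<close> meets
      \<open>Q x powr (e - k)\<close> from the average, which leaves \<open>Q x powr e\<close>; the
      two signs make up for the factor one half.\<close>
    also have "?A * ((F x)\<^sup>2 * Q x powr k) / 2 * (?B * Q x powr (e - k) + ?B * Q x powr (e - k))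
       = ?A * ?B * (Q x powr e * (F x)\<^sup>2)"
      using Qx by (simp add: powr_diff)
    finally show "(\<integral>\<^sup>+s. ennreal ?A * (ennreal (exp (e * s)) * (\<integral>\<^sup>+c. ?w * ?g s c x / 2 \<partial>lborelI I)) \<partial>lborel)
       \<le> ennreal (?A * ?B) * ennreal (Q x powr e * (F x)\<^sup>2)"
      by (simp only: ennreal_mult'[OF mult_nonneg_nonneg[OF A0 B0]])
  qed
  also have "\<dots> = ennreal (?A * ?B) * (\<integral>\<^sup>+x. ennreal (Q x powr e * (F x)\<^sup>2) \<partial>lborel)"
    by (rule nn_integral_cmult) measurable
  also have "?A * ?B = pi powr (2 * e) * Gamma (k - e) / Gamma (k + e)"
    using Gamma_real_pos[OF e(1)] by (simp add: field_simps powr_add[symmetric] mult_2)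
  finally show ?thesis unfolding q_def Q_def .
qed

section \<open>From Pitt to the logarithm\<close>

text \<open>The tangent inequality for \<open>exp\<close>. As it holds for each \<open>e\<close>,
  the \<open>q\<close> side of the logarithmic inequality is bounded without passing to a limit
  under its integral.\<close>

lemma ln_ge_powr:
  fixes q e :: real
  assumes "q > 0" "e > 0"
  shows "(1 - q powr - e) / e \<le> ln q"
proof -
  have "1 + (- e * ln q) \<le> exp (- e * ln q)" by (rule exp_ge_add_one_self)
  then show ?thesis using assms by (simp add: powr_def field_simps)
qed

lemma powr_ge_ln:
  fixes p e :: real
  assumes "p > 0" "e > 0"
  shows "ln p \<le> (p powr e - 1) / e"
proof -
  have "1 + (e * ln p) \<le> exp (e * ln p)" by (rule exp_ge_add_one_self)
  then show ?thesis using assms by (simp add: powr_def field_simps)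
qed

text \<open>Together with \<open>powr_ge_ln\<close> this confines the difference quotient to the
  interval from \<open>ln p\<close> to \<open>p - 1\<close>, uniformly in \<open>e\<close>, which
  supplies the majorant for dominated convergence.\<close>

lemma powr_Bernoulli:
  fixes p e :: real
  assumes "p \<ge> 0" "e > 0" "e \<le> 1"
  shows "(p powr e - 1) / e \<le> p - 1"
proof (cases "p = 0")
  case False
  then have p: "p > 0" using assms by simp
  \<comment> \<open>The tangent inequality for \<open>exp\<close> at two points, with weights
    \<open>e\<close> and \<open>1 - e\<close> for which the linear terms cancel; the left side is
    just 1.\<close>
  have "e * (1 + (1 - e) * ln p) + (1 - e) * (1 + - e * ln p)
      \<le> e * exp ((1 - e) * ln p) + (1 - e) * exp (- e * ln p)"
    using assms by (intro add_mono mult_left_mono exp_ge_add_one_self) auto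
  moreover have "exp ((1 - e) * ln p) = p / p powr e" "exp (- e * ln p) = 1 / p powr e"
    using p by (simp_all add: powr_def left_diff_distrib exp_diff exp_minus inverse_eq_divide)
  ultimately have "1 \<le> (e * p + (1 - e)) / p powr e"
    by (simp add: algebra_simps add_divide_distrib diff_divide_distrib)
  then have "p powr e \<le> e * p + (1 - e)" using p by (simp add: field_simps)
  then show ?thesis using assms by (simp add: field_simps)
qed (use assms in auto)

text \<open>Where \<open>ln q\<close> is nonnegative it is at most \<open>q\<close>; elsewhere
  \<open>ln_ge_powr\<close> bounds its modulus by the negative power. Hence one moment of each kind
  suffices.\<close>

lemma integrable_ln_weight:
  fixes q R :: "'a \<Rightarrow> real"
  assumes [measurable]: "q \<in> borel_measurable M"
    and q: "AE x in M. q x > 0" and R: "\<And>x. R x \<ge> 0" "integrable M R"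
    and e: "e > 0"
    and int: "integrable M (\<lambda>x. q x * R x)" "integrable M (\<lambda>x. q x powr - e * R x)"
  shows "integrable M (\<lambda>x. ln (q x) * R x)"
proof (rule Bochner_Integration.integrable_bound)
  show "integrable M (\<lambda>x. q x * R x + (R x + q x powr - e * R x) / e)"
    using int R by auto
  show "AE x in M. norm (ln (q x) * R x) \<le> norm (q x * R x + (R x + q x powr - e * R x) / e)"
    using q
  proof eventually_elim
    case (elim x)
    have "\<bar>ln (q x)\<bar> \<le> q x + (1 + q x powr - e) / e"
    proof (cases "ln (q x) \<ge> 0")
      case True
      then show ?thesis using ln_bound[OF elim] e by (auto intro: add_increasing2)
    next
      case False
      have "- ln (q x) \<le> (q x powr - e - 1) / e"
        using ln_ge_powr[OF elim e] minus_divide_left[of "1 - q x powr - e" e] by simp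
      also have "\<dots> \<le> q x + (1 + q x powr - e) / e"
        using elim e by (simp add: field_simps)
      finally show ?thesis using False by simp
    qed
    then have "\<bar>ln (q x)\<bar> * R x \<le> (q x + (1 + q x powr - e) / e) * R x"
      using R by (intro mult_right_mono) auto
    also have "\<dots> = q x * R x + (R x + q x powr - e * R x) / e"
      by (simp add: field_simps)
    finally show ?case using R by (simp add: abs_mult)
  qed
qed (use R in measurable)

text \<open>The constant equals 1 at \<open>e = 0\<close>, so this is also its logarithmic
  derivative; each of the two Gamma factors contributes \<open>- Digamma k\<close>.\<close>

lemma Pitt_constant_deriv:
  fixes k :: real
  assumes "k > 0"
  shows "((\<lambda>e. pi powr (2 * e) * Gamma (k - e) / Gamma (k + e)) has_real_derivative
     2 * ln pi - 2 * Digamma k) (at 0)"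
proof -
  have g: "Gamma k > 0" using assms by (rule Gamma_real_pos)
  have nk: "k \<notin> \<int>\<^sub>\<le>\<^sub>0" using assms by (auto simp: nonpos_Ints_def)
  show ?thesis
    by (rule derivative_eq_intros refl | use nk g in \<open>simp; fail\<close>)+
       (use g in \<open>simp add: field_simps power2_eq_square\<close>)
qed

text \<open>Divided by \<open>e\<close>, \<open>Pitt\<close> bounds the logarithmic integral of
  \<open>q\<close> from below for each small \<open>e\<close>. The limit is then needed only in the
  constant and in the integral of \<open>p powr e\<close>, where dominated convergence requires
  \<open>ln p * P\<close> to be integrable; this is what \<open>Pitt'\<close> provides.\<close>

lemma log_from_Pitt:
  fixes p q P R :: "'a \<Rightarrow> real"
  assumes k: "k > 0"
    and [measurable]: "p \<in> borel_measurable M" "q \<in> borel_measurable M"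
    and p: "AE x in M. p x > 0" and q: "AE x in M. q x > 0"
    and P: "\<And>x. P x \<ge> 0" "integrable M P" and R: "\<And>x. R x \<ge> 0" "integrable M R"
    and eq: "(\<integral>x. R x \<partial>M) = (\<integral>x. P x \<partial>M)"
    and pP: "integrable M (\<lambda>x. p x * P x)" and qR: "integrable M (\<lambda>x. q x * R x)"
    and Pitt: "\<And>e. 0 < e \<Longrightarrow> e < k \<Longrightarrow> (\<integral>\<^sup>+x. ennreal (q x powr - e * R x) \<partial>M)
      \<le> ennreal (pi powr (2 * e) * Gamma (k - e) / Gamma (k + e)) * (\<integral>\<^sup>+x. ennreal (p x powr e * P x) \<partial>M)"
    and Pitt': "\<And>e. 0 < e \<Longrightarrow> e < k \<Longrightarrow> (\<integral>\<^sup>+x. ennreal (p x powr - e * P x) \<partial>M)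
      \<le> ennreal (pi powr (2 * e) * Gamma (k - e) / Gamma (k + e)) * (\<integral>\<^sup>+x. ennreal (q x powr e * R x) \<partial>M)"
  shows "integrable M (\<lambda>x. ln (p x) * P x)" "integrable M (\<lambda>x. ln (q x) * R x)"
    "(\<integral>x. ln (q x) * R x \<partial>M) + (\<integral>x. ln (p x) * P x \<partial>M) \<ge> 2 * (Digamma k - ln pi) * (\<integral>x. P x \<partial>M)"
proof -
  define c where "c e = pi powr (2 * e) * Gamma (k - e) / Gamma (k + e)" for e
  have [measurable]: "P \<in> borel_measurable M" "R \<in> borel_measurable M" using P R by auto
  have c0: "c e \<ge> 0" if "0 < e" "e < k" for e
    using that by (auto simp: c_def intro!: divide_nonneg_nonneg mult_nonneg_nonneg less_imp_le[OF Gamma_real_pos])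
  have up: "integrable M (\<lambda>x. w x powr e * W x)"
    if [measurable]: "w \<in> borel_measurable M" and w: "AE x in M. w x > 0" and W: "\<And>x. W x \<ge> 0" "integrable M W" "integrable M (\<lambda>x. w x * W x)"
    and e: "0 < e" "e \<le> 1" for w W :: "'a \<Rightarrow> real" and e
  proof (rule Bochner_Integration.integrable_bound)
    show "integrable M (\<lambda>x. W x + w x * W x)" using W by auto
    show "AE x in M. norm (w x powr e * W x) \<le> norm (W x + w x * W x)"
      using w
    proof eventually_elim
      case (elim x)
      have "w x powr e \<le> 1 + e * (w x - 1)" using powr_Bernoulli[of "w x" e] elim e by (simp add: field_simps)
      also have "\<dots> \<le> 1 + w x"
      proof -
        have "e * w x \<le> w x" using elim e by (intro mult_left_le_one_le) auto
        then show ?thesis using e by (simp add: right_diff_distrib)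
      qed
      finally have "w x powr e * W x \<le> (1 + w x) * W x" using W by (intro mult_right_mono) auto
      then show ?case using W elim by (simp add: abs_mult algebra_simps)
    qed
  qed (use W in measurable)
  \<comment> \<open>Formulated for a generic pair of weights so that it serves both
    \<open>Pitt\<close> and \<open>Pitt'\<close>.\<close>
  have down: "integrable M (\<lambda>x. v x powr - e * V x) \<and> (\<integral>x. v x powr - e * V x \<partial>M) \<le> c e * (\<integral>x. w x powr e * W x \<partial>M)"
    if [measurable]: "v \<in> borel_measurable M" "w \<in> borel_measurable M" "V \<in> borel_measurable M"
    and w: "AE x in M. w x > 0" and V: "\<And>x. V x \<ge> 0" and W: "\<And>x. W x \<ge> 0" "integrable M W" "integrable M (\<lambda>x. w x * W x)"
    and e: "0 < e" "e \<le> 1" "e < k"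
    and le: "(\<integral>\<^sup>+x. ennreal (v x powr - e * V x) \<partial>M) \<le> ennreal (c e) * (\<integral>\<^sup>+x. ennreal (w x powr e * W x) \<partial>M)"
    for v w V W :: "'a \<Rightarrow> real" and e
  proof -
    have i: "integrable M (\<lambda>x. w x powr e * W x)" by (rule up) (use that in auto)
    have "(\<integral>\<^sup>+x. ennreal (w x powr e * W x) \<partial>M) = ennreal (\<integral>x. w x powr e * W x \<partial>M)"
      using i W by (intro nn_integral_eq_integral) auto
    then have le': "(\<integral>\<^sup>+x. ennreal (v x powr - e * V x) \<partial>M) \<le> ennreal (c e * (\<integral>x. w x powr e * W x \<partial>M))"
      using le c0 e by (simp add: ennreal_mult')
    have i2: "integrable M (\<lambda>x. v x powr - e * V x)"
      using le' V by (intro integrableI_bounded) (auto simp: abs_mult intro: le_less_trans)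
    moreover have "ennreal (\<integral>x. v x powr - e * V x \<partial>M) \<le> ennreal (c e * (\<integral>x. w x powr e * W x \<partial>M))"
      using le' i2 V by (subst (asm) nn_integral_eq_integral) auto
    ultimately show ?thesis
      using c0 e W by (subst (asm) ennreal_le_iff) (auto intro!: mult_nonneg_nonneg integral_nonneg)
  qed
  \<comment> \<open>\<open>e < k\<close> is the range of the Pitt inequalities,
    \<open>e \<le> 1\<close> that of Bernoulli's bound; halving \<open>k\<close> makes the former
    strict.\<close>
  define e0 where "e0 = min (k / 2) 1"
  have e0: "0 < e0" "e0 \<le> 1" "e0 < k" using k by (auto simp: e0_def min_def)
  have q1: "integrable M (\<lambda>x. q x powr - e * R x)" "(\<integral>x. q x powr - e * R x \<partial>M) \<le> c e * (\<integral>x. p x powr e * P x \<partial>M)"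
    if "0 < e" "e \<le> 1" "e < k" for e
    using down[of q p R P e] p P R pP Pitt[of e] that by (auto simp: c_def)
  have p1: "integrable M (\<lambda>x. p x powr - e * P x)"
    if "0 < e" "e \<le> 1" "e < k" for e
    using down[of p q P R e] q P R qR Pitt'[of e] that by (auto simp: c_def)
  show lnp: "integrable M (\<lambda>x. ln (p x) * P x)"
    by (rule integrable_ln_weight[OF _ p P e0(1) pP p1]) (use e0 in auto)
  show lnq: "integrable M (\<lambda>x. ln (q x) * R x)"
    by (rule integrable_ln_weight[OF _ q R e0(1) qR q1(1)]) (use e0 in auto)
  define N where "N = (\<integral>x. P x \<partial>M)"
  define H where "H e = (\<integral>x. p x powr e * P x \<partial>M)" for e
  \<comment> \<open>Dominated convergence is applied along a sequence of exponents tending to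
    0.\<close>
  define e where "e n = e0 / real (Suc n)" for n
  have en: "0 < e n" "e n \<le> 1" "e n < k" for n
  proof -
    have "e n \<le> e0" using e0 by (simp add: e_def field_simps)
    then show "0 < e n" "e n \<le> 1" "e n < k" using e0 by (auto simp: e_def)
  qed
  have elim: "e \<longlonglongrightarrow> 0"
    unfolding e_def[abs_def] by real_asymp
  have lower: "(N - c (e n) * H (e n)) / e n \<le> (\<integral>x. ln (q x) * R x \<partial>M)" for n
  proof -
    have "(N - c (e n) * H (e n)) / e n \<le> (N - (\<integral>x. q x powr - e n * R x \<partial>M)) / e n"
      using q1(2)[OF en] en[of n] by (intro divide_right_mono) (auto simp: H_def)
    also have "\<dots> = (\<integral>x. (1 - q x powr - e n) / e n * R x \<partial>M)"
      using q1(1)[OF en] R eq by (simp add: N_def left_diff_distrib divide_simps en(1)[of n, THEN less_imp_neq, symmetric] flip: integral_divide)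
    also have "\<dots> \<le> (\<integral>x. ln (q x) * R x \<partial>M)"
    proof (rule integral_mono_AE)
      show "integrable M (\<lambda>x. (1 - q x powr - e n) / e n * R x)"
        using q1(1)[OF en] R by (simp add: left_diff_distrib diff_divide_distrib)
      show "AE x in M. (1 - q x powr - e n) / e n * R x \<le> ln (q x) * R x"
        using q by eventually_elim (intro mult_right_mono ln_ge_powr en R)
    qed (rule lnq)
    finally show ?thesis .
  qed
  have Hlim: "(\<lambda>n. (H (e n) - N) / e n) \<longlonglongrightarrow> (\<integral>x. ln (p x) * P x \<partial>M)"
  proof -
    have "(\<lambda>n. \<integral>x. (p x powr e n - 1) / e n * P x \<partial>M) \<longlonglongrightarrow> (\<integral>x. ln (p x) * P x \<partial>M)"
    proof (rule integral_dominated_convergence)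
      show "integrable M (\<lambda>x. \<bar>ln (p x) * P x\<bar> + (P x + p x * P x))"
        using lnp P pP by auto
      show "AE x in M. (\<lambda>n. (p x powr e n - 1) / e n * P x) \<longlonglongrightarrow> ln (p x) * P x"
        using p
      proof eventually_elim
        case (elim x)
        have "((\<lambda>t. p x powr t) has_real_derivative ln (p x)) (at 0)"
          using elim by (auto intro!: derivative_eq_intros)
        then have "((\<lambda>t. (p x powr t - 1) / t) \<longlongrightarrow> ln (p x)) (at 0)"
          using elim by (simp add: has_field_derivative_iff)
        moreover have "filterlim e (at 0) sequentially"
          using \<open>e \<longlonglongrightarrow> 0\<close> en by (auto simp: filterlim_at less_imp_neq[symmetric] intro!: always_eventually)
        ultimately have "(\<lambda>n. (p x powr e n - 1) / e n) \<longlonglongrightarrow> ln (p x)"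
          by (rule filterlim_compose)
        then show ?case by (intro tendsto_mult tendsto_const)
      qed
      show "AE x in M. norm ((p x powr e n - 1) / e n * P x) \<le> \<bar>ln (p x) * P x\<bar> + (P x + p x * P x)" for n
        using p
      proof eventually_elim
        case (elim x)
        have "\<bar>(p x powr e n - 1) / e n\<bar> \<le> \<bar>ln (p x)\<bar> + (1 + p x)"
          using powr_ge_ln[OF elim en(1)[of n]] powr_Bernoulli[of "p x" "e n"] elim en[of n] by linarith
        then have "\<bar>(p x powr e n - 1) / e n\<bar> * P x \<le> (\<bar>ln (p x)\<bar> + (1 + p x)) * P x"
          using P by (intro mult_right_mono) auto
        also have "\<dots> = \<bar>ln (p x) * P x\<bar> + (P x + p x * P x)"
          using P by (simp add: abs_mult distrib_right)
        finally show ?case using P by (simp only: real_norm_def abs_mult[of "(p x powr e n - 1) / e n"] abs_of_nonneg)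
      qed
    qed measurable
    moreover have "(\<integral>x. (p x powr e n - 1) / e n * P x \<partial>M) = (H (e n) - N) / e n" for n
    proof -
      have "integrable M (\<lambda>x. p x powr e n * P x)" by (rule up) (use p P pP en in auto)
      then show ?thesis
        using P by (simp add: H_def N_def left_diff_distrib)
    qed
    ultimately show ?thesis by (simp only:)
  qed
  have HN: "(\<lambda>n. H (e n)) \<longlonglongrightarrow> N"
  proof -
    have "(\<lambda>n. N + e n * ((H (e n) - N) / e n)) \<longlonglongrightarrow> N + 0 * (\<integral>x. ln (p x) * P x \<partial>M)"
      by (intro tendsto_intros elim Hlim)
    moreover have "N + e n * ((H (e n) - N) / e n) = H (e n)" for n
      using en(1)[of n] by simp
    ultimately show ?thesis by simp
  qed
  have clim: "(\<lambda>n. (c (e n) - 1) / e n) \<longlonglongrightarrow> 2 * ln pi - 2 * Digamma k"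
  proof -
    have "((\<lambda>t. (c t - c 0) / (t - 0)) \<longlongrightarrow> 2 * ln pi - 2 * Digamma k) (at 0)"
      using Pitt_constant_deriv[OF k] unfolding c_def[abs_def] has_field_derivative_iff by simp
    moreover have "c 0 = 1" using Gamma_real_pos[OF k] by (simp add: c_def)
    moreover have "filterlim e (at 0) sequentially"
      using \<open>e \<longlonglongrightarrow> 0\<close> en by (auto simp: filterlim_at less_imp_neq[symmetric] intro!: always_eventually)
    ultimately show ?thesis
      by (auto dest: filterlim_compose)
  qed
  \<comment> \<open>Splitting \<open>N - c H\<close> as \<open>- (c - 1) H - (H - N)\<close>
    separates the first-order change of the constant from that of the moment.\<close>
  have "(\<lambda>n. - ((c (e n) - 1) / e n) * H (e n) - (H (e n) - N) / e n)
     \<longlonglongrightarrow> - (2 * ln pi - 2 * Digamma k) * N - (\<integral>x. ln (p x) * P x \<partial>M)"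
    by (intro tendsto_intros clim HN Hlim)
  moreover have "- ((c (e n) - 1) / e n) * H (e n) - (H (e n) - N) / e n = (N - c (e n) * H (e n)) / e n" for n
    using en(1)[of n] by (simp add: field_simps)
  ultimately have "- (2 * ln pi - 2 * Digamma k) * N - (\<integral>x. ln (p x) * P x \<partial>M) \<le> (\<integral>x. ln (q x) * R x \<partial>M)"
    using lower by (intro LIMSEQ_le_const2) auto
  then show "(\<integral>x. ln (q x) * R x \<partial>M) + (\<integral>x. ln (p x) * P x \<partial>M) \<ge> 2 * (Digamma k - ln pi) * (\<integral>x. P x \<partial>M)"
    by (simp add: N_def algebra_simps)
qed

section \<open>Symplectic block matrices and the Moore-Penrose inverse\<close>

declare transpose_matrix_vector [simp del]

lemma inner_matrix_vector_transpose:
  fixes A :: "real^'n^'m"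
  shows "(A *v x) \<bullet> y = x \<bullet> (transpose A *v y)"
  using adjoint_works[OF matrix_vector_mul_linear, of x A y] by (simp add: adjoint_matrix)

lemma sum_UNIV_Plus:
  fixes g :: "'a::finite + 'b::finite \<Rightarrow> 'c::comm_monoid_add"
  shows "sum g UNIV = (\<Sum>i\<in>UNIV. g (Inl i)) + (\<Sum>i\<in>UNIV. g (Inr i))"
  unfolding UNIV_Plus_UNIV[symmetric] by (subst sum.Plus) auto

lemma block_mat_mult:
  fixes A B C D A' B' C' D' :: "real^'n^'n"
  shows "block_mat A B C D ** block_mat A' B' C' D'
    = block_mat (A ** A' + B ** C') (A ** B' + B ** D') (C ** A' + D ** C') (C ** B' + D ** D')"
  by (simp add: block_mat_def matrix_matrix_mult_def vec_eq_iff sum_UNIV_Plus split: sum.split)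

lemma transpose_block_mat:
  "transpose (block_mat A B C D) = block_mat (transpose A) (transpose C) (transpose B) (transpose D)"
  by (simp add: block_mat_def transpose_def vec_eq_iff split: sum.split)

lemma block_mat_eq_iff:
  "block_mat A B C D = block_mat A' B' C' D' \<longleftrightarrow> A = A' \<and> B = B' \<and> C = C' \<and> D = D'"
proof
  assume h: "block_mat A B C D = block_mat A' B' C' D'"
  have "block_mat A B C D $ i $ j = block_mat A' B' C' D' $ i $ j" for i j using h by simp
  from this[of "Inl _" "Inl _"] this[of "Inl _" "Inr _"] this[of "Inr _" "Inl _"] this[of "Inr _" "Inr _"]
  show "A = A' \<and> B = B' \<and> C = C' \<and> D = D'"
    by (simp add: block_mat_def vec_eq_iff)
qed simp

lemma block_mat_one: "block_mat (mat 1) 0 0 (mat 1) = mat 1"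
  by (simp add: block_mat_def mat_def vec_eq_iff split: sum.split)

lemma position_block_mat: "position (block_mat A B C D *v z) = A *v position z + B *v momentum z"
  by (simp add: position_def momentum_def block_mat_def matrix_vector_mult_def vec_eq_iff sum_UNIV_Plus)

lemma exists_phase_point: "\<exists>z. position z = x \<and> momentum z = \<xi>"
  by (rule exI[of _ "\<chi> i. case i of Inl p \<Rightarrow> x $ p | Inr p \<Rightarrow> \<xi> $ p"])
     (simp add: position_def momentum_def vec_eq_iff)

lemma matrix_uminus_left: "(- A :: real^'n^'m) ** B = - (A ** B)"
  by (simp add: matrix_matrix_mult_def vec_eq_iff sum_negf)

lemma matrix_uminus_right: "(A :: real^'n^'m) ** (- B) = - (A ** B)"
  by (simp add: matrix_matrix_mult_def vec_eq_iff sum_negf)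

lemma symplectic_blocks:
  assumes "symplectic (block_mat A B C D)"
  shows "transpose A ** C = transpose C ** A" "transpose A ** D - transpose C ** B = mat 1"
    "transpose D ** A - transpose B ** C = mat 1" "transpose B ** D = transpose D ** B"
proof -
  have z [simp]: "(0::real^'n^'n) ** X = 0" "X ** (0::real^'n^'n) = 0" for X :: "real^'n^'n"
    by (simp_all add: matrix_matrix_mult_def vec_eq_iff)
  have "block_mat (transpose A ** C - transpose C ** A) (transpose A ** D - transpose C ** B)
     (transpose B ** C - transpose D ** A) (transpose B ** D - transpose D ** B)
    = block_mat 0 (mat 1) (- mat 1) 0"
    using assms unfolding symplectic_def Let_def
    by (simp add: transpose_block_mat block_mat_mult matrix_uminus_left matrix_uminus_right)
  then show "transpose A ** C = transpose C ** A" "transpose A ** D - transpose C ** B = mat 1"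
    "transpose D ** A - transpose B ** C = mat 1" "transpose B ** D = transpose D ** B"
    unfolding block_mat_eq_iff by (auto simp: algebra_simps)
qed

text \<open>The defining identity gives a left inverse, which for square matrices is also a right
  inverse. Reading off the product in this order yields the second set of block relations,
  \<open>symplectic_blocks'\<close>.\<close>

lemma symplectic_inverse:
  assumes "symplectic (block_mat A B C D)"
  shows "block_mat A B C D ** block_mat (transpose D) (- transpose B) (- transpose C) (transpose A) = mat 1"
proof -
  have "block_mat (transpose D) (- transpose B) (- transpose C) (transpose A) ** block_mat A B C D = mat 1"
    using symplectic_blocks[OF assms]
    by (simp add: block_mat_mult matrix_uminus_left block_mat_one[symmetric] block_mat_eq_iff)
  then show ?thesis by (simp add: matrix_left_right_inverse)
qed

lemma symplectic_blocks':
  assumes "symplectic (block_mat A B C D)"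
  shows "A ** transpose D - B ** transpose C = mat 1" "A ** transpose B = B ** transpose A"
proof -
  have "A ** transpose D - B ** transpose C = mat 1 \<and> B ** transpose A - A ** transpose B = 0"
    using symplectic_inverse[OF assms]
    by (simp add: block_mat_mult matrix_uminus_right block_mat_one[symmetric] block_mat_eq_iff)
  then show "A ** transpose D - B ** transpose C = mat 1" "A ** transpose B = B ** transpose A"
    by auto
qed

section \<open>Kernels, oblique projections and the Moore-Penrose inverse\<close>

lemma subspace_ker: "subspace (ker B)"
  by (auto simp: subspace_def ker_def matrix_vector_right_distrib matrix_vector_mult_scaleR)

lemma orthogonal_comp_ker: "(ker B)\<^sup>\<bottom> = range ((*v) (transpose B))"
proof -
  have "ker B = (range ((*v) (transpose B)))\<^sup>\<bottom>"
    using ker_orthogonal_comp_adjoint[OF matrix_vector_mul_linear[of B]]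
    by (auto simp: adjoint_matrix ker_def vimage_def)
  then show ?thesis
    by (simp add: orthogonal_comp_self linear_subspace_image[OF matrix_vector_mul_linear])
qed

lemma dim_orthogonal_comp_ker: "dim ((ker B)\<^sup>\<bottom>) = rank (B :: real^'n^'m)"
  by (metis orthogonal_comp_ker rank_dim_range rank_transpose)

lemma ker_decomp:
  fixes B :: "real^'n^'m"
  obtains u k where "u \<in> (ker B)\<^sup>\<bottom>" "k \<in> ker B" "x = u + k"
proof -
  obtain k u where "k \<in> span (ker B)" "\<And>w. w \<in> span (ker B) \<Longrightarrow> orthogonal u w" "x = k + u"
    by (rule orthogonal_subspace_decomp_exists) blast
  then show ?thesis
    using that[of u k] subspace_ker[of B]
    by (auto simp: orthogonal_comp_def orthogonal_commute add.commute span_eq_iff[THEN iffD2])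
qed

lemma ker_inter_orthogonal: "x \<in> ker B \<Longrightarrow> x \<in> (ker B)\<^sup>\<bottom> \<Longrightarrow> x = 0"
  by (auto simp: orthogonal_comp_def orthogonal_def)

lemma proj_along_props:
  fixes U W :: "(real^'n) set"
  assumes U: "subspace U" and W: "subspace W" and triv: "\<And>x. x \<in> U \<Longrightarrow> x \<in> W \<Longrightarrow> x = 0"
    and ex: "\<And>x. \<exists>u\<in>U. \<exists>w\<in>W. x = u + w"
  shows proj_along_in: "proj_along U W x \<in> U"
    and proj_along_eq: "u \<in> U \<Longrightarrow> x - u \<in> W \<Longrightarrow> proj_along U W x = u"
    and linear_proj_along: "linear (proj_along U W)"
proof -
  have uniq: "\<exists>!u. u \<in> U \<and> x - u \<in> W" for x
  proof -
    obtain u w where "u \<in> U" "w \<in> W" "x = u + w" using ex by blast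
    then show ?thesis
    proof (intro ex1I[of _ u])
      fix v assume v: "v \<in> U \<and> x - v \<in> W"
      have "u - v \<in> U" using U v \<open>u \<in> U\<close> by (simp add: subspace_diff)
      moreover have "u - v = (x - v) - w" using \<open>x = u + w\<close> by simp
      then have "u - v \<in> W" using subspace_diff[OF W, of "x - v" w] v \<open>w \<in> W\<close> by (simp only:)
      ultimately show "v = u" using triv[of "u - v"] by simp
    qed auto
  qed
  have p: "proj_along U W x \<in> U \<and> x - proj_along U W x \<in> W" for x
    unfolding proj_along_def by (rule theI'[OF uniq])
  then show "proj_along U W x \<in> U" by blast
  have eq: "proj_along U W x = u" if "u \<in> U" "x - u \<in> W" for x u
    using uniq[of x] p[of x] that by blast
  then show "u \<in> U \<Longrightarrow> x - u \<in> W \<Longrightarrow> proj_along U W x = u" .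
  show "linear (proj_along U W)"
  proof (rule linearI)
    fix x y c
    show "proj_along U W (x + y) = proj_along U W x + proj_along U W y"
      using p[of x] p[of y] subspace_add[OF W, of "x - proj_along U W x" "y - proj_along U W y"]
      by (intro eq) (auto intro: subspace_add U simp: algebra_simps)
    show "proj_along U W (c *\<^sub>R x) = c *\<^sub>R proj_along U W x"
      using p[of x] subspace_scale[OF W, of "x - proj_along U W x" c]
      by (intro eq) (auto intro: subspace_scale U simp: algebra_simps)
  qed
qed

text \<open>\<open>X\<close> is the orthogonal projection \<open>Q\<close> onto the range of
  \<open>B\<close>, followed by the inverse \<open>g\<close> of \<open>B\<close> restricted to the
  orthogonal complement of its kernel. Thus \<open>B ** X\<close> and \<open>X ** B\<close> are
  orthogonal projections, hence symmetric.\<close>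

lemma moore_penrose_exists:
  fixes B :: "real^'n^'m"
  shows "\<exists>X. B ** X ** B = B \<and> X ** B ** X = X \<and> transpose (B ** X) = B ** X \<and> transpose (X ** B) = X ** B"
proof -
  let ?V = "(ker B)\<^sup>\<bottom>"
  have V: "subspace ?V" by (rule subspace_orthogonal_comp)
  have inj: "inj_on ((*v) B) ?V"
  proof (rule inj_onI)
    fix x y assume "x \<in> ?V" "y \<in> ?V" "B *v x = B *v y"
    then have "x - y \<in> ker B" "x - y \<in> ?V"
      using V by (auto simp: ker_def matrix_vector_mult_diff_distrib subspace_diff)
    then show "x = y" using ker_inter_orthogonal by fastforce
  qed
  obtain g where g: "range g \<subseteq> ?V" "linear g" "\<And>v. v \<in> ?V \<Longrightarrow> g (B *v v) = v"
    using linear_exists_left_inverse_on[OF matrix_vector_mul_linear V inj] by blast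
  have perp: "\<exists>v\<in>?V. \<exists>n. (\<forall>w. n \<bullet> (B *v w) = 0) \<and> y = B *v v + n" for y
  proof -
    obtain p n where "p \<in> span (range ((*v) B))" "\<And>w. w \<in> span (range ((*v) B)) \<Longrightarrow> orthogonal n w" "y = p + n"
      by (rule orthogonal_subspace_decomp_exists) blast
    then have pn: "p \<in> range ((*v) B)" "\<And>w. n \<bullet> (B *v w) = 0" "y = p + n"
      by (auto simp: span_eq_iff[THEN iffD2] linear_subspace_image orthogonal_def)
    then obtain x where "p = B *v x" by blast
    moreover obtain u k where "u \<in> ?V" "k \<in> ker B" "x = u + k" by (rule ker_decomp)
    ultimately have "p = B *v u" by (simp add: ker_def matrix_vector_right_distrib)
    then show ?thesis using pn \<open>u \<in> ?V\<close> by blast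
  qed
  \<comment> \<open>The value is chosen pointwise; \<open>Qeq\<close> shows that the choice is
    forced, and linearity follows from that.\<close>
  define Q where "Q y = (SOME p. p \<in> range ((*v) B) \<and> (\<forall>w. (y - p) \<bullet> (B *v w) = 0))" for y
  have Q: "Q y \<in> range ((*v) B) \<and> (\<forall>w. (y - Q y) \<bullet> (B *v w) = 0)" for y
    unfolding Q_def by (rule someI_ex) (use perp[of y] in \<open>metis add_diff_cancel_left' rangeI\<close>)
  have Qeq: "Q y = B *v v" if "\<And>w. (y - B *v v) \<bullet> (B *v w) = 0" for y v
  proof -
    obtain z where z: "Q y = B *v z" using Q by blast
    have "(Q y - B *v v) \<bullet> (B *v w) = 0" for w
    proof -
      have "(Q y - B *v v) \<bullet> (B *v w) = (y - B *v v) \<bullet> (B *v w) - (y - Q y) \<bullet> (B *v w)"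
        by (simp add: inner_diff_left)
      then show ?thesis using that Q by simp
    qed
    from this[of "z - v"] show ?thesis
      by (simp add: z matrix_vector_mult_diff_distrib)
  qed
  have linQ: "linear Q"
  proof (rule linearI)
    fix x y c
    obtain a b where ab: "Q x = B *v a" "Q y = B *v b" using Q[of x] Q[of y] by blast
    have "Q (x + y) = B *v (a + b)"
      by (rule Qeq) (use Q[of x] Q[of y] ab in \<open>simp add: matrix_vector_right_distrib inner_diff_left inner_add_left\<close>)
    then show "Q (x + y) = Q x + Q y" by (simp add: ab matrix_vector_right_distrib)
    have "Q (c *\<^sub>R x) = B *v (c *\<^sub>R a)"
      by (rule Qeq) (use Q[of x] ab in \<open>simp add: matrix_vector_mult_scaleR inner_diff_left\<close>)
    then show "Q (c *\<^sub>R x) = c *\<^sub>R Q x" by (simp add: ab matrix_vector_mult_scaleR)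
  qed
  define X where "X = matrix (g \<circ> Q)"
  have X: "X *v y = g (Q y)" for y
    unfolding X_def using linear_compose[OF linQ g(2)] by (simp add: matrix_works)
  have QB: "Q (B *v w) = B *v w" for w by (rule Qeq) simp
  have Bg: "B *v g (Q y) = Q y" for y
  proof -
    obtain v n where v: "v \<in> ?V" "\<And>w. n \<bullet> (B *v w) = 0" "y = B *v v + n" using perp[of y] by blast
    then have "Q y = B *v v" by (intro Qeq) simp
    then show ?thesis using g(3)[OF v(1)] by simp
  qed
  have BX: "(B ** X) *v y = Q y" for y by (simp add: matrix_vector_mul_assoc[symmetric] X Bg)
  have XB: "(X ** B) *v w = g (B *v w)" for w by (simp add: matrix_vector_mul_assoc[symmetric] X QB)
  have gker: "w - g (B *v w) \<in> ker B" for w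
    using Bg[of "B *v w"] by (simp add: QB ker_def matrix_vector_mult_diff_distrib)
  have 1: "B ** X ** B = B"
    by (simp add: matrix_eq matrix_vector_mul_assoc[symmetric] X QB) (metis Bg QB)
  have 2: "X ** B ** X = X"
    by (simp add: matrix_eq matrix_vector_mul_assoc[symmetric] X Bg QB) (metis Bg QB)
  have sym: "transpose M = M" if "\<And>x y. (M *v x) \<bullet> y = x \<bullet> (M *v y)" for M :: "real^'z^'z"
  proof (rule matrix_eq[THEN iffD2], rule allI)
    fix y
    have "x \<bullet> (transpose M *v y) = x \<bullet> (M *v y)" for x
      using that[of x y] by (simp add: inner_matrix_vector_transpose)
    then show "transpose M *v y = M *v y" using vector_eq_ldot by blast
  qed
  have 3: "transpose (B ** X) = B ** X"
  proof (rule sym, unfold BX)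
    fix x y
    obtain a b where ab: "Q x = B *v a" "Q y = B *v b" using Q[of x] Q[of y] by blast
    have "(y - Q y) \<bullet> Q x = 0" "(x - Q x) \<bullet> Q y = 0" using Q ab by metis+
    then have "Q x \<bullet> y = Q x \<bullet> Q y" "x \<bullet> Q y = Q x \<bullet> Q y"
      by (metis eq_iff_diff_eq_0 inner_commute inner_diff_left)+
    then show "Q x \<bullet> y = x \<bullet> Q y" by simp
  qed
  have 4: "transpose (X ** B) = X ** B"
  proof (rule sym, unfold XB)
    fix x y
    have o: "g a \<bullet> (w - g (B *v w)) = 0" for a w
      using g(1) gker[of w] by (auto simp: orthogonal_comp_def orthogonal_def image_subset_iff inner_commute[of "g a"])
    have "g (B *v x) \<bullet> y = g (B *v x) \<bullet> g (B *v y)" using o[of "B *v x" y] by (simp add: inner_diff_right)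
    moreover have "x \<bullet> g (B *v y) = g (B *v x) \<bullet> g (B *v y)" using o[of "B *v y" x] by (simp add: inner_diff_right inner_commute)
    ultimately show "g (B *v x) \<bullet> y = x \<bullet> g (B *v y)" by simp
  qed
  show ?thesis using 1 2 3 4 by blast
qed

text \<open>Symmetry lets the products be reordered by transposition, which forces
  \<open>B ** X = B ** Y\<close> and \<open>X ** B = Y ** B\<close>; then
  \<open>X = X ** B ** X\<close> turns into \<open>Y ** B ** Y = Y\<close>.\<close>

lemma moore_penrose_unique:
  fixes B :: "real^'n^'m" and X Y :: "real^'m^'n"
  assumes "B ** X ** B = B" "X ** B ** X = X" "transpose (B ** X) = B ** X" "transpose (X ** B) = X ** B"
    and "B ** Y ** B = B" "Y ** B ** Y = Y" "transpose (B ** Y) = B ** Y" "transpose (Y ** B) = Y ** B"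
  shows "X = Y"
proof -
  have "B ** X = transpose (B ** Y ** B ** X)"
    using assms by (simp add: assms(5))
  also have "\<dots> = transpose (B ** X) ** transpose (B ** Y)"
    by (simp add: matrix_transpose_mul[symmetric] matrix_mul_assoc)
  also have "\<dots> = B ** Y"
    using assms by (simp add: matrix_mul_assoc)
  finally have BX: "B ** X = B ** Y" .
  have "X ** B = transpose (X ** (B ** Y ** B))"
    using assms by (simp add: assms(5))
  also have "\<dots> = transpose (Y ** B) ** transpose (X ** B)"
    by (simp add: matrix_transpose_mul[symmetric] matrix_mul_assoc)
  also have "\<dots> = Y ** B"
    using assms by (simp add: matrix_mul_assoc[symmetric])
  finally have XB: "X ** B = Y ** B" .
  have "X = X ** (B ** X)" using assms by (simp add: matrix_mul_assoc)
  also have "\<dots> = Y ** B ** Y" by (simp add: BX matrix_mul_assoc XB)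
  finally show ?thesis using assms by simp
qed

lemma moore_penrose_props:
  fixes B :: "real^'n^'m"
  defines "X \<equiv> moore_penrose B"
  shows "B ** X ** B = B" "X ** B ** X = X" "transpose (B ** X) = B ** X" "transpose (X ** B) = X ** B"
proof -
  have "\<exists>!X. B ** X ** B = B \<and> X ** B ** X = X \<and> transpose (B ** X) = B ** X \<and> transpose (X ** B) = X ** B"
    using moore_penrose_exists[of B] moore_penrose_unique[of B] by blast
  from theI'[OF this] show "B ** X ** B = B" "X ** B ** X = X" "transpose (B ** X) = B ** X" "transpose (X ** B) = X ** B"
    unfolding X_def moore_penrose_def by blast+
qed

lemma moore_penrose_in: "moore_penrose B *v y \<in> (ker B)\<^sup>\<bottom>"
proof -
  let ?X = "moore_penrose B"
  have "?X *v y = transpose (?X ** B) *v (?X *v y)"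
    by (simp add: moore_penrose_props matrix_vector_mul_assoc)
  also have "\<dots> = transpose B *v (transpose ?X *v (?X *v y))"
    by (simp add: matrix_transpose_mul matrix_vector_mul_assoc matrix_mul_assoc)
  finally show ?thesis unfolding orthogonal_comp_ker by blast
qed

lemma moore_penrose_left: "w - moore_penrose B *v (B *v w) \<in> ker B"
  by (simp add: ker_def matrix_vector_mult_diff_distrib matrix_vector_mul_assoc matrix_mul_assoc moore_penrose_props)

section \<open>The two direct sum decompositions of a symplectic matrix\<close>

lemma symplectic_decomp_position:
  fixes A B C D :: "real^'n^'n"
  assumes S: "symplectic (block_mat A B C D)"
  shows "x \<in> (ker B)\<^sup>\<bottom> \<Longrightarrow> x \<in> (*v) (transpose D ** A) ` ker B \<Longrightarrow> x = 0"
    and "\<exists>u\<in>(ker B)\<^sup>\<bottom>. \<exists>w\<in>(*v) (transpose D ** A) ` ker B. x = u + w"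
proof -
  \<comment> \<open>\<open>transpose D ** A\<close> differs from the identity by a map into the
    range of \<open>transpose B\<close>, which is the orthogonal complement of \<open>ker B\<close>.
    The image of \<open>ker B\<close> is therefore a graph over \<open>ker B\<close>, and both
    claims reduce to the orthogonal decomposition.\<close>
  have DA: "(transpose D ** A) *v k = k + transpose B *v (C *v k)" for k
  proof -
    have "transpose D ** A = mat 1 + transpose B ** C"
      using symplectic_blocks(3)[OF S] by (simp add: algebra_simps)
    then show ?thesis by (simp add: matrix_vector_mult_add_rdistrib matrix_vector_mul_assoc)
  qed
  have V: "subspace ((ker B)\<^sup>\<bottom>)" by (rule subspace_orthogonal_comp)
  have BT: "transpose B *v q \<in> (ker B)\<^sup>\<bottom>" for q unfolding orthogonal_comp_ker by blast
  show "x = 0" if x: "x \<in> (ker B)\<^sup>\<bottom>" "x \<in> (*v) (transpose D ** A) ` ker B"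
  proof -
    obtain k where k: "k \<in> ker B" "x = k + transpose B *v (C *v k)" using x(2) DA by auto
    have "x - transpose B *v (C *v k) \<in> (ker B)\<^sup>\<bottom>" using x(1) BT V by (intro subspace_diff)
    then have "k = 0" using k ker_inter_orthogonal[of k B] by simp
    then show ?thesis using k by simp
  qed
  obtain u k where "u \<in> (ker B)\<^sup>\<bottom>" "k \<in> ker B" "x = u + k" by (rule ker_decomp)
  then have "u - transpose B *v (C *v k) \<in> (ker B)\<^sup>\<bottom>"
    "x = (u - transpose B *v (C *v k)) + (transpose D ** A) *v k"
    using BT V by (auto simp: DA intro: subspace_diff)
  then show "\<exists>u\<in>(ker B)\<^sup>\<bottom>. \<exists>w\<in>(*v) (transpose D ** A) ` ker B. x = u + w"
    using \<open>k \<in> ker B\<close> by blast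
qed

text \<open>Since \<open>transpose D ** B = transpose B ** D\<close>, \<open>transpose D\<close>
  carries a vector common to both subspaces into both summands of the position decomposition, hence
  to 0. For spanning, \<open>transpose D *v x\<close> is split orthogonally and inserted into
  \<open>A ** transpose D - B ** transpose C = mat 1\<close>; the part in the range of
  \<open>transpose B\<close> lands in the range of \<open>B\<close> because
  \<open>A ** transpose B = B ** transpose A\<close>.\<close>

lemma symplectic_decomp_frequency:
  fixes A B C D :: "real^'n^'n"
  assumes S: "symplectic (block_mat A B C D)"
  shows "x \<in> range ((*v) B) \<Longrightarrow> x \<in> (*v) A ` ker B \<Longrightarrow> x = 0"
    and "\<exists>u\<in>range ((*v) B). \<exists>w\<in>(*v) A ` ker B. x = u + w"
proof -
  show "x = 0" if x: "x \<in> range ((*v) B)" "x \<in> (*v) A ` ker B"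
  proof -
    obtain k w where k: "k \<in> ker B" "x = A *v k" "x = B *v w" using x by auto
    have "(transpose D ** A) *v k = transpose D *v (B *v w)"
      using k by (metis matrix_vector_mul_assoc)
    also have "\<dots> = transpose B *v (D *v w)"
      using symplectic_blocks(4)[OF S] by (metis matrix_vector_mul_assoc)
    finally have "(transpose D ** A) *v k \<in> (ker B)\<^sup>\<bottom>" unfolding orthogonal_comp_ker by simp
    moreover have "(transpose D ** A) *v k \<in> (*v) (transpose D ** A) ` ker B" using k by blast
    ultimately have "(transpose D ** A) *v k = 0" using symplectic_decomp_position(1)[OF S] by blast
    moreover have "transpose D ** A = mat 1 + transpose B ** C"
      using symplectic_blocks(3)[OF S] by (simp add: algebra_simps)
    ultimately have "k = transpose B *v (- (C *v k))"
      by (simp add: matrix_vector_mult_add_rdistrib matrix_vector_mul_assoc add_eq_0_iff)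
         (metis linear_neg matrix_vector_mul_linear matrix_vector_mul_assoc minus_minus)
    then have "k \<in> (ker B)\<^sup>\<bottom>" unfolding orthogonal_comp_ker by (metis rangeI)
    then have "k = 0" using k ker_inter_orthogonal by blast
    then show ?thesis using k by simp
  qed
  obtain u k where uk: "u \<in> (ker B)\<^sup>\<bottom>" "k \<in> ker B" "transpose D *v x = u + k" by (rule ker_decomp)
  then obtain q where q: "u = transpose B *v q" unfolding orthogonal_comp_ker by blast
  have "x = (A ** transpose D - B ** transpose C) *v x"
    using symplectic_blocks'(1)[OF S] by simp
  also have "\<dots> = A *v (u + k) - B *v (transpose C *v x)"
    unfolding uk(3)[symmetric] by (simp add: matrix_vector_mult_diff_rdistrib matrix_vector_mul_assoc)
  also have "\<dots> = B *v (transpose A *v q - transpose C *v x) + A *v k"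
    using symplectic_blocks'(2)[OF S]
    by (simp add: q matrix_vector_right_distrib matrix_vector_mult_diff_distrib matrix_vector_mul_assoc)
  finally show "\<exists>u\<in>range ((*v) B). \<exists>w\<in>(*v) A ` ker B. x = u + w"
    using uk(2) by blast
qed

text \<open>The last two facts say how translations act: one along the complement of the kernel
  shifts \<open>Y\<close> by the same vector, and one by \<open>B *v w\<close> shifts
  \<open>L\<close> by \<open>w\<close> up to an element of \<open>ker B\<close>. Testing against
  vectors orthogonal to \<open>ker B\<close> makes that element invisible.\<close>

lemma symplectic_projections:
  fixes A B C D :: "real^'n^'n"
  assumes S: "symplectic (block_mat A B C D)"
  defines "Y \<equiv> proj_along ((ker B)\<^sup>\<bottom>) ((*v) (transpose D ** A) ` ker B)"
    and "L \<equiv> \<lambda>\<xi>. moore_penrose B *v proj_along (range ((*v) B)) ((*v) A ` ker B) \<xi>"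
  shows "linear Y" "linear L" "Y x \<in> (ker B)\<^sup>\<bottom>" "L \<xi> \<in> (ker B)\<^sup>\<bottom>"
    "v \<in> (ker B)\<^sup>\<bottom> \<Longrightarrow> Y v = v" "w - L (B *v w) \<in> ker B"
proof -
  have im: "subspace ((*v) M ` ker B)" for M :: "real^'n^'n"
    by (rule linear_subspace_image[OF matrix_vector_mul_linear subspace_ker])
  have ra: "subspace (range ((*v) B))"
    by (rule linear_subspace_image[OF matrix_vector_mul_linear subspace_UNIV])
  note p = proj_along_props[OF subspace_orthogonal_comp im symplectic_decomp_position[OF S]]
  note f = proj_along_props[OF ra im symplectic_decomp_frequency[OF S]]
  show "linear Y" unfolding Y_def by (rule p(3))
  show "linear L" unfolding L_def
    by (rule linear_compose[OF f(3) matrix_vector_mul_linear, unfolded o_def])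
  show "Y x \<in> (ker B)\<^sup>\<bottom>" unfolding Y_def by (rule p(1))
  show "L \<xi> \<in> (ker B)\<^sup>\<bottom>" unfolding L_def by (rule moore_penrose_in)
  show "v \<in> (ker B)\<^sup>\<bottom> \<Longrightarrow> Y v = v"
    unfolding Y_def by (rule p(2)) (auto simp: image_iff intro!: bexI[of _ 0] subspace_0 subspace_ker)
  have "proj_along (range ((*v) B)) ((*v) A ` ker B) (B *v w) = B *v w"
    by (rule f(2)) (auto simp: image_iff intro!: bexI[of _ 0] subspace_0 subspace_ker)
  then show "w - L (B *v w) \<in> ker B" unfolding L_def by (simp add: moore_penrose_left)
qed

section \<open>Weyl operators and their intertwining\<close>

text \<open>The operator \<open>rho\<close> at \<open>\<tau> = 0\<close>, acting on representatives
  instead of classes so that it can be estimated pointwise.\<close>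

definition weyl :: "real^'n \<Rightarrow> real^'n \<Rightarrow> (real^'n::finite \<Rightarrow> complex) \<Rightarrow> real^'n \<Rightarrow> complex" where
  "weyl x \<xi> f t = cis (- pi * (x \<bullet> \<xi>)) * cis (2 * pi * (\<xi> \<bullet> t)) * f (t - x)"

lemma norm_weyl: "cmod (weyl x \<xi> f t) = cmod (f (t - x))"
  by (simp add: weyl_def norm_mult)

lemma weyl_measurable:
  assumes [measurable]: "f \<in> borel_measurable borel"
  shows "weyl x \<xi> f \<in> borel_measurable borel"
proof -
  have [measurable]: "(\<lambda>t. cis (2 * pi * (\<xi> \<bullet> t))) \<in> borel_measurable borel"
    by (intro borel_measurable_continuous_onI continuous_intros)
  show ?thesis unfolding weyl_def[abs_def] by measurable
qed

lemma sq_integrable_weyl: "sq_integrable f \<Longrightarrow> sq_integrable (weyl x \<xi> f)"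
  using sq_integrable_translate[of f x] weyl_measurable[of f x \<xi>]
  by (simp add: sq_integrable_def norm_weyl)

lemma l2_rel_refl: "sq_integrable f \<Longrightarrow> l2_rel f f"
  by (simp add: l2_rel_def)

lemma rho_abs_L2: "sq_integrable f \<Longrightarrow> rho x \<xi> 0 (abs_L2 f) = abs_L2 (weyl x \<xi> f)"
  by (subst rho.abs_eq) (auto simp: l2_rel_refl weyl_def[abs_def])

lemma l2_inner_abs_L2:
  "sq_integrable f \<Longrightarrow> sq_integrable g \<Longrightarrow> l2_inner (abs_L2 f) (abs_L2 g) = (\<integral>x. f x * cnj (g x) \<partial>lborel)"
  by (subst l2_inner.abs_eq) (auto simp: l2_rel_refl)

lemma sq_integrable_rep_L2: "sq_integrable (rep_L2 F)"
  using Quotient3_rep_reflp[OF Quotient3_L2, of F] by (simp add: l2_rel_def)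

lemma abs_rep_L2: "abs_L2 (rep_L2 F) = F"
  by (rule Quotient3_abs_rep[OF Quotient3_L2])

text \<open>Injectivity lets \<open>inv_into UNIV T\<close> undo \<open>T\<close> in the
  intertwining relation, and unitarity then removes \<open>T\<close> from the inner product. Apart
  from equality of norms, this is all that is used of \<open>T\<close>.\<close>

lemma metaplectic_weyl_inner:
  assumes T: "metaplectic_over T S" "inj T"
    and sq: "sq_integrable f" "sq_integrable g" and Tf: "T (abs_L2 f) = abs_L2 g"
  shows "(\<integral>t. weyl (position (S *v z)) (momentum (S *v z)) g t * cnj (g t) \<partial>lborel)
    = (\<integral>t. weyl (position z) (momentum z) f t * cnj (f t) \<partial>lborel)"
proof -
  let ?\<rho> = "\<lambda>z. rho (position z) (momentum z) 0"
  have "(T \<circ> ?\<rho> z \<circ> inv_into UNIV T) (T (abs_L2 f)) = ?\<rho> (S *v z) (T (abs_L2 f))"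
    using T by (simp add: metaplectic_over_def)
  then have "?\<rho> (S *v z) (abs_L2 g) = T (?\<rho> z (abs_L2 f))"
    using T(2) by (simp add: Tf[symmetric])
  then have "l2_inner (?\<rho> (S *v z) (abs_L2 g)) (abs_L2 g) = l2_inner (T (?\<rho> z (abs_L2 f))) (T (abs_L2 f))"
    by (simp add: Tf)
  also have "\<dots> = l2_inner (?\<rho> z (abs_L2 f)) (abs_L2 f)"
    using T by (simp add: metaplectic_over_def unitary_op_def)
  finally show ?thesis
    using sq by (simp add: rho_abs_L2 l2_inner_abs_L2 sq_integrable_weyl)
qed

lemma metaplectic_group_inj:
  assumes "metaplectic_group G" "T \<in> G"
  shows "inj T"
proof -
  have "T \<in> carrier (BijGroup UNIV)"
    using assms subgroup.subset by (fastforce simp: metaplectic_group_def)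
  then show ?thesis by (auto simp: BijGroup_def Bij_def bij_betw_def)
qed

section \<open>Schwartz functions and second moments\<close>

text \<open>The coordinate of largest modulus controls the norm up to the factor
  \<open>CARD('n)\<close>, so the bounds for the constant monomial and for the pure powers of single
  coordinates suffice.\<close>

lemma schwartz_decay:
  fixes f :: "real^'n \<Rightarrow> complex"
  assumes "schwartz f"
  shows "\<exists>M\<ge>0. \<forall>x. cmod (iterated_partial is f x) \<le> M / (1 + norm x) ^ m"
proof -
  let ?g = "iterated_partial is f"
  have b: "\<exists>M. \<forall>x. \<bar>\<Prod>i\<in>UNIV. (x $ i) ^ \<alpha> i\<bar> * cmod (?g x) \<le> M" for \<alpha> :: "'n \<Rightarrow> nat"
  proof -
    obtain M where "\<forall>x. cmod (of_real (\<Prod>i\<in>UNIV. (x $ i) ^ \<alpha> i) * ?g x) \<le> M"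
      using assms unfolding schwartz_def by meson
    then show ?thesis by (auto simp: norm_mult simp del: of_real_prod of_real_power)
  qed
  obtain M0 where M0: "cmod (?g x) \<le> M0" for x
    using b[of "\<lambda>_. 0"] by auto
  have "\<exists>M. \<forall>x. \<bar>x $ i\<bar> ^ m * cmod (?g x) \<le> M" for i
    using b[of "\<lambda>j. if j = i then m else 0"]
    by (simp add: if_distrib[of "\<lambda>k. _ ^ k"] power_abs prod.delta cong: if_cong)
  then obtain Mi where Mi: "\<bar>x $ i\<bar> ^ m * cmod (?g x) \<le> Mi i" for x i
    by metis
  let ?n = "real CARD('n)"
  define M where "M = 2 ^ m * (M0 + ?n ^ m * (\<Sum>i\<in>UNIV. Mi i))"
  have main: "(1 + norm x) ^ m * cmod (?g x) \<le> M" for x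
  proof -
    define i where "i = (ARG_MAX (\<lambda>j. \<bar>x $ j\<bar>) j. True)"
    have i: "\<bar>x $ j\<bar> \<le> \<bar>x $ i\<bar>" for j
    proof -
      have "finite (range (\<lambda>j. \<bar>x $ j\<bar>))" by simp
      then have "\<exists>i. \<forall>j. \<bar>x $ j\<bar> \<le> \<bar>x $ i\<bar>"
        using Max_in[of "range (\<lambda>j. \<bar>x $ j\<bar>)"] Max_ge[of "range (\<lambda>j. \<bar>x $ j\<bar>)"] by fastforce
      then obtain i0 where "\<And>j. \<bar>x $ j\<bar> \<le> \<bar>x $ i0\<bar>" by blast
      then show ?thesis
        unfolding i_def arg_max_def is_arg_max_def
        by (rule_tac someI2[of _ i0]) (auto simp: not_less)
    qed
    have "norm x \<le> (\<Sum>j\<in>UNIV. \<bar>x $ j\<bar>)" by (rule norm_le_l1_cart)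
    also have "\<dots> \<le> (\<Sum>j\<in>(UNIV::'n set). \<bar>x $ i\<bar>)" by (intro sum_mono i)
    finally have nx: "norm x \<le> ?n * \<bar>x $ i\<bar>" by simp
    have "(1 + norm x) ^ m \<le> (2 * max 1 (norm x)) ^ m"
      by (intro power_mono) auto
    also have "\<dots> \<le> 2 ^ m * (1 + norm x ^ m)"
      by (simp add: power_mult_distrib max_def)
    also have "\<dots> \<le> 2 ^ m * (1 + (?n * \<bar>x $ i\<bar>) ^ m)"
      using nx by (intro mult_left_mono add_mono power_mono) auto
    finally have "(1 + norm x) ^ m * cmod (?g x) \<le> 2 ^ m * (1 + (?n * \<bar>x $ i\<bar>) ^ m) * cmod (?g x)"
      by (rule mult_right_mono) auto
    also have "\<dots> = 2 ^ m * (cmod (?g x) + ?n ^ m * (\<bar>x $ i\<bar> ^ m * cmod (?g x)))"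
      by (simp add: power_mult_distrib algebra_simps)
    also have "\<dots> \<le> M"
    proof -
      have "0 \<le> Mi j" for j using Mi[of 0 j] by (smt (verit) mult_nonneg_nonneg norm_ge_zero zero_le_power)
      then have "Mi i \<le> (\<Sum>i\<in>UNIV. Mi i)" by (intro member_le_sum) auto
      then have "\<bar>x $ i\<bar> ^ m * cmod (?g x) \<le> (\<Sum>i\<in>UNIV. Mi i)" using Mi[of x i] by linarith
      then show ?thesis unfolding M_def by (intro mult_left_mono add_mono M0) auto
    qed
    finally show ?thesis .
  qed
  have "M \<ge> 0" using main[of 0] by (smt (verit) norm_ge_zero mult_nonneg_nonneg zero_le_power)
  moreover have "cmod (?g x) \<le> M / (1 + norm x) ^ m" for x
  proof -
    have "(1 + norm x) ^ m > 0" by (simp add: add_pos_nonneg)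
    then show ?thesis using main[of x] by (simp add: field_simps)
  qed
  ultimately show ?thesis by blast
qed

text \<open>The power is at least the product of \<open>1 + (x \<bullet> b)\<^sup>2\<close> over the
  basis, so the integral is dominated by a product of integrals of
  \<open>1 / (1 + x\<^sup>2)\<close> over the line.\<close>

lemma integrable_inverse_1_plus_norm:
  "integrable lborel (\<lambda>x::'a::euclidean_space. 1 / (1 + norm x) ^ (2 * DIM('a)))"
proof (rule integrableI_bounded)
  have one: "(\<integral>\<^sup>+x. ennreal (1 / (1 + x\<^sup>2)) \<partial>lborel) < \<infinity>"
  proof -
    have "integrable lborel (\<lambda>x::real. 1 / (1 + x\<^sup>2))"
      using integrable_inverse_1_plus_square
      by (simp add: set_integrable_def einterval_eq_UNIV inverse_eq_divide)
    then show ?thesis by (auto simp: integrable_iff_bounded)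
  qed
  have "(\<integral>\<^sup>+x. ennreal (norm (1 / (1 + norm (x::'a)) ^ (2 * DIM('a)))) \<partial>lborel)
      \<le> (\<integral>\<^sup>+x. (\<Prod>b\<in>Basis. ennreal (1 / (1 + ((x::'a) \<bullet> b)\<^sup>2))) \<partial>lborel)"
  proof (rule nn_integral_mono)
    fix x :: 'a
    have "(\<Prod>b\<in>Basis. (1 + (x \<bullet> b)\<^sup>2)) \<le> (\<Prod>b\<in>(Basis::'a set). (1 + norm x)\<^sup>2)"
    proof (intro prod_mono conjI)
      fix b :: 'a assume "b \<in> Basis"
      then have "(x \<bullet> b)\<^sup>2 \<le> (norm x)\<^sup>2" using Basis_le_norm[of b x] by (simp add: abs_le_square_iff[symmetric])
      then show "1 + (x \<bullet> b)\<^sup>2 \<le> (1 + norm x)\<^sup>2" by (simp add: power2_eq_square algebra_simps add_increasing2)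
    qed (simp add: add_nonneg_nonneg)
    also have "\<dots> = (1 + norm x) ^ (2 * DIM('a))" by (simp add: power_mult)
    finally have le: "(\<Prod>b\<in>Basis. (1 + (x \<bullet> b)\<^sup>2)) \<le> (1 + norm x) ^ (2 * DIM('a))" .
    have "(\<Prod>b\<in>Basis. (1 + (x \<bullet> b)\<^sup>2)) > 0" by (intro prod_pos) (auto simp: add_pos_nonneg)
    then have "1 / (1 + norm x) ^ (2 * DIM('a)) \<le> 1 / (\<Prod>b\<in>Basis. (1 + (x \<bullet> b)\<^sup>2))"
      using le by (intro divide_left_mono) (auto simp: add_pos_nonneg)
    also have "\<dots> = (\<Prod>b\<in>Basis. 1 / (1 + (x \<bullet> b)\<^sup>2))" by (simp add: prod_dividef)
    finally have "ennreal (1 / (1 + norm x) ^ (2 * DIM('a))) \<le> ennreal (\<Prod>b\<in>Basis. 1 / (1 + (x \<bullet> b)\<^sup>2))"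
      by (rule ennreal_leI)
    then show "ennreal (norm (1 / (1 + norm x) ^ (2 * DIM('a)))) \<le> (\<Prod>b\<in>Basis. ennreal (1 / (1 + (x \<bullet> b)\<^sup>2)))"
      by (simp add: prod_ennreal)
  qed
  also have "\<dots> = (\<Prod>b\<in>(Basis::'a set). (\<integral>\<^sup>+x. ennreal (1 / (1 + x\<^sup>2)) \<partial>lborel))"
    by (rule nn_integral_lborel_prod) auto
  also have "\<dots> < \<infinity>"
    using one by (simp add: power_less_top_ennreal)
  finally show "(\<integral>\<^sup>+x. ennreal (norm (1 / (1 + norm (x::'a)) ^ (2 * DIM('a)))) \<partial>lborel) < \<infinity>" .
qed measurable

lemma schwartz_differentiable: "schwartz f \<Longrightarrow> f differentiable (at x)"
  unfolding schwartz_def by (metis iterated_partial.simps(1))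

lemma schwartz_measurable: "schwartz f \<Longrightarrow> f \<in> borel_measurable borel"
  by (intro borel_measurable_continuous_onI continuous_at_imp_continuous_on)
     (simp add: schwartz_differentiable differentiable_imp_continuous_within)

lemma schwartz_integrable_moments:
  fixes f :: "real^'n \<Rightarrow> complex"
  assumes f: "schwartz f"
  shows "integrable lborel (\<lambda>x. (cmod (f x))\<^sup>2)" "integrable lborel (\<lambda>x. (norm x)\<^sup>2 * (cmod (f x))\<^sup>2)"
proof -
  let ?d = "DIM(real^'n)"
  have [measurable]: "f \<in> borel_measurable borel" by (rule schwartz_measurable[OF f])
  \<comment> \<open>After squaring, the extra power pays for the factor
    \<open>(1 + norm x)\<^sup>2\<close>, and exponent \<open>2 * ?d\<close> remains for
    integrability.\<close>
  obtain M where M: "M \<ge> 0" "\<And>x. cmod (f x) \<le> M / (1 + norm x) ^ (?d + 1)"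
    using schwartz_decay[OF f, of "[]" "?d + 1"] by auto
  have le: "(1 + norm x)\<^sup>2 * (cmod (f x))\<^sup>2 \<le> M\<^sup>2 * (1 / (1 + norm x) ^ (2 * ?d))" for x
  proof -
    have p: "1 + norm x > 0" by (simp add: add_pos_nonneg)
    have "(cmod (f x))\<^sup>2 \<le> (M / (1 + norm x) ^ (?d + 1))\<^sup>2" using M by (intro power_mono) auto
    then have "(1 + norm x)\<^sup>2 * (cmod (f x))\<^sup>2 \<le> (1 + norm x)\<^sup>2 * (M / (1 + norm x) ^ (?d + 1))\<^sup>2"
      by (intro mult_left_mono) auto
    also have "\<dots> = M\<^sup>2 * (1 / (1 + norm x) ^ (2 * ?d))"
    proof -
      have "(1 + norm x) * (M / (1 + norm x) ^ (?d + 1)) = M / (1 + norm x) ^ ?d" using p by simp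
      then have "(1 + norm x)\<^sup>2 * (M / (1 + norm x) ^ (?d + 1))\<^sup>2 = (M / (1 + norm x) ^ ?d)\<^sup>2"
        by (metis power_mult_distrib)
      then show ?thesis by (simp add: power_divide power_mult mult.commute flip: power_mult)
    qed
    finally show ?thesis .
  qed
  have int: "integrable lborel (\<lambda>x::real^'n. M\<^sup>2 * (1 / (1 + norm x) ^ (2 * ?d)))"
    by (intro integrable_mult_right integrable_inverse_1_plus_norm)
  have w1: "1 \<le> (1 + norm x)\<^sup>2" "(norm x)\<^sup>2 \<le> (1 + norm x)\<^sup>2" for x :: "real^'n"
    by (auto simp: power_mono)
  show "integrable lborel (\<lambda>x. (cmod (f x))\<^sup>2)"
  proof (rule Bochner_Integration.integrable_bound[OF int])
    show "AE x in lborel. norm ((cmod (f x))\<^sup>2) \<le> norm (M\<^sup>2 * (1 / (1 + norm x) ^ (2 * ?d)))"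
    proof (rule AE_I2)
      fix x
      have "1 * (cmod (f x))\<^sup>2 \<le> (1 + norm x)\<^sup>2 * (cmod (f x))\<^sup>2" by (intro mult_right_mono w1) simp
      also note le
      finally show "norm ((cmod (f x))\<^sup>2) \<le> norm (M\<^sup>2 * (1 / (1 + norm x) ^ (2 * ?d)))" by simp
    qed
  qed measurable
  show "integrable lborel (\<lambda>x. (norm x)\<^sup>2 * (cmod (f x))\<^sup>2)"
  proof (rule Bochner_Integration.integrable_bound[OF int])
    show "AE x in lborel. norm ((norm x)\<^sup>2 * (cmod (f x))\<^sup>2) \<le> norm (M\<^sup>2 * (1 / (1 + norm x) ^ (2 * ?d)))"
    proof (rule AE_I2)
      fix x
      have "(norm x)\<^sup>2 * (cmod (f x))\<^sup>2 \<le> (1 + norm x)\<^sup>2 * (cmod (f x))\<^sup>2" by (intro mult_right_mono w1) simp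
      also note le
      finally show "norm ((norm x)\<^sup>2 * (cmod (f x))\<^sup>2) \<le> norm (M\<^sup>2 * (1 / (1 + norm x) ^ (2 * ?d)))" by simp
    qed
  qed measurable
qed

section \<open>Small Weyl displacements and second moments\<close>

lemma schwartz_lipschitz:
  fixes f :: "real^'n \<Rightarrow> complex"
  assumes f: "schwartz f"
  shows "\<exists>C\<ge>0. \<forall>s y. norm y \<le> r \<longrightarrow> cmod (f (s - y) - f s) \<le> C * norm y / (1 + norm s) ^ m"
proof (cases "r \<ge> 0")
  case True
  have "\<exists>M\<ge>0. \<forall>x. cmod (partial_deriv i f x) \<le> M / (1 + norm x) ^ m" for i
    using schwartz_decay[OF f, of "[i]" m] by simp
  then obtain M where M: "\<And>i. M i \<ge> 0" "\<And>i x. cmod (partial_deriv i f x) \<le> M i / (1 + norm x) ^ m"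
    by metis
  \<comment> \<open>On the segment from \<open>s\<close> to \<open>s - y\<close> one has
    \<open>1 + norm s \<le> (1 + norm x) * (1 + r)\<close>, so decay at the intermediate point
    \<open>x\<close> becomes decay at \<open>s\<close> at the cost of
    \<open>(1 + r) ^ m\<close>.\<close>
  define C where "C = (\<Sum>i\<in>UNIV. M i) * (1 + r) ^ m"
  have C0: "C \<ge> 0" using M True by (auto simp: C_def intro!: mult_nonneg_nonneg sum_nonneg)
  have "cmod (f (s - y) - f s) \<le> C / (1 + norm s) ^ m * norm ((s - y) - s)" if y: "norm y \<le> r" for s y
  proof (rule differentiable_bound[of "closed_segment s (s - y)" f "\<lambda>x. frechet_derivative f (at x)"])
    fix x assume x: "x \<in> closed_segment s (s - y)"
    have D: "(f has_derivative frechet_derivative f (at x)) (at x)"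
      using schwartz_differentiable[OF f] by (simp add: frechet_derivative_works)
    then show "(f has_derivative frechet_derivative f (at x)) (at x within closed_segment s (s - y))"
      by (rule has_derivative_at_withinI)
    have lin: "linear (frechet_derivative f (at x))" using D by (rule has_derivative_linear)
    have "norm (x - s) \<le> norm y"
      using segment_bound(1)[OF x] by simp
    then have "norm s \<le> norm x + r" using y norm_triangle_sub[of s x] by (simp add: norm_minus_commute)
    then have s: "1 + norm s \<le> (1 + norm x) * (1 + r)"
    proof -
      have "(1 + norm x) * (1 + r) = 1 + norm x + r + norm x * r" by (simp add: algebra_simps)
      moreover have "0 \<le> norm x * r" using True by simp
      ultimately show ?thesis using \<open>norm s \<le> norm x + r\<close> by linarith
    qed
    have Mx: "M i / (1 + norm x) ^ m \<le> M i * (1 + r) ^ m / (1 + norm s) ^ m" for i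
    proof -
      have px: "(1 + norm x) ^ m > 0" "(1 + norm s) ^ m > 0" by (simp_all add: add_pos_nonneg)
      have "(1 + norm s) ^ m \<le> (1 + norm x) ^ m * (1 + r) ^ m"
        using s by (simp add: power_mult_distrib[symmetric] power_mono)
      then have "M i * (1 + norm s) ^ m \<le> M i * ((1 + norm x) ^ m * (1 + r) ^ m)"
        by (rule mult_left_mono[OF _ M(1)])
      then show ?thesis using px by (simp add: field_simps)
    qed
    show "onorm (frechet_derivative f (at x)) \<le> C / (1 + norm s) ^ m"
    proof (rule onorm_le)
      fix h :: "real^'n"
      have "frechet_derivative f (at x) h = frechet_derivative f (at x) (\<Sum>i\<in>UNIV. (h $ i) *\<^sub>R axis i 1)"
        using basis_expansion[of h] by (simp add: scalar_mult_eq_scaleR)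
      also have "\<dots> = (\<Sum>i\<in>UNIV. (h $ i) *\<^sub>R partial_deriv i f x)"
        by (simp add: linear_sum[OF lin] linear_cmul[OF lin] partial_deriv_def)
      also have "cmod \<dots> \<le> (\<Sum>i\<in>UNIV. \<bar>h $ i\<bar> * cmod (partial_deriv i f x))"
        by (rule order_trans[OF norm_sum]) simp
      also have "\<dots> \<le> (\<Sum>i\<in>UNIV. norm h * (M i * (1 + r) ^ m / (1 + norm s) ^ m))"
        by (intro sum_mono mult_mono component_le_norm_cart order_trans[OF M(2) Mx]) auto
      also have "\<dots> = C / (1 + norm s) ^ m * norm h"
        by (simp add: C_def sum_distrib_left sum_distrib_right sum_divide_distrib mult_ac)
      finally show "cmod (frechet_derivative f (at x) h) \<le> C / (1 + norm s) ^ m * norm h" .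
    qed
  qed auto
  then show ?thesis using C0 by (intro exI[of _ C]) auto
next
  case False
  then show ?thesis by (intro exI[of _ 0]) (auto, meson norm_ge_zero order_trans)
qed

lemma norm_cis_minus_one: "cmod (cis a - 1) \<le> \<bar>a\<bar>"
  using iexp_approx1[of a 0] by (simp add: cis_conv_exp)

text \<open>Along \<open>t = 1 / (n + 1)\<close> the quotient of \<open>2 - 2 * cos (t * u)\<close>
  by \<open>t\<^sup>2\<close> tends to \<open>u\<^sup>2\<close>, so Fatou's lemma turns quadratic
  behaviour at the origin into a finite second moment.\<close>

lemma nn_integral_square_le:
  fixes u R :: "'a \<Rightarrow> real"
  assumes [measurable]: "u \<in> borel_measurable M" and R: "\<And>x. R x \<ge> 0" "integrable M R"
    and le: "\<And>t. 0 < t \<Longrightarrow> t \<le> 1 \<Longrightarrow> (\<integral>x. (2 - 2 * cos (t * u x)) * R x \<partial>M) \<le> C * t\<^sup>2"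
  shows "(\<integral>\<^sup>+x. ennreal ((u x)\<^sup>2 * R x) \<partial>M) \<le> ennreal C"
proof -
  have [measurable]: "R \<in> borel_measurable M" using R by auto
  let ?k = "\<lambda>n. real (Suc n)"
  have lim: "(\<lambda>n. ennreal ((?k n)\<^sup>2 * ((2 - 2 * cos (1 / ?k n * u x)) * R x))) \<longlonglongrightarrow> ennreal ((u x)\<^sup>2 * R x)" for x
  proof -
    have "(\<lambda>n. (?k n)\<^sup>2 * (2 - 2 * cos (1 / ?k n * u x))) \<longlonglongrightarrow> u x * u x"
      by real_asymp
    then have "(\<lambda>n. (?k n)\<^sup>2 * (2 - 2 * cos (1 / ?k n * u x)) * R x) \<longlonglongrightarrow> (u x)\<^sup>2 * R x"
      unfolding power2_eq_square[of "u x"] by (rule tendsto_mult[OF _ tendsto_const])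
    then show ?thesis by (intro tendsto_ennrealI) (simp add: mult.assoc)
  qed
  have "(\<integral>\<^sup>+x. ennreal ((u x)\<^sup>2 * R x) \<partial>M) = (\<integral>\<^sup>+x. liminf (\<lambda>n. ennreal ((?k n)\<^sup>2 * ((2 - 2 * cos (1 / ?k n * u x)) * R x))) \<partial>M)"
    by (intro nn_integral_cong lim_imp_Liminf[symmetric] lim) simp
  also have "\<dots> \<le> liminf (\<lambda>n. \<integral>\<^sup>+x. ennreal ((?k n)\<^sup>2 * ((2 - 2 * cos (1 / ?k n * u x)) * R x)) \<partial>M)"
    by (intro nn_integral_liminf) measurable
  also have "\<dots> \<le> ennreal C"
  proof -
    have "\<forall>\<^sub>F n in sequentially. (\<integral>\<^sup>+x. ennreal ((?k n)\<^sup>2 * ((2 - 2 * cos (1 / ?k n * u x)) * R x)) \<partial>M) \<le> ennreal C"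
    proof (intro always_eventually allI)
      fix n
      let ?h = "\<lambda>x. (2 - 2 * cos (1 / ?k n * u x)) * R x"
      have nn: "0 \<le> ?h x" for x using R by simp
      have i: "integrable M ?h"
      proof (rule Bochner_Integration.integrable_bound)
        show "integrable M (\<lambda>x. 4 * R x)" using R by simp
        show "AE x in M. norm (?h x) \<le> norm (4 * R x)"
        proof (rule AE_I2)
          fix x
          have "2 - 2 * cos (1 / ?k n * u x) \<le> 4" using cos_ge_minus_one[of "1 / ?k n * u x"] by linarith
          then have "?h x \<le> 4 * R x" using R by (intro mult_right_mono) auto
          then show "norm (?h x) \<le> norm (4 * R x)" using nn[of x] R(1)[of x] by simp
        qed
      qed measurable
      have "(?k n)\<^sup>2 * (\<integral>x. ?h x \<partial>M) \<le> (?k n)\<^sup>2 * (C * (1 / ?k n)\<^sup>2)"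
        by (intro mult_left_mono le) auto
      also have "\<dots> = C" by (simp add: power_divide)
      finally have "(\<integral>x. (?k n)\<^sup>2 * ?h x \<partial>M) \<le> C" by simp
      moreover have "(\<integral>\<^sup>+x. ennreal ((?k n)\<^sup>2 * ?h x) \<partial>M) = ennreal (\<integral>x. (?k n)\<^sup>2 * ?h x \<partial>M)"
        using i nn by (intro nn_integral_eq_integral integrable_mult_right) (auto intro!: AE_I2 mult_nonneg_nonneg)
      ultimately show "(\<integral>\<^sup>+x. ennreal ((?k n)\<^sup>2 * ?h x) \<partial>M) \<le> ennreal C" by (simp add: ennreal_leI)
    qed
    from Liminf_mono[OF this] show ?thesis by (simp add: Liminf_const)
  qed
  finally show ?thesis .
qed

lemma sq_integrable_measurable: "sq_integrable f \<Longrightarrow> f \<in> borel_measurable borel"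
  by (simp add: sq_integrable_def)

lemma integrable_mult_cnj:
  assumes "sq_integrable f" "sq_integrable g"
  shows "integrable lborel (\<lambda>x. f x * cnj (g x))"
proof (rule Bochner_Integration.integrable_bound)
  show "integrable lborel (\<lambda>x. (cmod (f x))\<^sup>2 + (cmod (g x))\<^sup>2)"
    using assms by (simp add: sq_integrable_def)
  show "(\<lambda>x. f x * cnj (g x)) \<in> borel_measurable lborel"
    using borel_measurable_mult_cnj[of f g] assms by (simp add: sq_integrable_def)
  show "AE x in lborel. norm (f x * cnj (g x)) \<le> norm ((cmod (f x))\<^sup>2 + (cmod (g x))\<^sup>2)"
  proof (rule AE_I2)
    fix x
    have "2 * (cmod (f x) * cmod (g x)) \<le> (cmod (f x))\<^sup>2 + (cmod (g x))\<^sup>2"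
      using sum_squares_bound[of "cmod (f x)" "cmod (g x)"] by simp
    then have "cmod (f x) * cmod (g x) \<le> (cmod (f x))\<^sup>2 + (cmod (g x))\<^sup>2"
      using mult_nonneg_nonneg[OF norm_ge_zero[of "f x"] norm_ge_zero[of "g x"]] by linarith
    then show "norm (f x * cnj (g x)) \<le> norm ((cmod (f x))\<^sup>2 + (cmod (g x))\<^sup>2)"
      by (simp add: norm_mult)
  qed
qed

lemma weyl_inner_le:
  assumes "sq_integrable f"
  shows "ennreal (cmod (\<integral>t. weyl x \<xi> f t * cnj (f t) \<partial>lborel))
    \<le> (\<integral>\<^sup>+t. ennreal (cmod (f (t - x)) * cmod (f t)) \<partial>lborel)"
  using integral_norm_bound_ennreal[OF integrable_mult_cnj[OF sq_integrable_weyl[OF assms] assms]]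
  by (simp add: norm_mult norm_weyl)

text \<open>With zero position the Weyl operator is a pure modulation, and its matrix coefficient is
  a characteristic function of the density of \<open>f\<close>.\<close>

lemma weyl_modulation_inner:
  "(\<integral>t. weyl 0 \<xi> f t * cnj (f t) \<partial>lborel) = (\<integral>t. cis (2 * pi * (\<xi> \<bullet> t)) * of_real ((cmod (f t))\<^sup>2) \<partial>lborel)"
  by (intro Bochner_Integration.integral_cong refl)
     (simp only: weyl_def complex_norm_square inner_zero_left mult_zero_right cis_zero mult_1 diff_0_right mult.assoc)

lemma weyl_difference_norm:
  assumes f: "sq_integrable f"
  shows "(\<integral>t. (cmod (weyl x \<xi> f t - f t))\<^sup>2 \<partial>lborel)
    = 2 * (\<integral>t. (cmod (f t))\<^sup>2 \<partial>lborel) - 2 * Re (\<integral>t. weyl x \<xi> f t * cnj (f t) \<partial>lborel)"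
proof -
  have i: "integrable lborel (\<lambda>t. weyl x \<xi> f t * cnj (f t))"
    by (intro integrable_mult_cnj sq_integrable_weyl f)
  have n: "integrable lborel (\<lambda>t. (cmod (f t))\<^sup>2)" "integrable lborel (\<lambda>t. (cmod (weyl x \<xi> f t))\<^sup>2)"
    using f sq_integrable_weyl[OF f, of x \<xi>] by (auto simp: sq_integrable_def)
  have [measurable]: "f \<in> borel_measurable borel" using f by (rule sq_integrable_measurable)
  have "(\<integral>t. (cmod (weyl x \<xi> f t))\<^sup>2 \<partial>lborel) = (\<integral>t. (cmod (f (t - x)))\<^sup>2 \<partial>lborel)"
    by (simp add: norm_weyl)
  also have "\<dots> = (\<integral>t. (cmod (f (- x + t)))\<^sup>2 \<partial>lborel)" by simp
  also have "\<dots> = (\<integral>t. (cmod (f t))\<^sup>2 \<partial>lborel)"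
    by (subst (2) lborel_distr_plus[of "- x", symmetric], subst integral_distr) auto
  finally have eq: "(\<integral>t. (cmod (weyl x \<xi> f t))\<^sup>2 \<partial>lborel) = (\<integral>t. (cmod (f t))\<^sup>2 \<partial>lborel)" .
  have pt: "(cmod (a - b))\<^sup>2 = (cmod a)\<^sup>2 + (cmod b)\<^sup>2 - 2 * Re (a * cnj b)" for a b
    unfolding cmod_power2 by (simp add: power2_eq_square algebra_simps)
  have "(\<integral>t. (cmod (weyl x \<xi> f t - f t))\<^sup>2 \<partial>lborel)
     = (\<integral>t. (cmod (weyl x \<xi> f t))\<^sup>2 + (cmod (f t))\<^sup>2 - 2 * Re (weyl x \<xi> f t * cnj (f t)) \<partial>lborel)"
    by (simp only: pt)
  also have "\<dots> = (\<integral>t. (cmod (weyl x \<xi> f t))\<^sup>2 \<partial>lborel) + (\<integral>t. (cmod (f t))\<^sup>2 \<partial>lborel)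
      - 2 * (\<integral>t. Re (weyl x \<xi> f t * cnj (f t)) \<partial>lborel)"
    using n integrable_Re[OF i] by (simp del: times_complex.sel)
  also have "(\<integral>t. Re (weyl x \<xi> f t * cnj (f t)) \<partial>lborel) = Re (\<integral>t. weyl x \<xi> f t * cnj (f t) \<partial>lborel)"
    by (rule integral_Re[OF i])
  finally show ?thesis unfolding eq by simp
qed

text \<open>The displacement is a translation, covered by the Lipschitz bound, followed by a phase
  \<open>\<theta>\<close> with \<open>cmod (cis \<theta> - 1) \<le> \<bar>\<theta>\<bar>\<close>. As
  \<open>\<theta>\<close> grows linearly in \<open>s\<close>, \<open>f\<close> itself must decay one
  power faster than its increments.\<close>

lemma schwartz_weyl_difference:
  fixes f :: "real^'n \<Rightarrow> complex"
  assumes f: "schwartz f"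
  shows "\<exists>C. \<forall>t. 0 < t \<and> t \<le> 1 \<longrightarrow> (\<integral>s. (cmod (weyl (t *\<^sub>R x) (t *\<^sub>R \<xi>) f s - f s))\<^sup>2 \<partial>lborel) \<le> C * t\<^sup>2"
proof -
  let ?d = "DIM(real^'n)"
  have [measurable]: "f \<in> borel_measurable borel" by (rule schwartz_measurable[OF f])
  obtain M where M: "M \<ge> 0" "\<And>s. cmod (f s) \<le> M / (1 + norm s) ^ (?d + 1)"
    using schwartz_decay[OF f, of "[]" "?d + 1"] by auto
  obtain C where C: "C \<ge> 0" "\<And>s y. norm y \<le> norm x \<Longrightarrow> cmod (f (s - y) - f s) \<le> C * norm y / (1 + norm s) ^ ?d"
    using schwartz_lipschitz[OF f, of "norm x" ?d] by auto
  define K where "K = C * norm x + pi * norm \<xi> * (norm x + 2) * M"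
  have K0: "K \<ge> 0" using C M by (simp add: K_def)
  have pt: "cmod (weyl (t *\<^sub>R x) (t *\<^sub>R \<xi>) f s - f s) \<le> t * K * (1 / (1 + norm s) ^ ?d)" if t: "0 < t" "t \<le> 1" for t s
  proof -
    define \<theta> where "\<theta> = - pi * ((t *\<^sub>R x) \<bullet> (t *\<^sub>R \<xi>)) + 2 * pi * ((t *\<^sub>R \<xi>) \<bullet> s)"
    let ?a = "f (s - t *\<^sub>R x)"
    have p: "1 + norm s > 0" by (simp add: add_pos_nonneg)
    have "weyl (t *\<^sub>R x) (t *\<^sub>R \<xi>) f s = cis \<theta> * ?a"
      by (simp only: weyl_def \<theta>_def cis_mult)
    then have "weyl (t *\<^sub>R x) (t *\<^sub>R \<xi>) f s - f s = cis \<theta> * (?a - f s) + (cis \<theta> - 1) * f s"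
      by (simp add: algebra_simps)
    then have "cmod (weyl (t *\<^sub>R x) (t *\<^sub>R \<xi>) f s - f s) \<le> cmod (?a - f s) + cmod (cis \<theta> - 1) * cmod (f s)"
      using norm_triangle_ineq[of "cis \<theta> * (?a - f s)" "(cis \<theta> - 1) * f s"] by (simp add: norm_mult)
    also have "cmod (?a - f s) \<le> t * (C * norm x) * (1 / (1 + norm s) ^ ?d)"
      using C(2)[of "t *\<^sub>R x" s] t by (simp add: mult_left_le_one_le mult_ac)
    also have "cmod (cis \<theta> - 1) * cmod (f s) \<le> (t * (pi * norm \<xi> * (norm x + 2)) * (1 + norm s)) * (M / (1 + norm s) ^ (?d + 1))"
    proof (intro mult_mono M norm_ge_zero)
      have tt: "t * t \<le> t" using t by (simp add: mult_left_le_one_le)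
      have "\<bar>\<theta>\<bar> \<le> pi * \<bar>(t *\<^sub>R x) \<bullet> (t *\<^sub>R \<xi>)\<bar> + 2 * pi * \<bar>(t *\<^sub>R \<xi>) \<bullet> s\<bar>"
        unfolding \<theta>_def by (rule order_trans[OF abs_triangle_ineq]) (simp add: abs_mult)
      also have "\<dots> \<le> pi * (norm (t *\<^sub>R x) * norm (t *\<^sub>R \<xi>)) + 2 * pi * (norm (t *\<^sub>R \<xi>) * norm s)"
        by (intro add_mono mult_left_mono Cauchy_Schwarz_ineq2) auto
      also have "\<dots> = (t * t) * (pi * norm x * norm \<xi>) + t * (2 * pi * norm \<xi> * norm s)"
        using t by simp
      also have "\<dots> \<le> t * (pi * norm x * norm \<xi>) + t * (2 * pi * norm \<xi> * norm s)"
        by (intro add_right_mono mult_right_mono tt) auto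
      also have "\<dots> \<le> t * (pi * norm \<xi> * (norm x + 2)) * (1 + norm s)"
      proof -
        have "t * (pi * norm \<xi> * (norm x + 2)) * (1 + norm s)
          = (t * (pi * norm x * norm \<xi>) + t * (2 * pi * norm \<xi> * norm s))
            + (t * (pi * norm \<xi> * norm x * norm s) + t * (pi * norm \<xi> * 2))"
          by (simp add: algebra_simps)
        moreover have "0 \<le> t * (pi * norm \<xi> * norm x * norm s) + t * (pi * norm \<xi> * 2)"
          using t by (intro add_nonneg_nonneg mult_nonneg_nonneg) auto
        ultimately show ?thesis by linarith
      qed
      finally show "cmod (cis \<theta> - 1) \<le> t * (pi * norm \<xi> * (norm x + 2)) * (1 + norm s)"
        using norm_cis_minus_one[of \<theta>] by linarith
    qed (use t p in auto)
    also have "(t * (pi * norm \<xi> * (norm x + 2)) * (1 + norm s)) * (M / (1 + norm s) ^ (?d + 1))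
      = t * (pi * norm \<xi> * (norm x + 2) * M) * (1 / (1 + norm s) ^ ?d)"
      using p by simp
    finally show ?thesis by (simp add: K_def algebra_simps)
  qed
  have int: "integrable lborel (\<lambda>s::real^'n. 1 / (1 + norm s) ^ (2 * ?d))"
    by (rule integrable_inverse_1_plus_norm)
  have "(\<integral>s. (cmod (weyl (t *\<^sub>R x) (t *\<^sub>R \<xi>) f s - f s))\<^sup>2 \<partial>lborel)
     \<le> (K\<^sup>2 * (\<integral>s. 1 / (1 + norm (s::real^'n)) ^ (2 * ?d) \<partial>lborel)) * t\<^sup>2" if t: "0 < t" "t \<le> 1" for t
  proof -
    have le: "(cmod (weyl (t *\<^sub>R x) (t *\<^sub>R \<xi>) f s - f s))\<^sup>2 \<le> (t\<^sup>2 * K\<^sup>2) * (1 / (1 + norm s) ^ (2 * ?d))" for s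
    proof -
      have "(cmod (weyl (t *\<^sub>R x) (t *\<^sub>R \<xi>) f s - f s))\<^sup>2 \<le> (t * K * (1 / (1 + norm s) ^ ?d))\<^sup>2"
        by (intro power_mono pt t) auto
      also have "\<dots> = (t\<^sup>2 * K\<^sup>2) * (1 / (1 + norm s) ^ (2 * ?d))"
        by (simp add: power_mult_distrib power_divide mult.commute flip: power_mult)
      finally show ?thesis .
    qed
    have int2: "integrable lborel (\<lambda>s::real^'n. (t\<^sup>2 * K\<^sup>2) * (1 / (1 + norm s) ^ (2 * ?d)))"
      by (intro integrable_mult_right int)
    have [measurable]: "weyl (t *\<^sub>R x) (t *\<^sub>R \<xi>) f \<in> borel_measurable borel" by (rule weyl_measurable) simp
    have "(\<integral>s. (cmod (weyl (t *\<^sub>R x) (t *\<^sub>R \<xi>) f s - f s))\<^sup>2 \<partial>lborel)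
       \<le> (\<integral>s. (t\<^sup>2 * K\<^sup>2) * (1 / (1 + norm (s::real^'n)) ^ (2 * ?d)) \<partial>lborel)"
    proof (rule integral_mono[OF _ int2])
      show "integrable lborel (\<lambda>s. (cmod (weyl (t *\<^sub>R x) (t *\<^sub>R \<xi>) f s - f s))\<^sup>2)"
        by (rule Bochner_Integration.integrable_bound[OF int2]) (use le in \<open>auto intro!: order_trans[OF le] AE_I2\<close>)
    qed (rule le)
    also have "\<dots> = (t\<^sup>2 * K\<^sup>2) * (\<integral>s. 1 / (1 + norm (s::real^'n)) ^ (2 * ?d) \<partial>lborel)"
      by (rule integral_mult_right_zero)
    finally show ?thesis by (simp only: mult_ac)
  qed
  then show ?thesis by blast
qed

lemma position_scaleR: "position (t *\<^sub>R z) = t *\<^sub>R position z"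
  and momentum_scaleR: "momentum (t *\<^sub>R z) = t *\<^sub>R momentum z"
  by (simp_all add: position_def momentum_def vec_eq_iff)

lemma metaplectic_norm:
  assumes T: "metaplectic_over T S" "inj T"
    and sq: "sq_integrable f" "sq_integrable g" and Tf: "T (abs_L2 f) = abs_L2 g"
  shows "(\<integral>x. (cmod (g x))\<^sup>2 \<partial>lborel) = (\<integral>x. (cmod (f x))\<^sup>2 \<partial>lborel)"
proof -
  have "complex_of_real (\<integral>x. (cmod (h x))\<^sup>2 \<partial>lborel) = (\<integral>x. h x * cnj (h x) \<partial>lborel)" for h :: "real^'n \<Rightarrow> complex"
    by (subst integral_complex_of_real[symmetric]) (simp only: complex_norm_square)
  moreover have "(\<integral>x. g x * cnj (g x) \<partial>lborel) = (\<integral>x. f x * cnj (f x) \<partial>lborel)"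
    using T sq by (simp add: metaplectic_over_def unitary_op_def Tf[symmetric] flip: l2_inner_abs_L2)
  ultimately show ?thesis by (metis of_real_eq_iff)
qed

text \<open>Since \<open>S *v z\<close> has position 0, the displacement of \<open>f\<close> by
  \<open>t *\<^sub>R z\<close> corresponds to modulating \<open>g\<close> by
  \<open>t *\<^sub>R w\<close>. The estimate for Schwartz \<open>f\<close> thus becomes the
  hypothesis of \<open>nn_integral_square_le\<close> for \<open>g\<close>.\<close>

lemma metaplectic_second_moment:
  assumes T: "metaplectic_over T S" "inj T"
    and f: "schwartz f" and sq: "sq_integrable f" "sq_integrable g" and Tf: "T (abs_L2 f) = abs_L2 g"
    and z: "position (S *v z) = 0" "momentum (S *v z) = w"
  shows "integrable lborel (\<lambda>\<xi>. (w \<bullet> \<xi>)\<^sup>2 * (cmod (g \<xi>))\<^sup>2)"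
proof -
  have [measurable]: "g \<in> borel_measurable borel" using sq(2) by (rule sq_integrable_measurable)
  have R: "integrable lborel (\<lambda>\<xi>. (cmod (g \<xi>))\<^sup>2)" using sq by (simp add: sq_integrable_def)
  obtain C where C: "\<And>t. 0 < t \<Longrightarrow> t \<le> 1 \<Longrightarrow>
      (\<integral>s. (cmod (weyl (t *\<^sub>R position z) (t *\<^sub>R momentum z) f s - f s))\<^sup>2 \<partial>lborel) \<le> C * t\<^sup>2"
    using schwartz_weyl_difference[OF f] by blast
  have "(\<integral>\<^sup>+\<xi>. ennreal ((2 * pi * (w \<bullet> \<xi>))\<^sup>2 * (cmod (g \<xi>))\<^sup>2) \<partial>lborel) \<le> ennreal C"
  proof (rule nn_integral_square_le)
    fix t :: real assume t: "0 < t" "t \<le> 1"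
    let ?c = "\<lambda>\<xi>. cis (2 * pi * ((t *\<^sub>R w) \<bullet> \<xi>)) * complex_of_real ((cmod (g \<xi>))\<^sup>2)"
    have [measurable]: "(\<lambda>\<xi>. cis (2 * pi * ((t *\<^sub>R w) \<bullet> \<xi>))) \<in> borel_measurable borel"
      by (intro borel_measurable_continuous_onI continuous_intros)
    have ci: "integrable lborel ?c"
      by (rule Bochner_Integration.integrable_bound[OF R])
         (measurable, simp add: norm_mult del: of_real_power inner_scaleR_left)
    have "(\<integral>\<xi>. (2 - 2 * cos (t * (2 * pi * (w \<bullet> \<xi>)))) * (cmod (g \<xi>))\<^sup>2 \<partial>lborel)
      = (\<integral>\<xi>. 2 * (cmod (g \<xi>))\<^sup>2 - 2 * Re (?c \<xi>) \<partial>lborel)"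
      by (intro Bochner_Integration.integral_cong refl) (simp add: algebra_simps)
    also have "\<dots> = 2 * (\<integral>\<xi>. (cmod (g \<xi>))\<^sup>2 \<partial>lborel) - 2 * (\<integral>\<xi>. Re (?c \<xi>) \<partial>lborel)"
      using R integrable_Re[OF ci] by (simp del: times_complex.sel)
    also have "(\<integral>\<xi>. Re (?c \<xi>) \<partial>lborel) = Re (\<integral>\<xi>. ?c \<xi> \<partial>lborel)"
      by (rule integral_Re[OF ci])
    also have "(\<integral>\<xi>. ?c \<xi> \<partial>lborel) = (\<integral>s. weyl (t *\<^sub>R position z) (t *\<^sub>R momentum z) f s * cnj (f s) \<partial>lborel)"
      unfolding weyl_modulation_inner[symmetric]
      using metaplectic_weyl_inner[OF T sq Tf, of "t *\<^sub>R z"] z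
      by (simp add: position_scaleR momentum_scaleR matrix_vector_mult_scaleR)
    also have "2 * (\<integral>\<xi>. (cmod (g \<xi>))\<^sup>2 \<partial>lborel) - 2 * Re \<dots>
       = (\<integral>s. (cmod (weyl (t *\<^sub>R position z) (t *\<^sub>R momentum z) f s - f s))\<^sup>2 \<partial>lborel)"
      unfolding weyl_difference_norm[OF sq(1)] metaplectic_norm[OF T sq Tf] ..
    also have "\<dots> \<le> C * t\<^sup>2" by (rule C[OF t])
    finally show "(\<integral>\<xi>. (2 - 2 * cos (t * (2 * pi * (w \<bullet> \<xi>)))) * (cmod (g \<xi>))\<^sup>2 \<partial>lborel) \<le> C * t\<^sup>2" .
  qed (use R in auto)
  then have "integrable lborel (\<lambda>\<xi>. (2 * pi * (w \<bullet> \<xi>))\<^sup>2 * (cmod (g \<xi>))\<^sup>2)"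
    by (intro integrableI_bounded) (auto simp: abs_mult intro: le_less_trans)
  then have "integrable lborel (\<lambda>\<xi>. (1 / (2 * pi)\<^sup>2) * ((2 * pi * (w \<bullet> \<xi>))\<^sup>2 * (cmod (g \<xi>))\<^sup>2))"
    by (rule integrable_mult_right)
  then show ?thesis by (simp add: power_mult_distrib)
qed

section \<open>Linear functionals, orthonormal coordinates and symplectic preimages\<close>

lemma AE_linear_functional_nonzero:
  fixes \<phi> :: "'a::euclidean_space \<Rightarrow> real"
  assumes "linear \<phi>" "\<phi> v \<noteq> 0"
  shows "AE x in lborel. \<phi> x \<noteq> 0"
proof -
  let ?a = "adjoint \<phi> 1"
  have a: "?a \<bullet> x = \<phi> x" for x
    using adjoint_works[OF assms(1), of x 1] by (simp add: inner_commute)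
  have "?a \<noteq> 0" using a[of v] assms(2) by auto
  then have "negligible {x. ?a \<bullet> x = 0}" by (intro negligible_hyperplane) simp
  then have "{x. \<phi> x = 0} \<in> null_sets lebesgue" by (simp add: a negligible_iff_null_sets)
  moreover have "{x. \<phi> x = 0} \<in> sets borel"
    using assms(1) by (intro borel_closed closed_Collect_eq linear_continuous_on continuous_intros)
      (auto simp: linear_conv_bounded_linear)
  ultimately have "{x. \<phi> x = 0} \<in> null_sets lborel"
    by (auto simp: null_sets_def)
  then show ?thesis by (auto intro: AE_I')
qed

lemma orthonormal_norm_square:
  fixes I :: "'a::euclidean_space set"
  assumes I: "pairwise orthogonal I" "\<And>b. b \<in> I \<Longrightarrow> norm b = 1" "finite I" and v: "v \<in> span I"
  shows "(norm v)\<^sup>2 = (\<Sum>b\<in>I. (b \<bullet> v)\<^sup>2)"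
proof -
  have e: "(\<Sum>b\<in>I. (v \<bullet> b) *\<^sub>R b) = v"
    using I v by (intro orthonormal_basis_expand) (auto simp: norm_eq_1)
  have "(norm v)\<^sup>2 = v \<bullet> (\<Sum>b\<in>I. (v \<bullet> b) *\<^sub>R b)" unfolding e by (simp add: power2_norm_eq_inner)
  then show ?thesis by (simp add: inner_sum_right power2_eq_square inner_commute)
qed

lemma inner_orthonormal_sum:
  fixes I :: "'a::euclidean_space set"
  assumes I: "pairwise orthogonal I" "\<And>b. b \<in> I \<Longrightarrow> norm b = 1" "finite I" and b: "b \<in> I"
  shows "b \<bullet> (\<Sum>a\<in>I. c a *\<^sub>R a) = c b"
proof -
  have "b \<bullet> (\<Sum>a\<in>I. c a *\<^sub>R a) = (\<Sum>a\<in>I. if a = b then c b else 0)"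
    unfolding inner_sum_right using I b
    by (intro sum.cong refl) (auto simp: pairwise_def orthogonal_def norm_eq_1)
  then show ?thesis using I b by simp
qed


lemma cmod_integral_cis_minus:
  fixes \<theta> R :: "'a \<Rightarrow> real"
  shows "cmod (\<integral>x. cis (- \<theta> x) * of_real (R x) \<partial>M) = cmod (\<integral>x. cis (\<theta> x) * of_real (R x) \<partial>M)"
proof -
  have "(\<integral>x. cis (- \<theta> x) * of_real (R x) \<partial>M) = (\<integral>x. cnj (cis (\<theta> x) * of_real (R x)) \<partial>M)"
    by (simp add: cis_cnj)
  also have "\<dots> = cnj (\<integral>x. cis (\<theta> x) * of_real (R x) \<partial>M)" by (rule Bochner_Integration.integral_cnj)
  finally show ?thesis by simp
qed

text \<open>The inverse of a symplectic matrix is explicit in its blocks. What matters is that the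
  position of the preimage lies in the range of \<open>transpose B\<close>, that is in the
  orthogonal complement of \<open>ker B\<close>.\<close>

lemma symplectic_momentum_preimage:
  fixes A B C D :: "real^'n::finite^'n"
  assumes "symplectic (block_mat A B C D)"
  shows "\<exists>z. position (block_mat A B C D *v z) = 0 \<and> momentum (block_mat A B C D *v z) = w
    \<and> position z = - (transpose B *v w)"
proof -
  obtain y :: "real^('n + 'n)" where y: "position y = 0" "momentum y = w" using exists_phase_point by blast
  let ?z = "block_mat (transpose D) (- transpose B) (- transpose C) (transpose A) *v y"
  have "block_mat A B C D *v ?z = y"
    using symplectic_inverse[OF assms] by (simp add: matrix_vector_mul_assoc)
  moreover have "(- transpose B) *v w = - (transpose B *v w)"
    using matrix_vector_mult_diff_rdistrib[of 0 "transpose B" w] by simp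
  ultimately show ?thesis using y by (intro exI[of _ ?z]) (simp add: position_block_mat)
qed

lemma linear_borel_measurable:
  fixes h :: "'a::euclidean_space \<Rightarrow> 'b::euclidean_space"
  shows "linear h \<Longrightarrow> h \<in> borel_measurable borel"
  by (intro borel_measurable_continuous_onI linear_continuous_on) (simp add: linear_conv_bounded_linear)

section \<open>The logarithmic uncertainty inequality for metaplectic operators\<close>

theorem proposition1p6:
  fixes A B C D :: "real^'n^'n"
    and G :: "('n::finite L2 \<Rightarrow> 'n L2) set"
    and T :: "'n L2 \<Rightarrow> 'n L2"
    and f :: "real^'n \<Rightarrow> complex"
  assumes "metaplectic_group G"
    and "T \<in> G"
    and "symplectic (block_mat A B C D)"
    and "metaplectic_over T (block_mat A B C D)"
    and "rank B > 0"
    and "schwartz f"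
  defines "u \<equiv> \<lambda>\<xi>. ln (norm (moore_penrose B *v
                   proj_along (range ((*v) B)) ((*v) A ` ker B) \<xi>))
                 * (cmod (rep_L2 (T (abs_L2 f)) \<xi>))\<^sup>2"
    and "v \<equiv> \<lambda>x. ln (norm (proj_along (orthogonal_comp (ker B))
                   ((*v) (transpose D ** A) ` ker B) x))
                 * (cmod (f x))\<^sup>2"
  shows "integrable lborel u \<and> integrable lborel v \<and>
    (\<integral>\<xi>. u \<xi> \<partial>lborel) + (\<integral>x. v x \<partial>lborel)
      \<ge> (Digamma (real (rank B) / 4) - ln pi) * (\<integral>x. (cmod (f x))\<^sup>2 \<partial>lborel)"
proof -
  let ?S = "block_mat A B C D"
  note S = assms(3)
  define g where "g = rep_L2 (T (abs_L2 f))"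
  have sg: "sq_integrable g" unfolding g_def by (rule sq_integrable_rep_L2)
  have sf: "sq_integrable f"
    using schwartz_integrable_moments(1) schwartz_measurable assms(6) by (auto simp: sq_integrable_def)
  have Tf: "T (abs_L2 f) = abs_L2 g" by (simp add: g_def abs_rep_L2)
  have T: "metaplectic_over T ?S" "inj T" using assms(4) metaplectic_group_inj[OF assms(1,2)] by auto
  have [measurable]: "f \<in> borel_measurable borel" "g \<in> borel_measurable borel"
    using sf sg by (auto intro: sq_integrable_measurable)
  have Rf: "integrable lborel (\<lambda>x. (cmod (f x))\<^sup>2)" and Rg: "integrable lborel (\<lambda>x. (cmod (g x))\<^sup>2)"
    using sf sg by (auto simp: sq_integrable_def)

  define Y where "Y = proj_along ((ker B)\<^sup>\<bottom>) ((*v) (transpose D ** A) ` ker B)"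
  define L where "L \<xi> = moore_penrose B *v proj_along (range ((*v) B)) ((*v) A ` ker B) \<xi>" for \<xi>
  note proj = symplectic_projections[OF S, folded Y_def L_def[abs_def]]
  have linY: "linear Y" and linL: "linear L" using proj(1,2) by (auto simp: L_def[abs_def])
  have YV: "Y x \<in> (ker B)\<^sup>\<bottom>" and LV: "L x \<in> (ker B)\<^sup>\<bottom>" for x using proj(3,4) by (auto simp: L_def)
  have Yid: "Y b = b" if "b \<in> (ker B)\<^sup>\<bottom>" for b using proj(5)[OF that] .
  have LB: "b \<bullet> L (B *v w) = b \<bullet> w" if "b \<in> (ker B)\<^sup>\<bottom>" for b w
  proof -
    have "w - L (B *v w) \<in> ker B" using proj(6)[of w] by (simp add: L_def)
    then have "b \<bullet> (w - L (B *v w)) = 0"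
      using that by (auto simp: orthogonal_comp_def orthogonal_def inner_commute)
    then show ?thesis by (simp add: inner_diff_right)
  qed
  have adjY: "adjoint Y q \<bullet> x = q \<bullet> Y x" and adjL: "adjoint L q \<bullet> x = q \<bullet> L x" for q x
    using adjoint_works[OF linY, of x q] adjoint_works[OF linL, of x q] by (simp_all add: inner_commute)
  have [measurable]: "Y \<in> borel_measurable borel" "L \<in> borel_measurable borel"
    using linY linL by (auto intro: linear_borel_measurable)

  have V: "subspace ((ker B)\<^sup>\<bottom>)" by (rule subspace_orthogonal_comp)
  \<comment> \<open>The basis is its own index set for the coordinates; its cardinality
    \<open>rank B\<close> fixes \<open>k\<close>.\<close>
  obtain I where I: "I \<subseteq> (ker B)\<^sup>\<bottom>" "pairwise orthogonal I" "\<And>b. b \<in> I \<Longrightarrow> norm b = 1"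
    "independent I" "card I = dim ((ker B)\<^sup>\<bottom>)" "span I = (ker B)\<^sup>\<bottom>"
    using orthonormal_basis_subspace[OF V] by metis
  have fin: "finite I" using I(4) by (rule independent_imp_finite)
  have card: "card I = rank B" using I(5) dim_orthogonal_comp_ker by metis
  define k where "k = real (card I) / 4"
  have k: "k > 0" using assms(5) by (simp add: k_def card)
  obtain b0 where b0: "b0 \<in> I" using assms(5) card by fastforce
  have bb: "b \<bullet> b = 1" if "b \<in> I" for b using I(3)[OF that] by (simp add: norm_eq_1)
  have bV: "b \<in> (ker B)\<^sup>\<bottom>" if "b \<in> I" for b using I(1) that by blast
  have normsq: "(norm x)\<^sup>2 = (\<Sum>b\<in>I. (b \<bullet> x)\<^sup>2)" if "x \<in> (ker B)\<^sup>\<bottom>" for x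
    using orthonormal_norm_square[of I x] I fin that by auto
  have nY: "(norm (Y x))\<^sup>2 = (\<Sum>b\<in>I. (b \<bullet> Y x)\<^sup>2)" and nL: "(norm (L x))\<^sup>2 = (\<Sum>b\<in>I. (b \<bullet> L x)\<^sup>2)" for x
    by (rule normsq[OF YV], rule normsq[OF LV])
  have posY: "AE x in lborel. (norm (Y x))\<^sup>2 > 0"
  proof -
    have "AE x in lborel. b0 \<bullet> Y x \<noteq> 0"
      by (rule AE_linear_functional_nonzero[of _ b0])
         (use linY b0 bb Yid bV in \<open>auto simp: linear_iff inner_add_right\<close>)
    then show ?thesis by eventually_elim auto
  qed
  have posL: "AE x in lborel. (norm (L x))\<^sup>2 > 0"
  proof -
    \<comment> \<open>The witness is \<open>B *v b0\<close> because
      \<open>b0 \<bullet> L (B *v b0) = b0 \<bullet> b0 = 1\<close>.\<close>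
    have "AE x in lborel. b0 \<bullet> L x \<noteq> 0"
      by (rule AE_linear_functional_nonzero[of _ "B *v b0"])
         (use linL b0 bb LB bV in \<open>auto simp: linear_iff inner_add_right\<close>)
    then show ?thesis by eventually_elim auto
  qed

  define p where "p c = (\<Sum>b\<in>I. c b *\<^sub>R b)" for c :: "real^'n \<Rightarrow> real"
  have pV: "p c \<in> (ker B)\<^sup>\<bottom>" for c
    unfolding p_def using V bV by (intro subspace_sum) (auto intro: subspace_scale)
  have bp: "b \<bullet> p c = c b" if "b \<in> I" for b c
    unfolding p_def using I fin that by (intro inner_orthonormal_sum) auto
  have psum: "p c \<bullet> x = (\<Sum>b\<in>I. c b * (b \<bullet> x))" for c x
    by (simp add: p_def inner_sum_left)
  have [measurable]: "p \<in> borel_measurable (lborelI I)"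
    unfolding p_def[abs_def] by measurable

  have fwd: "ennreal (cmod (\<integral>\<xi>. cis (2 * pi * (\<Sum>b\<in>I. c b * (b \<bullet> L \<xi>))) * of_real ((cmod (g \<xi>))\<^sup>2) \<partial>lborel))
      \<le> (\<integral>\<^sup>+x. ennreal (cmod (f (x + p c)) * cmod (f x)) \<partial>lborel)" for c
  proof -
    \<comment> \<open>The frequency whose character is \<open>p c \<bullet> L \<xi>\<close>. By
      \<open>LB\<close>, \<open>transpose B\<close> maps it back to \<open>p c\<close>, so the
      operator acting on \<open>f\<close> translates by exactly \<open>- p c\<close>.\<close>
    let ?w = "adjoint L (p c)"
    obtain z where z: "position (?S *v z) = 0" "momentum (?S *v z) = ?w" "position z = - (transpose B *v ?w)"
      using symplectic_momentum_preimage[OF S] by blast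
    have "x \<bullet> (transpose B *v ?w) = x \<bullet> p c" for x
      using adjL[of "p c" "B *v x"] LB[OF pV, of c x]
      by (simp add: inner_matrix_vector_transpose[symmetric] inner_commute)
    then have "transpose B *v ?w = p c" using vector_eq_ldot by blast
    then have zp: "position z = - p c" using z by simp
    have "(\<integral>\<xi>. cis (2 * pi * (\<Sum>b\<in>I. c b * (b \<bullet> L \<xi>))) * of_real ((cmod (g \<xi>))\<^sup>2) \<partial>lborel)
      = (\<integral>\<xi>. weyl 0 ?w g \<xi> * cnj (g \<xi>) \<partial>lborel)"
      unfolding weyl_modulation_inner by (simp only: adjL psum)
    also have "\<dots> = (\<integral>t. weyl (- p c) (momentum z) f t * cnj (f t) \<partial>lborel)"
      using metaplectic_weyl_inner[OF T sf sg Tf, of z] z zp by simp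
    finally show ?thesis using weyl_inner_le[OF sf, of "- p c" "momentum z"] by simp
  qed

  \<comment> \<open>In the reverse direction the modulation acts on \<open>f\<close> and the
    translation on \<open>g\<close>; the latter is the position component of the image under
    \<open>?S\<close> of a pure momentum, up to sign.\<close>
  define \<tau> where "\<tau> c = B *v adjoint Y (p c)" for c
  have [measurable]: "\<tau> \<in> borel_measurable (lborelI I)"
  proof -
    have "linear (\<lambda>q. B *v adjoint Y q)"
      by (rule linear_compose[OF adjoint_linear[OF linY] matrix_vector_mul_linear, unfolded o_def])
    then have [measurable]: "(\<lambda>q. B *v adjoint Y q) \<in> borel_measurable borel" by (rule linear_borel_measurable)
    show ?thesis unfolding \<tau>_def[abs_def] by measurable
  qed
  have bwd: "ennreal (cmod (\<integral>x. cis (2 * pi * (\<Sum>b\<in>I. c b * (b \<bullet> Y x))) * of_real ((cmod (f x))\<^sup>2) \<partial>lborel))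
      \<le> (\<integral>\<^sup>+x. ennreal (cmod (g (x + \<tau> c)) * cmod (g x)) \<partial>lborel)" for c
  proof -
    \<comment> \<open>The minus sign makes the translated argument \<open>x + \<tau> c\<close>; it
      conjugates the characteristic function, whose modulus is unchanged.\<close>
    let ?w = "- adjoint Y (p c)"
    obtain z :: "real^('n + 'n)" where z: "position z = 0" "momentum z = ?w" using exists_phase_point by blast
    have Bm: "B *v ?w = - \<tau> c"
      using matrix_vector_mult_diff_distrib[of B 0 "adjoint Y (p c)"] by (simp add: \<tau>_def)
    have zS: "position (?S *v z) = - \<tau> c" using z Bm by (simp add: position_block_mat)
    have neg: "- (2 * pi * (?w \<bullet> x)) = 2 * pi * (\<Sum>b\<in>I. c b * (b \<bullet> Y x))" for x
      using adjY[of "p c" x] psum[of c "Y x"] by simp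
    have "cmod (\<integral>x. cis (2 * pi * (\<Sum>b\<in>I. c b * (b \<bullet> Y x))) * of_real ((cmod (f x))\<^sup>2) \<partial>lborel)
      = cmod (\<integral>x. cis (2 * pi * (?w \<bullet> x)) * of_real ((cmod (f x))\<^sup>2) \<partial>lborel)"
      unfolding neg[symmetric] by (rule cmod_integral_cis_minus)
    also have "\<dots> = cmod (\<integral>t. weyl 0 ?w f t * cnj (f t) \<partial>lborel)"
      unfolding weyl_modulation_inner ..
    also have "(\<integral>t. weyl 0 ?w f t * cnj (f t) \<partial>lborel)
      = (\<integral>t. weyl (- \<tau> c) (momentum (?S *v z)) g t * cnj (g t) \<partial>lborel)"
      using metaplectic_weyl_inner[OF T sf sg Tf, of z] z zS by simp
    finally show ?thesis using weyl_inner_le[OF sg, of "- \<tau> c" "momentum (?S *v z)"] by simp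
  qed

  have mY: "integrable lborel (\<lambda>x. (norm (Y x))\<^sup>2 * (cmod (f x))\<^sup>2)"
  proof -
    obtain K where K: "\<And>x. norm (Y x) \<le> K * norm x" using linear_bounded[OF linY] by blast
    have K': "(norm (Y x))\<^sup>2 \<le> K\<^sup>2 * (norm x)\<^sup>2" for x
      using power_mono[OF K[of x] norm_ge_zero, of 2] by (simp add: power_mult_distrib)
    show ?thesis
    proof (rule Bochner_Integration.integrable_bound)
      show "integrable lborel (\<lambda>x. K\<^sup>2 * ((norm x)\<^sup>2 * (cmod (f x))\<^sup>2))"
        by (intro integrable_mult_right schwartz_integrable_moments assms)
      show "AE x in lborel. norm ((norm (Y x))\<^sup>2 * (cmod (f x))\<^sup>2) \<le> norm (K\<^sup>2 * ((norm x)\<^sup>2 * (cmod (f x))\<^sup>2))"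
      proof (rule AE_I2)
        fix x
        have "(norm (Y x))\<^sup>2 * (cmod (f x))\<^sup>2 \<le> K\<^sup>2 * (norm x)\<^sup>2 * (cmod (f x))\<^sup>2"
          by (intro mult_right_mono K') simp
        then show "norm ((norm (Y x))\<^sup>2 * (cmod (f x))\<^sup>2) \<le> norm (K\<^sup>2 * ((norm x)\<^sup>2 * (cmod (f x))\<^sup>2))"
          by (simp add: mult.assoc)
      qed
    qed measurable
  qed
  \<comment> \<open>In orthonormal coordinates the moment is a sum of moments of the functionals
    \<open>b \<bullet> L \<xi>\<close>, each of the form treated in
    \<open>metaplectic_second_moment\<close> with \<open>w = adjoint L b\<close>.\<close>
  have mL: "integrable lborel (\<lambda>\<xi>. (norm (L \<xi>))\<^sup>2 * (cmod (g \<xi>))\<^sup>2)"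
    unfolding nL sum_distrib_right
  proof (rule Bochner_Integration.integrable_sum)
    fix b assume "b \<in> I"
    obtain z where "position (?S *v z) = 0" "momentum (?S *v z) = adjoint L b"
      using symplectic_momentum_preimage[OF S] by blast
    from metaplectic_second_moment[OF T assms(6) sf sg Tf this]
    show "integrable lborel (\<lambda>\<xi>. (b \<bullet> L \<xi>)\<^sup>2 * (cmod (g \<xi>))\<^sup>2)" by (simp only: adjL)
  qed

  have P1: "(\<integral>\<^sup>+x. ennreal (((norm (L x))\<^sup>2) powr - e * (cmod (g x))\<^sup>2) \<partial>lborel)
      \<le> ennreal (pi powr (2 * e) * Gamma (k - e) / Gamma (k + e)) *
        (\<integral>\<^sup>+x. ennreal (((norm (Y x))\<^sup>2) powr e * (cmod (f x))\<^sup>2) \<partial>lborel)"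
    if e: "0 < e" "e < k" for e
    unfolding nY nL
  proof (rule Pitt_inequality[OF fin k_def e, where \<tau> = p and F = "\<lambda>x. cmod (f x)"])
    fix i c x assume "i \<in> I"
    then show "i \<bullet> Y (x + p c) = i \<bullet> Y x + c i"
      by (simp add: linear_add[OF linY] Yid[OF pV] inner_add_right bp)
  qed (use posY Rg fwd in \<open>auto simp: nY\<close>)
  have P2: "(\<integral>\<^sup>+x. ennreal (((norm (Y x))\<^sup>2) powr - e * (cmod (f x))\<^sup>2) \<partial>lborel)
      \<le> ennreal (pi powr (2 * e) * Gamma (k - e) / Gamma (k + e)) *
        (\<integral>\<^sup>+x. ennreal (((norm (L x))\<^sup>2) powr e * (cmod (g x))\<^sup>2) \<partial>lborel)"
    if e: "0 < e" "e < k" for e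
    unfolding nY nL
  proof (rule Pitt_inequality[OF fin k_def e, where \<tau> = \<tau> and F = "\<lambda>x. cmod (g x)"])
    fix i c x assume i: "i \<in> I"
    \<comment> \<open>\<open>LB\<close> strips \<open>L\<close> and \<open>B\<close> when tested
      against \<open>i\<close>, and the remaining adjoint moves \<open>Y\<close> onto
      \<open>i\<close>, which it fixes.\<close>
    have "i \<bullet> L (\<tau> c) = adjoint Y (p c) \<bullet> i"
      unfolding \<tau>_def LB[OF bV[OF i]] by (rule inner_commute)
    also have "\<dots> = c i" unfolding adjY Yid[OF bV[OF i]] using bp[OF i] by (simp add: inner_commute)
    finally show "i \<bullet> L (x + \<tau> c) = i \<bullet> L x + c i"
      by (simp add: linear_add[OF linL] inner_add_right)
  qed (use posL Rf bwd in \<open>auto simp: nL\<close>)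

  note log = log_from_Pitt[OF k _ _ posY posL _ Rf _ Rg metaplectic_norm[OF T sf sg Tf] mY mL P1 P2]
  \<comment> \<open>The preceding estimates concern squared norms, which doubles the logarithms; at
    \<open>y = 0\<close> both sides vanish because \<open>ln 0 = 0\<close>.\<close>
  have half: "ln (norm y) * r = (1 / 2) * (ln ((norm y)\<^sup>2) * r)" for y :: "real^'n" and r :: real
    by (cases "y = 0") (simp_all add: ln_realpow)
  have u: "u = (\<lambda>\<xi>. (1 / 2) * (ln ((norm (L \<xi>))\<^sup>2) * (cmod (g \<xi>))\<^sup>2))"
    unfolding u_def half L_def g_def ..
  have v: "v = (\<lambda>x. (1 / 2) * (ln ((norm (Y x))\<^sup>2) * (cmod (f x))\<^sup>2))"
    unfolding v_def half Y_def ..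
  have iu: "integrable lborel u" and iv: "integrable lborel v"
    unfolding u v using log(1,2) by (auto intro!: integrable_mult_right)
  have "(Digamma k - ln pi) * (\<integral>x. (cmod (f x))\<^sup>2 \<partial>lborel)
    = (1 / 2) * (2 * (Digamma k - ln pi) * (\<integral>x. (cmod (f x))\<^sup>2 \<partial>lborel))"
    by simp
  also have "\<dots> \<le> (1 / 2) * ((\<integral>\<xi>. ln ((norm (L \<xi>))\<^sup>2) * (cmod (g \<xi>))\<^sup>2 \<partial>lborel)
      + (\<integral>x. ln ((norm (Y x))\<^sup>2) * (cmod (f x))\<^sup>2 \<partial>lborel))"
    using log(3) by (intro mult_left_mono) auto
  also have "\<dots> = (\<integral>\<xi>. u \<xi> \<partial>lborel) + (\<integral>x. v x \<partial>lborel)"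
    unfolding u v integral_mult_right_zero by (simp only: distrib_left)
  finally show ?thesis
    using iu iv unfolding k_def card by blast
qed

end
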